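(* Let $M$ be a $C^\infty$-manifold with $\dim M\ge3$, let $\nabla$ be a torsion-free covariant derivative on $M$, let $p\in M$ and $V=T_pM$. Consider $S\in\mathcal{S}^2(V)$, $A\in\Lambda^2(V)$, $w\in\mathcal{T}_1V$, and tensors $U\in\mathcal{T}_3V$ formed by one of $$U=(\nabla\psi-\mathrm{sym}(\nabla\psi))|_p\in\mathcal{T}_{\mathfrak{r}_s}\quad\text{or}\quad U=(\nabla\omega-\mathrm{alt}(\nabla\omega))|_p\in\mathcal{T}_{\mathfrak{r}_a},$$ where $\psi$ is a symmetric and $\omega$ a skew-symmetric differentiable covariant tensor field of order 2 on $M$, and $\mathfrak{r}_s$, $\mathfrak{r}_a$ are the minimal right ideals of $\mathbb{K}[\mathcal{S}_3]$ defining the symmetry classes of these tensors. Let $y_t$, $y_{t'}$ be the Young symmetrizers of the tableaux $t$ with rows $(1,3),(2,4)$ and $t'$ with rows $(1,3,5),(2,4)$, and let $\ell_w$, $\ell_S$, $\ell_A$ be the lengths (as defined in the context) of the reduced coordinate expressions of $y_t^{\ast}(U\otimes w)$, $y_{t'}^{\ast}(U\otimes S)$, $y_{t'}^{\ast}(U\otimes A)$. Then the shortest lengths, namely $4$ for $y_t^{\ast}(U\otimes w)$, $12$ for $y_{t'}^{\ast}(U\otimes S)$ and $10$ for $y_{t'}^{\ast}(U\otimes A)$, are obtained exactly in the following cases: (1) $y_{t'}^{\ast}(U\otimes S)$ with $U=(\nabla\psi-\mathrm{sym}(\nabla\psi))|_p$, $\psi$ symmetric; (2) $y_t^{\ast}(U\otimes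 w)$, $y_{t'}^{\ast}(U\otimes S)$, $y_{t'}^{\ast}(U\otimes A)$ with $U=(\nabla\omega-\mathrm{alt}(\nabla\omega))|_p$, $\omega$ skew-symmetric. That is, $\ell_S(\mathfrak{r}_s)=12$, $\ell_w(\mathfrak{r}_s)\neq4$, $\ell_A(\mathfrak{r}_s)\ne10$, and $\ell_w(\mathfrak{r}_a)=4$, $\ell_S(\mathfrak{r}_a)=12$, $\ell_A(\mathfrak{r}_a)=10$.
   Context: $\mathcal{T}_rV$ is the space of $r$-times covariant tensors on $V$; $\mathcal{S}^2(V)$, $\Lambda^2(V)\subset\mathcal{T}_2V$ are the symmetric, resp. alternating, 2-forms. Here $\mathbb{K}=\mathbb{R}$ (or $\mathbb{C}$). "sym" and "alt" denote the (normalized) total symmetrization and anti-symmetrization of tensors; $\nabla\psi$ has coordinates $(\nabla\psi)_{ijk}=\psi_{ij;k}$ (differentiation index last), similarly for $\omega$. A group ring element $a=\sum_{p}a(p)\,p\in\mathbb{K}[\mathcal{S}_r]$ acts on $T\in\mathcal{T}_rV$ by $(aT)_{i_1\dots i_r}=\sum_p a(p)T_{i_{p(1)}\dots i_{p(r)}}$. Products of permutations are $(p\circ q)(i)=p(q(i))$, and $a^{\ast}:=\sum_p a(p)\,p^{-1}$. The Young symmetrizer of a tableau $t$ is $y_t=\sum_{p\in\mathcal{H}_t}\sum_{q\in\mathcal{V}_t}\mathrm{sign}(q)\,p\circ q$, where $\mathcal{H}_t$, $\mathcal{V}_t$ are the groups of permutations that permute numbers only within the rows, resp. columns, of $t$.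 The symmetry class of a right ideal $\mathfrak{r}\subseteq\mathbb{K}[\mathcal{S}_r]$ is $\mathcal{T}_{\mathfrak{r}}=\{aT\,|\,a\in\mathfrak{r},\,T\in\mathcal{T}_rV\}$. Writing permutations as $[p(1),p(2),p(3)]$, for $\nu\in\mathbb{K}$ let $\xi_\nu=\frac13\{[1,2,3]+\nu[1,3,2]+(1-\nu)[2,1,3]-\nu[2,3,1]+(-1+\nu)[3,1,2]-[3,2,1]\}$, an idempotent generating a minimal (2-dimensional) right ideal of $\mathbb{K}[\mathcal{S}_3]$ belonging to the partition $(2\,1)$. The right ideals above are $\mathfrak{r}_s=\xi_0\cdot\mathbb{K}[\mathcal{S}_3]$ and $\mathfrak{r}_a=\xi_2\cdot\mathbb{K}[\mathcal{S}_3]$. Lengths. Let $\mathfrak{r}\subset\mathbb{K}[\mathcal{S}_3]$ be a minimal right ideal belonging to $(2\,1)$. The linear identities $\sum_{p\in\mathcal{S}_3}x_p\,U_{i_{p(1)}i_{p(2)}i_{p(3)}}=0$ valid for all $U\in\mathcal{T}_{\mathfrak{r}}$ are exactly the solutions $x\in\mathbb{K}^{\mathcal{S}_3}$ of $\sum_p h(p)x_p=0$ for all $h\in\mathfrak{l}:=\mathfrak{r}^{\ast}=\{a^{\ast}\,|\,a\in\mathfrak{r}\}$. A 2-element subset $\mathcal{P}\subset\mathcal{S}_3$ is called admissible for $\mathfrak{r}$ if, for a basis $h_1,h_2$ of $\mathfrak{l}$, the $2\times2$ determinant $\det(h_i(p))_{i\in\{1,2\},\,p\in\mathcal{P}}$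 is nonzero. Then for each $\bar p\in\mathcal{S}_3\setminus\mathcal{P}$ there is a unique such identity expressing $U_{i_{\bar p(1)}i_{\bar p(2)}i_{\bar p(3)}}$ as a linear combination of the two coordinates $U_{i_{p(1)}i_{p(2)}i_{p(3)}}$, $p\in\mathcal{P}$. Reduction with respect to an admissible $\mathcal{P}$: write the coordinates of the tensor as a formal polynomial in ordered index names $i_1<i_2<i_3<i_4$ (resp. $i_1<\dots<i_5$), namely $y_t^{\ast}(U\otimes w)_{i_1\dots i_4}=\sum_{p\in\mathcal{S}_4}c_p\,U_{i_{p(1)}i_{p(2)}i_{p(3)}}w_{i_{p(4)}}$, resp. $y_{t'}^{\ast}(U\otimes S)_{i_1\dots i_5}$ or $y_{t'}^{\ast}(U\otimes A)_{i_1\dots i_5}=\sum_{p\in\mathcal{S}_5}c_p\,U_{i_{p(1)}i_{p(2)}i_{p(3)}}B_{i_{p(4)}i_{p(5)}}$ with $B=S$ or $B=A$; in the latter two cases use $S_{ab}=S_{ba}$, resp. $A_{ab}=-A_{ba}$, to put the indices of $S$, $A$ into increasing order. In every term regard the three indices of $U$ as a permutation of their increasingly ordered sequence $a_1<a_2<a_3$, and replace every $U_{a_{\bar p(1)}a_{\bar p(2)}a_{\bar p(3)}}$ with $\bar p\notin\mathcal{P}$ by its expression in the $U_{a_{p(1)}a_{p(2)}a_{p(3)}}$, $p\in\mathcal{P}$. Collect like monomials; the length of the result is the number of monomials with nonzero coefficient. The length $\ell_w(\mathfrak{r})$, $\ell_S(\mathfrak{r})$, $\ell_A(\mathfrak{r})$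 is the smallest length so obtained over all sets $\mathcal{P}$ admissible for $\mathfrak{r}$. *)

theory Defs
  imports "HOL-Analysis.Analysis"
begin

section \<open>The group ring and its action on tensors\<close>

text \<open>Permutations of \<open>{1..r}\<close> are functions on \<^typ>\<open>nat\<close> that fix everything else. Elements of
  \<open>K[S_r]\<close> are coefficient functions vanishing off the permutations, so that equality of functions
  is equality in the group ring.\<close>

definition perms :: "nat \<Rightarrow> (nat \<Rightarrow> nat) set" where
  "perms r = {p. p permutes {1..r}}"

definition group_ring :: "nat \<Rightarrow> ((nat \<Rightarrow> nat) \<Rightarrow> 'k::field) set" where
  "group_ring r = {a. \<forall>p. p \<notin> perms r \<longrightarrow> a p = 0}"

definition gr_single :: "(nat \<Rightarrow> nat) \<Rightarrow> (nat \<Rightarrow> nat) \<Rightarrow> 'k::field" where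
  "gr_single p = (\<lambda>q. if q = p then 1 else 0)"

definition gr_mult :: "nat \<Rightarrow> ((nat \<Rightarrow> nat) \<Rightarrow> 'k::field) \<Rightarrow> ((nat \<Rightarrow> nat) \<Rightarrow> 'k) \<Rightarrow> (nat \<Rightarrow> nat) \<Rightarrow> 'k" where
  "gr_mult r a b = (\<lambda>s. \<Sum>p\<in>perms r. \<Sum>q\<in>perms r. if p \<circ> q = s then a p * b q else 0)"

definition gr_star :: "((nat \<Rightarrow> nat) \<Rightarrow> 'k::field) \<Rightarrow> (nat \<Rightarrow> nat) \<Rightarrow> 'k" where
  "gr_star a = (\<lambda>p. if bij p then a (inv p) else 0)"

definition right_ideal_gen :: "nat \<Rightarrow> ((nat \<Rightarrow> nat) \<Rightarrow> 'k::field) \<Rightarrow> ((nat \<Rightarrow> nat) \<Rightarrow> 'k) set" where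
  "right_ideal_gen r a = {gr_mult r a b | b. b \<in> group_ring r}"

text \<open>\<open>arrange p [x\<^sub>1,\<dots>,x\<^sub>r] = [x\<^bsub>p(1)\<^esub>,\<dots>,x\<^bsub>p(r)\<^esub>]\<close>\<close>

definition arrange :: "(nat \<Rightarrow> nat) \<Rightarrow> 'a list \<Rightarrow> 'a list" where
  "arrange p xs = map (\<lambda>k. xs ! (p k - 1)) [1..<Suc (length xs)]"

text \<open>An \<open>r\<close>-times covariant tensor is a function on lists of \<open>r\<close> vectors of \<open>V\<close>, set to \<open>0\<close> on all
  other lists. The vectors are functions into a real vector space (below: the components in the
  various charts) and \<open>V\<close> carries the pointwise operations. The scalars \<open>'k\<close> are those of a real normed
  field, i.e. the reals or the complex numbers; for complex scalars this is the space of
  covariant tensors on the complexification of \<open>V\<close>.\<close>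

definition tensors :: "nat \<Rightarrow> ('c \<Rightarrow> 'e::real_vector) set \<Rightarrow> (('c \<Rightarrow> 'e) list \<Rightarrow> 'k::real_normed_field) set" where
  "tensors r V = {T.
     (\<forall>vs. \<not> (length vs = r \<and> set vs \<subseteq> V) \<longrightarrow> T vs = 0) \<and>
     (\<forall>vs i u v a b. length vs = r \<and> set vs \<subseteq> V \<and> i < r \<and> u \<in> V \<and> v \<in> V \<longrightarrow>
        T (vs[i := (\<lambda>c. a *\<^sub>R u c + b *\<^sub>R v c)]) = a *\<^sub>R T (vs[i := u]) + b *\<^sub>R T (vs[i := v]))}"

definition sym_forms :: "('c \<Rightarrow> 'e::real_vector) set \<Rightarrow> (('c \<Rightarrow> 'e) list \<Rightarrow> 'k::real_normed_field) set" where
  "sym_forms V = {T \<in> tensors 2 V. \<forall>u\<in>V. \<forall>v\<in>V. T [v, u] = T [u, v]}"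

definition alt_forms :: "('c \<Rightarrow> 'e::real_vector) set \<Rightarrow> (('c \<Rightarrow> 'e) list \<Rightarrow> 'k::real_normed_field) set" where
  "alt_forms V = {T \<in> tensors 2 V. \<forall>u\<in>V. \<forall>v\<in>V. T [v, u] = - T [u, v]}"

definition tensor_prod :: "nat \<Rightarrow> ('v list \<Rightarrow> 'k::field) \<Rightarrow> ('v list \<Rightarrow> 'k) \<Rightarrow> 'v list \<Rightarrow> 'k" where
  "tensor_prod r T B = (\<lambda>vs. T (take r vs) * B (drop r vs))"

definition act :: "nat \<Rightarrow> ((nat \<Rightarrow> nat) \<Rightarrow> 'k::field) \<Rightarrow> ('v list \<Rightarrow> 'k) \<Rightarrow> 'v list \<Rightarrow> 'k" where
  "act r a T = (\<lambda>vs. if length vs = r then \<Sum>p\<in>perms r. a p * T (arrange p vs) else 0)"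

definition symmetrize :: "nat \<Rightarrow> ('v list \<Rightarrow> 'k::field_char_0) \<Rightarrow> 'v list \<Rightarrow> 'k" where
  "symmetrize r = act r (\<lambda>p. 1 / fact r)"

definition alternate :: "nat \<Rightarrow> ('v list \<Rightarrow> 'k::field_char_0) \<Rightarrow> 'v list \<Rightarrow> 'k" where
  "alternate r = act r (\<lambda>p. of_int (sign p) / fact r)"

definition symmetry_class ::
  "nat \<Rightarrow> ((nat \<Rightarrow> nat) \<Rightarrow> 'k) set \<Rightarrow> ('c \<Rightarrow> 'e::real_vector) set \<Rightarrow> (('c \<Rightarrow> 'e) list \<Rightarrow> 'k::real_normed_field) set" where
  "symmetry_class r I V = {act r a T | a T. a \<in> I \<and> T \<in> tensors r V}"

section \<open>Young symmetrizers and the ideals\<close>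

text \<open>A tableau with entries \<open>1,\<dots>,r\<close> is the list of its rows.\<close>

definition tableau_column :: "nat list list \<Rightarrow> nat \<Rightarrow> nat set" where
  "tableau_column t j = {row ! j | row. row \<in> set t \<and> j < length row}"

definition row_group :: "nat list list \<Rightarrow> (nat \<Rightarrow> nat) set" where
  "row_group t = {p \<in> perms (sum_list (map length t)). \<forall>row\<in>set t. p ` set row = set row}"

definition column_group :: "nat list list \<Rightarrow> (nat \<Rightarrow> nat) set" where
  "column_group t = {p \<in> perms (sum_list (map length t)).
     \<forall>j. p ` tableau_column t j = tableau_column t j}"

definition young_symmetrizer :: "nat list list \<Rightarrow> (nat \<Rightarrow> nat) \<Rightarrow> 'k::field" where
  "young_symmetrizer t =
     (\<lambda>s. \<Sum>p\<in>row_group t. \<Sum>q\<in>column_group t. of_int (sign q) * gr_single (p \<circ> q) s)"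

definition one_line :: "nat list \<Rightarrow> nat \<Rightarrow> nat" where
  "one_line xs = (\<lambda>i. if 1 \<le> i \<and> i \<le> length xs then xs ! (i - 1) else i)"

definition xi :: "'k::field \<Rightarrow> (nat \<Rightarrow> nat) \<Rightarrow> 'k" where
  "xi \<nu> = (\<lambda>p. (1 / 3) *
     (gr_single (one_line [1,2,3]) p + \<nu> * gr_single (one_line [1,3,2]) p
      + (1 - \<nu>) * gr_single (one_line [2,1,3]) p - \<nu> * gr_single (one_line [2,3,1]) p
      + (- 1 + \<nu>) * gr_single (one_line [3,1,2]) p - gr_single (one_line [3,2,1]) p))"

definition ideal_s :: "((nat \<Rightarrow> nat) \<Rightarrow> 'k::field) set" where
  "ideal_s = right_ideal_gen 3 (xi 0)"

definition ideal_a :: "((nat \<Rightarrow> nat) \<Rightarrow> 'k::field) set" where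
  "ideal_a = right_ideal_gen 3 (xi 2)"

section \<open>Reduction of coordinate expressions and their lengths\<close>

text \<open>\<open>x \<in> identities I\<close> stands for the linear identity
  \<open>\<Sum>\<^sub>p x\<^sub>p U\<^bsub>i \<circ> p\<^esub> = 0\<close>, where \<open>U\<^bsub>i \<circ> p\<^esub>\<close> is the coordinate with indices \<open>i\<^bsub>p(1)\<^esub>, i\<^bsub>p(2)\<^esub>, i\<^bsub>p(3)\<^esub>\<close>.\<close>

definition identities :: "((nat \<Rightarrow> nat) \<Rightarrow> 'k::field) set \<Rightarrow> ((nat \<Rightarrow> nat) \<Rightarrow> 'k) set" where
  "identities I = {x \<in> group_ring 3. \<forall>h\<in>gr_star ` I. (\<Sum>p\<in>perms 3. h p * x p) = 0}"

definition is_basis2 :: "('p \<Rightarrow> 'k::field) set \<Rightarrow> ('p \<Rightarrow> 'k) \<Rightarrow> ('p \<Rightarrow> 'k) \<Rightarrow> bool" where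
  "is_basis2 L h1 h2 \<longleftrightarrow> h1 \<in> L \<and> h2 \<in> L \<and>
     (\<forall>h\<in>L. \<exists>\<alpha> \<beta>. h = (\<lambda>p. \<alpha> * h1 p + \<beta> * h2 p)) \<and>
     (\<forall>\<alpha> \<beta>. (\<lambda>p. \<alpha> * h1 p + \<beta> * h2 p) = (\<lambda>p. 0) \<longrightarrow> \<alpha> = 0 \<and> \<beta> = 0)"

definition admissible :: "((nat \<Rightarrow> nat) \<Rightarrow> 'k::field) set \<Rightarrow> (nat \<Rightarrow> nat) set \<Rightarrow> bool" where
  "admissible I P \<longleftrightarrow> P \<subseteq> perms 3 \<and>
     (\<exists>h1 h2 p1 p2. is_basis2 (gr_star ` I) h1 h2 \<and> P = {p1, p2} \<and> p1 \<noteq> p2 \<and>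
        h1 p1 * h2 p2 - h1 p2 * h2 p1 \<noteq> 0)"

text \<open>The coefficients \<open>\<kappa>\<^sub>q\<close> in \<open>U\<^bsub>a \<circ> p\<^esub> = \<Sum>\<^bsub>q \<in> P\<^esub> \<kappa>\<^sub>q U\<^bsub>a \<circ> q\<^esub>\<close>.\<close>

definition red_coeff ::
  "((nat \<Rightarrow> nat) \<Rightarrow> 'k::field) set \<Rightarrow> (nat \<Rightarrow> nat) set \<Rightarrow> (nat \<Rightarrow> nat) \<Rightarrow> (nat \<Rightarrow> nat) \<Rightarrow> 'k" where
  "red_coeff I P p = (if p \<in> P then gr_single p
     else (THE \<kappa>. (\<forall>q. q \<notin> P \<longrightarrow> \<kappa> q = 0) \<and> (\<lambda>q. gr_single p q - \<kappa> q) \<in> identities I))"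

definition pattern :: "nat list \<Rightarrow> nat \<Rightarrow> nat" where
  "pattern us = (THE p. p \<in> perms 3 \<and> us = arrange p (sort us))"

text \<open>A formal polynomial assigns a coefficient to each monomial; the monomial \<open>(us, bs)\<close> is
  \<open>U\<^sub>u\<^sub>s B\<^sub>b\<^sub>s\<close>, where the number \<open>k\<close> stands for the index name \<open>i\<^sub>k\<close>.
  \<open>reduced n \<epsilon> c I P\<close> is the reduction with respect to \<open>P\<close> of
  \<open>\<Sum>\<^sub>p c\<^sub>p U\<^sub>u\<^sub>s B\<^sub>b\<^sub>s\<close>, where \<open>us\<close> are the first three and \<open>bs\<close> the
  remaining indices of \<open>i\<^bsub>p(1)\<^esub>,\<dots>,i\<^bsub>p(n)\<^esub>\<close>, for a factor \<open>B\<close> of order one, or of order two with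
  \<open>B\<^sub>b\<^sub>a = \<epsilon> B\<^sub>a\<^sub>b\<close>.\<close>

definition reduced ::
  "nat \<Rightarrow> 'k \<Rightarrow> ((nat \<Rightarrow> nat) \<Rightarrow> 'k) \<Rightarrow> ((nat \<Rightarrow> nat) \<Rightarrow> 'k::field) set \<Rightarrow> (nat \<Rightarrow> nat) set
     \<Rightarrow> nat list \<times> nat list \<Rightarrow> 'k" where
  "reduced n \<epsilon> c I P = (\<lambda>m. \<Sum>p\<in>perms n.
     (let us = take 3 (arrange p [1..<Suc n]); bs = drop 3 (arrange p [1..<Suc n])
      in c p * (if sorted bs then 1 else \<epsilon>) *
         (\<Sum>q\<in>P. red_coeff I P (pattern us) q *
            (if m = (arrange q (sort us), sort bs) then 1 else 0))))"

definition expr_length :: "(nat list \<times> nat list \<Rightarrow> 'k::field) \<Rightarrow> nat" where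
  "expr_length e = card {m. e m \<noteq> 0}"

definition eval_expr ::
  "(nat list \<times> nat list \<Rightarrow> 'k::field) \<Rightarrow> ('v list \<Rightarrow> 'k) \<Rightarrow> ('v list \<Rightarrow> 'k) \<Rightarrow> 'v list \<Rightarrow> 'k" where
  "eval_expr e U B vs = (\<Sum>(us, bs) | e (us, bs) \<noteq> 0.
     e (us, bs) * U (map (\<lambda>k. vs ! (k - 1)) us) * B (map (\<lambda>k. vs ! (k - 1)) bs))"

definition y_t :: "(nat \<Rightarrow> nat) \<Rightarrow> 'k::field" where
  "y_t = young_symmetrizer [[1,3],[2,4]]"

definition y_t' :: "(nat \<Rightarrow> nat) \<Rightarrow> 'k::field" where
  "y_t' = young_symmetrizer [[1,3,5],[2,4]]"

definition reduced_w ::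
  "((nat \<Rightarrow> nat) \<Rightarrow> 'k::field) set \<Rightarrow> (nat \<Rightarrow> nat) set \<Rightarrow> nat list \<times> nat list \<Rightarrow> 'k" where
  "reduced_w = reduced 4 1 (gr_star y_t)"

definition reduced_S ::
  "((nat \<Rightarrow> nat) \<Rightarrow> 'k::field) set \<Rightarrow> (nat \<Rightarrow> nat) set \<Rightarrow> nat list \<times> nat list \<Rightarrow> 'k" where
  "reduced_S = reduced 5 1 (gr_star y_t')"

definition reduced_A ::
  "((nat \<Rightarrow> nat) \<Rightarrow> 'k::field) set \<Rightarrow> (nat \<Rightarrow> nat) set \<Rightarrow> nat list \<times> nat list \<Rightarrow> 'k" where
  "reduced_A = reduced 5 (- 1) (gr_star y_t')"

definition length_w :: "((nat \<Rightarrow> nat) \<Rightarrow> 'k::field) set \<Rightarrow> nat" where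
  "length_w I = (LEAST l. \<exists>P. admissible I P \<and> l = expr_length (reduced_w I P))"

definition length_S :: "((nat \<Rightarrow> nat) \<Rightarrow> 'k::field) set \<Rightarrow> nat" where
  "length_S I = (LEAST l. \<exists>P. admissible I P \<and> l = expr_length (reduced_S I P))"

definition length_A :: "((nat \<Rightarrow> nat) \<Rightarrow> 'k::field) set \<Rightarrow> nat" where
  "length_A I = (LEAST l. \<exists>P. admissible I P \<and> l = expr_length (reduced_A I P))"

section \<open>Smooth manifolds\<close>

text \<open>A manifold is a Hausdorff, second countable type \<open>'m\<close> with a smooth atlas modelled on \<open>'e\<close>,
  so its dimension is \<open>DIM('e)\<close>. A chart is a pair of its domain and its coordinate map (whose
  values off the domain are irrelevant).\<close>

primrec Ck_on :: "nat \<Rightarrow> 'e::euclidean_space set \<Rightarrow> ('e \<Rightarrow> 'b::real_normed_vector) \<Rightarrow> bool" where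
  "Ck_on 0 S f = continuous_on S f"
| "Ck_on (Suc k) S f = ((\<forall>x\<in>S. f differentiable (at x)) \<and>
     (\<forall>v. Ck_on k S (\<lambda>x. frechet_derivative f (at x) v)))"

definition smooth_on :: "'e::euclidean_space set \<Rightarrow> ('e \<Rightarrow> 'b::real_normed_vector) \<Rightarrow> bool" where
  "smooth_on S f \<longleftrightarrow> open S \<and> (\<forall>k. Ck_on k S f)"

type_synonym ('m, 'e) chart = "'m set \<times> ('m \<Rightarrow> 'e)"

definition chart_inv :: "('m, 'e) chart \<Rightarrow> 'e \<Rightarrow> 'm" where
  "chart_inv c = inv_into (fst c) (snd c)"

definition smooth_atlas ::
  "('m::{t2_space, second_countable_topology}, 'e::euclidean_space) chart set \<Rightarrow> bool" where
  "smooth_atlas \<A> \<longleftrightarrow> \<Union>(fst ` \<A>) = UNIV \<and>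
     (\<forall>c\<in>\<A>. open (fst c) \<and> open (snd c ` fst c) \<and>
        homeomorphism (fst c) (snd c ` fst c) (snd c) (chart_inv c)) \<and>
     (\<forall>c\<in>\<A>. \<forall>c'\<in>\<A>. smooth_on (snd c ` (fst c \<inter> fst c')) (snd c' \<circ> chart_inv c))"

definition charts_at :: "('m, 'e) chart set \<Rightarrow> 'm \<Rightarrow> ('m, 'e) chart set" where
  "charts_at \<A> p = {c \<in> \<A>. p \<in> fst c}"

text \<open>A tangent vector at \<open>p\<close> is the family of its components in the charts around \<open>p\<close>.\<close>

type_synonym ('m, 'e) tvec = "('m, 'e) chart \<Rightarrow> 'e"

definition tangent_space ::
  "('m, 'e::euclidean_space) chart set \<Rightarrow> 'm \<Rightarrow> ('m, 'e) tvec set" where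
  "tangent_space \<A> p = {v. (\<forall>c. c \<notin> charts_at \<A> p \<longrightarrow> v c = 0) \<and>
     (\<forall>c\<in>charts_at \<A> p. \<forall>c'\<in>charts_at \<A> p.
        v c' = frechet_derivative (snd c' \<circ> chart_inv c) (at (snd c p)) (v c))}"

definition diff_at ::
  "('m, 'e::euclidean_space) chart set \<Rightarrow> 'm \<Rightarrow> ('m \<Rightarrow> 'b::real_normed_vector) \<Rightarrow> bool" where
  "diff_at \<A> p f \<longleftrightarrow> (\<exists>c\<in>charts_at \<A> p. (f \<circ> chart_inv c) differentiable (at (snd c p)))"

text \<open>The derivative of a function along a tangent vector; it does not depend on the chart.\<close>

definition dir_deriv ::
  "('m, 'e::euclidean_space) chart set \<Rightarrow> 'm \<Rightarrow> ('m, 'e) tvec \<Rightarrow> ('m \<Rightarrow> 'b::real_normed_vector) \<Rightarrow> 'b" where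
  "dir_deriv \<A> p v f = (let c = (SOME c. c \<in> charts_at \<A> p)
     in frechet_derivative (f \<circ> chart_inv c) (at (snd c p)) (v c))"

text \<open>Functions and vector fields are total, but only their values on an open set \<open>W\<close>, respectively
  near the point \<open>p\<close>, matter.\<close>

definition smooth_fun_on ::
  "('m::topological_space, 'e::euclidean_space) chart set \<Rightarrow> 'm set \<Rightarrow> ('m \<Rightarrow> real) \<Rightarrow> bool" where
  "smooth_fun_on \<A> W f \<longleftrightarrow> open W \<and> (\<forall>q\<in>W. \<exists>c\<in>charts_at \<A> q. \<exists>N. open N \<and> q \<in> N \<and> N \<subseteq> W \<inter> fst c \<and>
     smooth_on (snd c ` N) (f \<circ> chart_inv c))"

definition vector_field_on ::
  "('m::topological_space, 'e::euclidean_space) chart set \<Rightarrow> 'm set \<Rightarrow> ('m \<Rightarrow> ('m, 'e) tvec) \<Rightarrow> bool" where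
  "vector_field_on \<A> W X \<longleftrightarrow> open W \<and> (\<forall>q\<in>W. X q \<in> tangent_space \<A> q \<and>
     (\<exists>c\<in>charts_at \<A> q. \<exists>N. open N \<and> q \<in> N \<and> N \<subseteq> W \<inter> fst c \<and>
       smooth_on (snd c ` N) (\<lambda>x. X (chart_inv c x) c)))"

definition smooth_fun_near ::
  "('m::topological_space, 'e::euclidean_space) chart set \<Rightarrow> 'm \<Rightarrow> ('m \<Rightarrow> real) \<Rightarrow> bool" where
  "smooth_fun_near \<A> p f \<longleftrightarrow> (\<exists>W. p \<in> W \<and> smooth_fun_on \<A> W f)"

definition vector_field_near ::
  "('m::topological_space, 'e::euclidean_space) chart set \<Rightarrow> 'm \<Rightarrow> ('m \<Rightarrow> ('m, 'e) tvec) \<Rightarrow> bool" where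
  "vector_field_near \<A> p X \<longleftrightarrow> (\<exists>W. p \<in> W \<and> vector_field_on \<A> W X)"

definition lie_bracket ::
  "('m, 'e::euclidean_space) chart set \<Rightarrow> ('m \<Rightarrow> ('m, 'e) tvec) \<Rightarrow> ('m \<Rightarrow> ('m, 'e) tvec) \<Rightarrow> 'm \<Rightarrow> ('m, 'e) tvec" where
  "lie_bracket \<A> X Y p = (\<lambda>c. if c \<in> charts_at \<A> p
     then frechet_derivative (\<lambda>x. Y (chart_inv c x) c) (at (snd c p)) (X p c)
          - frechet_derivative (\<lambda>x. X (chart_inv c x) c) (at (snd c p)) (Y p c)
     else 0)"

section \<open>Covariant derivatives\<close>

text \<open>\<open>D p u Y\<close> is \<open>\<nabla>\<^sub>u Y\<close> for \<open>u\<close> in \<open>T\<^sub>p M\<close> and a vector field \<open>Y\<close> that is smooth near \<open>p\<close>.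
  Locality in \<open>Y\<close> follows from the product rule, applied to the function that is \<open>1\<close> near \<open>p\<close> and \<open>0\<close> elsewhere.\<close>

type_synonym ('m, 'e) connection = "'m \<Rightarrow> ('m, 'e) tvec \<Rightarrow> ('m \<Rightarrow> ('m, 'e) tvec) \<Rightarrow> ('m, 'e) tvec"

definition covariant_derivative ::
  "('m::topological_space, 'e::euclidean_space) chart set \<Rightarrow> ('m, 'e) connection \<Rightarrow> bool" where
  "covariant_derivative \<A> D \<longleftrightarrow>
     (\<forall>p. \<forall>u\<in>tangent_space \<A> p. \<forall>Y. vector_field_near \<A> p Y \<longrightarrow> D p u Y \<in> tangent_space \<A> p) \<and>
     (\<forall>p. \<forall>u\<in>tangent_space \<A> p. \<forall>v\<in>tangent_space \<A> p. \<forall>a b Y. vector_field_near \<A> p Y \<longrightarrow>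
        D p (\<lambda>c. a *\<^sub>R u c + b *\<^sub>R v c) Y = (\<lambda>c. a *\<^sub>R D p u Y c + b *\<^sub>R D p v Y c)) \<and>
     (\<forall>p. \<forall>u\<in>tangent_space \<A> p. \<forall>Y Z. vector_field_near \<A> p Y \<and> vector_field_near \<A> p Z \<longrightarrow>
        D p u (\<lambda>q c. Y q c + Z q c) = (\<lambda>c. D p u Y c + D p u Z c)) \<and>
     (\<forall>p. \<forall>u\<in>tangent_space \<A> p. \<forall>f Y. smooth_fun_near \<A> p f \<and> vector_field_near \<A> p Y \<longrightarrow>
        D p u (\<lambda>q c. f q *\<^sub>R Y q c) = (\<lambda>c. dir_deriv \<A> p u f *\<^sub>R Y p c + f p *\<^sub>R D p u Y c)) \<and>
     (\<forall>W X Y. vector_field_on \<A> W X \<and> vector_field_on \<A> W Y \<longrightarrow>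
        vector_field_on \<A> W (\<lambda>p. D p (X p) Y))"

definition torsion_free ::
  "('m::topological_space, 'e::euclidean_space) chart set \<Rightarrow> ('m, 'e) connection \<Rightarrow> bool" where
  "torsion_free \<A> D \<longleftrightarrow> (\<forall>p X Y. vector_field_near \<A> p X \<and> vector_field_near \<A> p Y \<longrightarrow>
     (\<lambda>c. D p (X p) Y c - D p (Y p) X c) = lie_bracket \<A> X Y p)"

definition diff_tensor_field2 ::
  "('m::topological_space, 'e::euclidean_space) chart set \<Rightarrow> ('m \<Rightarrow> ('m, 'e) tvec list \<Rightarrow> 'k::real_normed_field) \<Rightarrow> bool" where
  "diff_tensor_field2 \<A> \<psi> \<longleftrightarrow> (\<forall>p. \<psi> p \<in> tensors 2 (tangent_space \<A> p)) \<and>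
     (\<forall>p X Y. vector_field_near \<A> p X \<and> vector_field_near \<A> p Y \<longrightarrow> diff_at \<A> p (\<lambda>q. \<psi> q [X q, Y q]))"

definition extend_vector ::
  "('m::topological_space, 'e::euclidean_space) chart set \<Rightarrow> 'm \<Rightarrow> ('m, 'e) tvec \<Rightarrow> 'm \<Rightarrow> ('m, 'e) tvec" where
  "extend_vector \<A> p u = (SOME X. vector_field_near \<A> p X \<and> X p = u)"

text \<open>\<open>(\<nabla>\<psi>)(u, v, w) = w (\<psi>(X, Y)) - \<psi>(\<nabla>\<^sub>w X, v) - \<psi>(u, \<nabla>\<^sub>w Y)\<close> for arbitrary local extensions
  \<open>X\<close>, \<open>Y\<close> of \<open>u\<close>, \<open>v\<close>; the direction of differentiation is the last argument.\<close>

definition nabla_tensor2 ::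
  "('m::topological_space, 'e::euclidean_space) chart set \<Rightarrow> ('m, 'e) connection \<Rightarrow>
     ('m \<Rightarrow> ('m, 'e) tvec list \<Rightarrow> 'k::real_normed_field) \<Rightarrow> 'm \<Rightarrow> ('m, 'e) tvec list \<Rightarrow> 'k" where
  "nabla_tensor2 \<A> D \<psi> p = (\<lambda>vs.
     if length vs = 3 \<and> set vs \<subseteq> tangent_space \<A> p then
       (let u = vs ! 0; v = vs ! 1; w = vs ! 2;
            X = extend_vector \<A> p u; Y = extend_vector \<A> p v
        in dir_deriv \<A> p w (\<lambda>q. \<psi> q [X q, Y q]) - \<psi> p [D p w X, v] - \<psi> p [u, D p w Y])
     else 0)"

end

theory Submission
  imports Defs
begin

text \<open>Let \<open>\<sigma> = 1\<close> in the symmetric and \<open>\<sigma> = -1\<close> in the skew-symmetric case; the generator is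
  \<open>\<xi>\<close> with parameter \<open>\<nu> = 1 - \<sigma>\<close>. The coordinates of \<open>U\<close> satisfy \<open>U\<^sub>2\<^sub>1\<^sub>3 = \<sigma> U\<^sub>1\<^sub>2\<^sub>3\<close> and have vanishing
  cyclic sums, and the left ideal \<open>\<ll> = \<rr>\<^sup>*\<close> is exactly the two-dimensional space of functions \<open>h\<close> on the
  permutations with these symmetries: every \<open>h(p)\<close> is an integral combination of \<open>h(123)\<close> and
  \<open>h(132)\<close>, and \<open>p\<close> gets a coordinate vector in \<open>\<int>\<^sup>2\<close>. By Cramer's rule, the coefficient of
  \<open>U\<^sub>p B\<^sub>b\<close> in the reduction with respect to \<open>{p, p'}\<close> is the determinant of \<open>v\<^sub>b\<close> and the vector of \<open>p'\<close>
  divided by that of the vectors of \<open>p\<close> and \<open>p'\<close>, where \<open>v\<^sub>b\<close> is the sum of the vectors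
  of the terms with indices \<open>b\<close> and does not depend on the admissible set. The length is
  therefore \<open>N(p) + N(p')\<close>, where \<open>N(p)\<close> counts the \<open>b\<close> for which \<open>v\<^sub>b\<close> is not parallel to the vector of
  \<open>p\<close>, and its minimum is found by integer arithmetic.

  That \<open>\<nabla>\<psi>\<close> is a tensor follows by expanding the extensions of the arguments in a coordinate frame:
  \<open>w (\<psi>(X, Y)) - \<psi>(\<nabla>\<^sub>w X, Y) - \<psi>(X, \<nabla>\<^sub>w Y)\<close> is linear over the smooth functions in \<open>X\<close> and \<open>Y\<close>.\<close>

section \<open>Permutations in one-line notation\<close>

text \<open>Keeps the entry \<open>1\<close> of literal words such as \<open>[2,1,3]\<close> from being rewritten to \<open>Suc 0\<close>.\<close>

declare One_nat_def [simp del]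

text \<open>The starred symmetrizers live on 24 and 120 permutations over an unspecified field, and
  every admissible pair has its own reduction. Three facts make this computable. The indices of
  \<open>U\<close> are the complement of those of the other factor, so a monomial is a word of
  \<open>S3\<close> together with a sorted list b, and each v_b is computed only once. All
  coefficients come from integers, and characteristic 0 lets \<open>of_int\<close> reflect
  vanishing. Finally, exchanging the first two entries of a word multiplies its vector by \<sigma>,
  so the six vectors lie on three lines; an admissible pair uses two different lines, and each
  length is a sum of two out of three counts.

  The parameter 1 - \<sigma> is the one for which \<open>[2,1,3]\<close> has coefficient \<sigma>/3
  in \<open>xi\<close>, matching the swap rule.

  On the geometric side the obstacle is that \<open>nabla_tensor2\<close> chooses extensions by
  \<open>SOME\<close>, separately for each vector, so linearity cannot be read off the definition.
  It has to come from a formula that sees only the values at the point.\<close>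

lemma finite_perms [simp]: "finite (perms n)"
  by (simp add: perms_def finite_permutations)

lemma perms_compose: "p \<in> perms n \<Longrightarrow> q \<in> perms n \<Longrightarrow> p \<circ> q \<in> perms n"
  by (simp add: perms_def permutes_compose)

lemma perms_inv: "p \<in> perms n \<Longrightarrow> inv p \<in> perms n"
  by (simp add: perms_def permutes_inv)

lemma perms_bij: "p \<in> perms n \<Longrightarrow> bij p"
  by (simp add: perms_def permutes_bij)

lemma perms_inv_inv: "p \<in> perms n \<Longrightarrow> inv (inv p) = p"
  using perms_bij inv_inv_eq by blast

lemma perms_inv_o: "p \<in> perms n \<Longrightarrow> inv p \<circ> p = id" "p \<in> perms n \<Longrightarrow> p \<circ> inv p = id"
  by (simp_all add: perms_def permutes_inv_o)

lemma bij_betw_inv_perms: "bij_betw inv (perms n) (perms n)"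
  by (rule bij_betwI[where g = inv]) (auto simp: perms_inv perms_inv_inv)

lemma perms_apply: "p \<in> perms n \<Longrightarrow> 1 \<le> k \<Longrightarrow> k \<le> n \<Longrightarrow> 1 \<le> p k \<and> p k \<le> n"
  using permutes_in_image[of p "{1..n}" k] by (simp add: perms_def)

lemma one_line_eq_iff:
  assumes "length xs = length ys"
  shows "one_line xs = one_line ys \<longleftrightarrow> xs = ys"
proof
  assume e: "one_line xs = one_line ys"
  have "xs ! i = ys ! i" if "i < length xs" for i
    using fun_cong[OF e, of "Suc i"] that assms by (simp add: one_line_def)
  then show "xs = ys" using assms nth_equalityI by blast
qed simp

lemma one_line_compose:
  assumes "length xs = length ys"
  shows "one_line xs \<circ> one_line ys = one_line (map (one_line xs) ys)"
proof
  fix i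
  show "(one_line xs \<circ> one_line ys) i = one_line (map (one_line xs) ys) i"
    using assms by (cases "1 \<le> i \<and> i \<le> length ys") (auto simp: one_line_def)
qed

lemma one_line_word:
  assumes "p \<in> perms n"
  shows "one_line (map p [1..<Suc n]) = p"
proof
  fix i
  show "one_line (map p [1..<Suc n]) i = p i"
    using assms permutes_not_in[of p "{1..n}" i]
    by (cases "1 \<le> i \<and> i \<le> n") (auto simp: one_line_def perms_def simp del: upt_Suc)
qed

lemma one_line_mem:
  assumes "distinct xs" "set xs = {1..length xs}"
  shows "one_line xs \<in> perms (length xs)"
proof -
  let ?n = "length xs"
  have "inj_on (one_line xs) {1..?n}"
    using assms(1) by (auto simp: inj_on_def one_line_def nth_eq_iff_index_eq)
  moreover have "one_line xs ` {1..?n} \<subseteq> {1..?n}"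
  proof
    fix y assume "y \<in> one_line xs ` {1..?n}"
    then obtain i where "i \<in> {1..?n}" "y = xs ! (i - 1)" by (auto simp: one_line_def)
    then have "y \<in> set xs" by auto
    then show "y \<in> {1..?n}" using assms(2) by simp
  qed
  ultimately have "bij_betw (one_line xs) {1..?n} {1..?n}"
    by (simp add: bij_betw_def endo_inj_surj)
  moreover have "one_line xs i = i" if "i \<notin> {1..?n}" for i
    using that by (auto simp: one_line_def)
  ultimately show ?thesis
    unfolding perms_def using bij_imp_permutes by blast
qed

definition S3 :: "nat list list" where
  "S3 = [[1,2,3], [1,3,2], [2,1,3], [2,3,1], [3,1,2], [3,2,1]]"

lemma upt_1_4: "[1..<Suc 3] = [1, 2, 3]"
  by code_simp

lemma perms_3: "perms 3 = one_line ` set S3"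
proof
  show "one_line ` set S3 \<subseteq> perms 3"
  proof
    fix p assume "p \<in> one_line ` set S3"
    then obtain xs where xs: "p = one_line xs" "xs \<in> set S3" by blast
    then have "distinct xs \<and> set xs = {1..length xs} \<and> length xs = 3"
      by (auto simp: S3_def)
    then show "p \<in> perms 3" using one_line_mem xs by metis
  qed
  show "perms 3 \<subseteq> one_line ` set S3"
  proof
    fix p assume p: "p \<in> perms 3"
    have r: "p 1 \<in> {1,2,3}" "p 2 \<in> {1,2,3}" "p 3 \<in> {1,2,3}"
      using perms_apply[OF p, of 1] perms_apply[OF p, of 2] perms_apply[OF p, of 3] by auto
    have "p 1 \<noteq> p 2" "p 1 \<noteq> p 3" "p 2 \<noteq> p 3"
      using perms_bij[OF p] by (simp_all add: bij_is_inj inj_eq)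
    moreover have "a \<noteq> b \<Longrightarrow> a \<noteq> c \<Longrightarrow> b \<noteq> c \<Longrightarrow> a \<in> {1,2,3} \<Longrightarrow> b \<in> {1,2,3} \<Longrightarrow> c \<in> {1,2,3} \<Longrightarrow>
      [a, b, c] \<in> set S3" for a b c :: nat
      unfolding S3_def by (elim insertE emptyE; simp)
    ultimately have "[p 1, p 2, p 3] \<in> set S3" using r by blast
    moreover have "p = one_line [p 1, p 2, p 3]"
      using one_line_word[OF p] unfolding upt_1_4 by simp
    ultimately show "p \<in> one_line ` set S3" by blast
  qed
qed

lemma inj_on_one_line: "(\<And>xs. xs \<in> A \<Longrightarrow> length xs = n) \<Longrightarrow> inj_on one_line A"
  by (auto simp: inj_on_def one_line_eq_iff)

lemma length_S3: "xs \<in> set S3 \<Longrightarrow> length xs = 3"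
  by (auto simp: S3_def)

lemma sum_perms_3:
  "(\<Sum>p\<in>perms 3. f p) = f (one_line [1,2,3]) + f (one_line [1,3,2]) + f (one_line [2,1,3])
    + f (one_line [2,3,1]) + f (one_line [3,1,2]) + (f (one_line [3,2,1]) :: 'a::comm_monoid_add)"
proof -
  have "(\<Sum>p\<in>perms 3. f p) = (\<Sum>xs\<in>set S3. f (one_line xs))"
    unfolding perms_3 using inj_on_one_line[OF length_S3] by (simp add: sum.reindex)
  then show ?thesis by (simp add: S3_def add.assoc)
qed

lemma one_line_3 [simp]:
  "one_line [a,b,c] 1 = a" "one_line [a,b,c] 2 = b" "one_line [a,b,c] 3 = c"
  by (simp_all add: one_line_def)

lemma one_line_id: "one_line [1,2,3] = id"
  using one_line_word[of id 3] unfolding upt_1_4 by (simp add: perms_def permutes_id)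

section \<open>The left ideal of a symmetry class\<close>

text \<open>For fixed \<open>p\<close> and \<open>s\<close> the equation
  \<open>p \<circ> q = s\<close> has the single solution \<open>inv p \<circ> s\<close>, which
  collapses the inner sum of the convolution.\<close>

lemma gr_mult_eq:
  "gr_mult n a b s = (if s \<in> perms n then \<Sum>p\<in>perms n. a p * b (inv p \<circ> s) else 0)"
proof -
  have "(\<Sum>q\<in>perms n. if p \<circ> q = s then a p * b q else 0)
    = (if s \<in> perms n then a p * b (inv p \<circ> s) else 0)" if p: "p \<in> perms n" for p
  proof -
    have "p \<circ> q = s \<longleftrightarrow> q = inv p \<circ> s" for q
    proof
      assume "p \<circ> q = s"
      then have "inv p \<circ> s = (inv p \<circ> p) \<circ> q" by (metis o_assoc)
      then show "q = inv p \<circ> s" by (simp add: perms_inv_o[OF p])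
    next
      assume "q = inv p \<circ> s"
      then have "p \<circ> q = (p \<circ> inv p) \<circ> s" by (metis o_assoc)
      then show "p \<circ> q = s" by (simp add: perms_inv_o[OF p])
    qed
    then have "(\<Sum>q\<in>perms n. if p \<circ> q = s then a p * b q else 0)
      = (\<Sum>q\<in>perms n. if q = inv p \<circ> s then a p * b (inv p \<circ> s) else 0)"
      by (intro sum.cong) auto
    also have "\<dots> = (if inv p \<circ> s \<in> perms n then a p * b (inv p \<circ> s) else 0)"
      by simp
    also have "inv p \<circ> s \<in> perms n \<longleftrightarrow> s \<in> perms n"
      using perms_compose[OF p, of "inv p \<circ> s"] perms_compose[OF perms_inv[OF p], of s]
      by (auto simp: o_assoc perms_inv_o[OF p])
    finally show ?thesis .
  qed
  then show ?thesis unfolding gr_mult_def by simp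
qed

lemma inv_S3 [simp]:
  "inv (one_line [1,2,3]) = one_line [1,2,3]"
  "inv (one_line [1,3,2]) = one_line [1,3,2]"
  "inv (one_line [2,1,3]) = one_line [2,1,3]"
  "inv (one_line [2,3,1]) = one_line [3,1,2]"
  "inv (one_line [3,1,2]) = one_line [2,3,1]"
  "inv (one_line [3,2,1]) = one_line [3,2,1]"
  by (rule inv_unique_comp; simp add: one_line_compose; simp add: one_line_id)+

text \<open>The swap rule and the cyclic rule in solved form, with the values at
  \<open>[1,2,3]\<close> and \<open>[1,3,2]\<close> left free. The value at \<open>[3,2,1]\<close>
  is \<sigma> times the one at \<open>[2,3,1]\<close>, simplified by \<sigma> squared being
  1.\<close>

definition solutions :: "'k::field \<Rightarrow> ((nat \<Rightarrow> nat) \<Rightarrow> 'k) set" where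
  "solutions \<sigma> = {h \<in> group_ring 3.
     h (one_line [2,1,3]) = \<sigma> * h (one_line [1,2,3]) \<and>
     h (one_line [2,3,1]) = - h (one_line [1,2,3]) - \<sigma> * h (one_line [1,3,2]) \<and>
     h (one_line [3,1,2]) = \<sigma> * h (one_line [1,3,2]) \<and>
     h (one_line [3,2,1]) = - \<sigma> * h (one_line [1,2,3]) - h (one_line [1,3,2])}"

text \<open>The convolution evaluates \<open>b\<close> at \<open>inv p \<circ> s\<close>.
  Transpositions are their own inverses while the two 3-cycles are inverse to each other, so
  compared with \<open>xi\<close> the coefficients at \<open>[2,3,1]\<close> and
  \<open>[3,1,2]\<close> change places.\<close>

lemma gr_mult_xi:
  fixes b :: "(nat \<Rightarrow> nat) \<Rightarrow> 'k::field"
  assumes "xs \<in> set S3"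
  defines "f \<equiv> \<lambda>ys. b (one_line (map (one_line ys) xs))"
  shows "gr_mult 3 (xi \<nu>) b (one_line xs) = (1 / 3) *
    (f [1,2,3] + \<nu> * f [1,3,2] + (1 - \<nu>) * f [2,1,3] - \<nu> * f [3,1,2] + (\<nu> - 1) * f [2,3,1] - f [3,2,1])"
proof -
  have "one_line xs \<in> perms 3" using assms(1) perms_3 by blast
  moreover have "b (one_line ys \<circ> one_line xs) = f ys" if "length ys = 3" for ys
    unfolding f_def using one_line_compose[of ys xs] that length_S3[OF assms(1)] by simp
  ultimately show ?thesis
    unfolding gr_mult_eq sum_perms_3
    by (simp add: xi_def gr_single_def one_line_eq_iff algebra_simps)
qed

text \<open>For one inclusion an arbitrary product with \<open>xi (1 - \<sigma>)\<close> is
  evaluated at the six permutations, where each rule is a polynomial consequence of the hypothesis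
  on \<sigma>. For the other, \<open>xi (1 - \<sigma>)\<close> is a left unit on the star of any
  solution, which therefore lies in the right ideal.\<close>

lemma star_ideal_eq:
  fixes \<sigma> :: "'k::field_char_0"
  assumes "\<sigma> * \<sigma> = 1"
  shows "gr_star ` right_ideal_gen 3 (xi (1 - \<sigma>)) = solutions \<sigma>"
proof -
  \<comment> \<open>Replacing the fraction by \<open>t\<close> with 3 t = 1 leaves polynomial
    identities, which suit \<open>algebra\<close>.\<close>
  define t where "t = (1 / 3 :: 'k)"
  have t: "3 * t = 1" by (simp add: t_def)
  have star: "gr_star a p = (if p \<in> perms 3 then a (inv p) else 0)"
    if "a \<in> group_ring 3" for a :: "(nat \<Rightarrow> nat) \<Rightarrow> 'k" and p
  proof -
    have "inv p \<notin> perms 3" if "bij p" "p \<notin> perms 3"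
      using perms_inv[of "inv p" 3] inv_inv_eq[OF that(1)] that(2) by auto
    then show ?thesis using that perms_bij[of p 3] unfolding gr_star_def group_ring_def by auto
  qed
  have gr: "gr_mult 3 a b \<in> group_ring 3" for a b :: "(nat \<Rightarrow> nat) \<Rightarrow> 'k"
    by (simp add: group_ring_def gr_mult_eq)
  have m: "one_line [1,2,3] \<in> perms 3" "one_line [1,3,2] \<in> perms 3" "one_line [2,1,3] \<in> perms 3"
    "one_line [2,3,1] \<in> perms 3" "one_line [3,1,2] \<in> perms 3" "one_line [3,2,1] \<in> perms 3"
    unfolding perms_3 S3_def by simp_all
  have S: "[1,2,3] \<in> set S3" "[1,3,2] \<in> set S3" "[2,1,3] \<in> set S3"
    "[2,3,1] \<in> set S3" "[3,1,2] \<in> set S3" "[3,2,1] \<in> set S3"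
    by (simp_all add: S3_def)
  note X = S[THEN gr_mult_xi, of "1 - \<sigma>", simplified one_line_3 list.map, folded t_def]
  show ?thesis
  proof
    show "gr_star ` right_ideal_gen 3 (xi (1 - \<sigma>)) \<subseteq> solutions \<sigma>"
    proof
      fix h assume "h \<in> gr_star ` right_ideal_gen 3 (xi (1 - \<sigma>))"
      then obtain b where h: "h = gr_star (gr_mult 3 (xi (1 - \<sigma>)) b)"
        unfolding right_ideal_gen_def by blast
      have "h \<in> group_ring 3" unfolding h group_ring_def using star[OF gr] by auto
      then show "h \<in> solutions \<sigma>"
        unfolding solutions_def mem_Collect_eq h star[OF gr] inv_S3 if_P[OF m(1)] if_P[OF m(2)]
          if_P[OF m(3)] if_P[OF m(4)] if_P[OF m(5)] if_P[OF m(6)] X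
        using assms by (-, intro conjI) (assumption | algebra)+
    qed
    show "solutions \<sigma> \<subseteq> gr_star ` right_ideal_gen 3 (xi (1 - \<sigma>))"
    proof
      fix h assume h: "h \<in> solutions \<sigma>"
      then have hg: "h \<in> group_ring 3" by (simp add: solutions_def)
      define a where "a = gr_star h"
      have a: "a p = (if p \<in> perms 3 then h (inv p) else 0)" for p
        unfolding a_def using star[OF hg] .
      then have ag: "a \<in> group_ring 3" by (simp add: group_ring_def)
      have "gr_mult 3 (xi (1 - \<sigma>)) a p = a p" for p
      proof (cases "p \<in> perms 3")
        case True
        then obtain xs where xs: "p = one_line xs" "xs \<in> set S3" unfolding perms_3 by blast
        \<comment> \<open>Passing to the star exchanges the values at the two 3-cycles.\<close>
        have vals: "a (one_line [1,2,3]) = h (one_line [1,2,3])" "a (one_line [1,3,2]) = h (one_line [1,3,2])"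
          "a (one_line [2,1,3]) = \<sigma> * h (one_line [1,2,3])"
          "a (one_line [3,1,2]) = - h (one_line [1,2,3]) - \<sigma> * h (one_line [1,3,2])"
          "a (one_line [2,3,1]) = \<sigma> * h (one_line [1,3,2])"
          "a (one_line [3,2,1]) = - \<sigma> * h (one_line [1,2,3]) - h (one_line [1,3,2])"
          using h m by (simp_all add: a solutions_def)
        have "gr_mult 3 (xi (1 - \<sigma>)) a (one_line [1,2,3]) = a (one_line [1,2,3])"
          "gr_mult 3 (xi (1 - \<sigma>)) a (one_line [1,3,2]) = a (one_line [1,3,2])"
          "gr_mult 3 (xi (1 - \<sigma>)) a (one_line [2,1,3]) = a (one_line [2,1,3])"
          "gr_mult 3 (xi (1 - \<sigma>)) a (one_line [2,3,1]) = a (one_line [2,3,1])"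
          "gr_mult 3 (xi (1 - \<sigma>)) a (one_line [3,1,2]) = a (one_line [3,1,2])"
          "gr_mult 3 (xi (1 - \<sigma>)) a (one_line [3,2,1]) = a (one_line [3,2,1])"
          unfolding X vals using assms t by algebra+
        then show ?thesis using xs by (auto simp: S3_def)
      next
        case False
        then show ?thesis by (simp add: a gr_mult_eq)
      qed
      then have "a = gr_mult 3 (xi (1 - \<sigma>)) a" by (simp add: fun_eq_iff)
      then have "a \<in> right_ideal_gen 3 (xi (1 - \<sigma>))"
        unfolding right_ideal_gen_def using ag by blast
      moreover have "gr_star a p = h p" for p
        using star[OF ag, of p] perms_inv[of p 3] perms_inv_inv[of p 3] hg
        by (auto simp: a group_ring_def)
      then have "h = gr_star a" by (simp add: fun_eq_iff)
      ultimately show "h \<in> gr_star ` right_ideal_gen 3 (xi (1 - \<sigma>))" by blast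
    qed
  qed
qed

text \<open>The coordinate vector of a permutation: \<open>h(xs)\<close> in terms of \<open>h(123)\<close> and \<open>h(132)\<close>.\<close>

definition coord :: "int \<Rightarrow> nat list \<Rightarrow> int \<times> int" where
  "coord s xs =
     (if xs = [1,2,3] then (1, 0) else if xs = [1,3,2] then (0, 1)
      else if xs = [2,1,3] then (s, 0) else if xs = [2,3,1] then (- 1, - s)
      else if xs = [3,1,2] then (0, s) else (- s, - 1))"

definition minor :: "int \<Rightarrow> nat list \<Rightarrow> nat list \<Rightarrow> int" where
  "minor s x y = fst (coord s x) * snd (coord s y) - fst (coord s y) * snd (coord s x)"

lemma minor_self [simp]: "minor s x x = 0"
  by (simp add: minor_def)

lemma solutions_coord:
  assumes "h \<in> solutions (of_int s)" "xs \<in> set S3"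
  shows "h (one_line xs) = of_int (fst (coord s xs)) * h (one_line [1,2,3])
    + of_int (snd (coord s xs)) * h (one_line [1,3,2])"
proof -
  have "xs = [1,2,3] \<or> xs = [1,3,2] \<or> xs = [2,1,3] \<or> xs = [2,3,1] \<or> xs = [3,1,2] \<or> xs = [3,2,1]"
    using assms(2) by (simp add: S3_def)
  then show ?thesis
    using assms(1) by (elim disjE) (simp_all add: solutions_def coord_def)
qed

text \<open>For \<open>f = fst\<close> and \<open>f = snd\<close> this is the basis of the solution
  space dual to evaluation at \<open>[1,2,3]\<close> and \<open>[1,3,2]\<close>;
  \<open>map p [1,2,3]\<close> recovers the one-line word of \<open>p\<close>.\<close>

definition basis_solution :: "int \<Rightarrow> (int \<times> int \<Rightarrow> int) \<Rightarrow> (nat \<Rightarrow> nat) \<Rightarrow> 'k::field" where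
  "basis_solution s f p = (if p \<in> perms 3 then of_int (f (coord s (map p [1,2,3]))) else 0)"

lemma one_line_map_3: "length xs = 3 \<Longrightarrow> map (one_line xs) [1,2,3] = xs"
proof -
  assume "length xs = 3"
  then obtain a b c where "xs = [a, b, c]" by (auto simp: numeral_3_eq_3 length_Suc_conv)
  then show ?thesis by simp
qed

lemma basis_solution_apply:
  "xs \<in> set S3 \<Longrightarrow> basis_solution s f (one_line xs) = of_int (f (coord s xs))"
  unfolding basis_solution_def one_line_map_3[OF length_S3] perms_3 by simp

lemma basis_solution_mem:
  "basis_solution s fst \<in> solutions (of_int s)" "basis_solution s snd \<in> solutions (of_int s)"
proof -
  have S: "[1,2,3] \<in> set S3" "[1,3,2] \<in> set S3" "[2,1,3] \<in> set S3"
    "[2,3,1] \<in> set S3" "[3,1,2] \<in> set S3" "[3,2,1] \<in> set S3"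
    by (simp_all add: S3_def)
  have "basis_solution s f \<in> group_ring 3" for f
    by (simp add: basis_solution_def group_ring_def)
  then show "basis_solution s fst \<in> solutions (of_int s)" "basis_solution s snd \<in> solutions (of_int s)"
    unfolding solutions_def mem_Collect_eq S[THEN basis_solution_apply]
    by (simp_all add: coord_def)
qed

lemma group_ring_eqI:
  assumes "a \<in> group_ring 3" "b \<in> group_ring 3" "\<And>xs. xs \<in> set S3 \<Longrightarrow> a (one_line xs) = b (one_line xs)"
  shows "a = b"
proof
  fix p show "a p = b p"
    using assms by (cases "p \<in> perms 3") (auto simp: group_ring_def perms_3)
qed

lemma is_basis2_basis_solution:
  "is_basis2 (solutions (of_int s)) (basis_solution s fst) (basis_solution s snd)"
  unfolding is_basis2_def
proof (intro conjI allI ballI impI)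
  have S: "[1,2,3] \<in> set S3" "[1,3,2] \<in> set S3" by (simp_all add: S3_def)
  fix h :: "(nat \<Rightarrow> nat) \<Rightarrow> 'a" assume h: "h \<in> solutions (of_int s)"
  have "h = (\<lambda>p. h (one_line [1,2,3]) * basis_solution s fst p + h (one_line [1,3,2]) * basis_solution s snd p)"
  proof (rule group_ring_eqI)
    show "h \<in> group_ring 3" using h by (simp add: solutions_def)
    show "(\<lambda>p. h (one_line [1,2,3]) * basis_solution s fst p + h (one_line [1,3,2]) * basis_solution s snd p)
        \<in> group_ring 3"
      by (simp add: basis_solution_def group_ring_def)
    show "h (one_line xs) = h (one_line [1,2,3]) * basis_solution s fst (one_line xs)
        + h (one_line [1,3,2]) * basis_solution s snd (one_line xs)" if "xs \<in> set S3" for xs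
      using solutions_coord[OF h that] that by (simp add: basis_solution_apply mult.commute)
  qed
  then show "\<exists>\<alpha> \<beta>. h = (\<lambda>p. \<alpha> * basis_solution s fst p + \<beta> * basis_solution s snd p)" by blast
next
  have S: "[1,2,3] \<in> set S3" "[1,3,2] \<in> set S3" by (simp_all add: S3_def)
  fix \<alpha> \<beta> :: 'a
  assume "(\<lambda>p. \<alpha> * basis_solution s fst p + \<beta> * basis_solution s snd p) = (\<lambda>p. 0)"
  then have "\<alpha> * basis_solution s fst p + \<beta> * basis_solution s snd p = 0" for p by metis
  from this[of "one_line [1,2,3]"] this[of "one_line [1,3,2]"]
  show "\<alpha> = 0" "\<beta> = 0"
    unfolding S[THEN basis_solution_apply] by (simp_all add: coord_def)
qed (rule basis_solution_mem)+

text \<open>The determinant for any two solutions is \<open>minor s x y\<close> times their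
  determinant at \<open>[1,2,3]\<close> and \<open>[1,3,2]\<close>, a factor that does not depend on
  the pair. For the dual basis this factor is 1.\<close>

lemma admissible_iff:
  fixes I :: "((nat \<Rightarrow> nat) \<Rightarrow> 'k::field_char_0) set"
  assumes I: "gr_star ` I = solutions (of_int s)"
  shows "admissible I P \<longleftrightarrow>
    (\<exists>x\<in>set S3. \<exists>y\<in>set S3. P = {one_line x, one_line y} \<and> minor s x y \<noteq> 0)"
proof
  assume "admissible I P"
  then obtain h1 h2 p1 p2 where B: "is_basis2 (solutions (of_int s :: 'k)) h1 h2"
    and P: "P \<subseteq> perms 3" "P = {p1, p2}" and d: "h1 p1 * h2 p2 - h1 p2 * h2 p1 \<noteq> 0"
    unfolding admissible_def I by blast
  have h: "h1 \<in> solutions (of_int s)" "h2 \<in> solutions (of_int s)"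
    using B by (simp_all add: is_basis2_def)
  obtain x y where xy: "x \<in> set S3" "y \<in> set S3" "p1 = one_line x" "p2 = one_line y"
    using P unfolding perms_3 by blast
  have "h1 p1 * h2 p2 - h1 p2 * h2 p1 = of_int (minor s x y) *
    (h1 (one_line [1,2,3]) * h2 (one_line [1,3,2]) - h1 (one_line [1,3,2]) * h2 (one_line [1,2,3]))"
    unfolding xy solutions_coord[OF h(1) xy(1)] solutions_coord[OF h(1) xy(2)]
      solutions_coord[OF h(2) xy(1)] solutions_coord[OF h(2) xy(2)] minor_def of_int_diff of_int_mult
    by algebra
  then have "minor s x y \<noteq> 0" using d by auto
  then show "\<exists>x\<in>set S3. \<exists>y\<in>set S3. P = {one_line x, one_line y} \<and> minor s x y \<noteq> 0"
    using xy P(2) by blast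
next
  assume "\<exists>x\<in>set S3. \<exists>y\<in>set S3. P = {one_line x, one_line y} \<and> minor s x y \<noteq> 0"
  then obtain x y where xy: "x \<in> set S3" "y \<in> set S3" "P = {one_line x, one_line y}" "minor s x y \<noteq> 0"
    by blast
  have "x \<noteq> y" using xy(4) by auto
  then have ne: "one_line x \<noteq> one_line y"
    using one_line_eq_iff[of x y] length_S3 xy(1,2) by simp
  let ?e1 = "basis_solution s fst :: _ \<Rightarrow> 'k" and ?e2 = "basis_solution s snd :: _ \<Rightarrow> 'k"
  have "?e1 (one_line x) * ?e2 (one_line y) - ?e1 (one_line y) * ?e2 (one_line x) = of_int (minor s x y)"
    using xy(1,2) by (simp add: basis_solution_apply minor_def)
  then have nz: "?e1 (one_line x) * ?e2 (one_line y) - ?e1 (one_line y) * ?e2 (one_line x) \<noteq> 0"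
    using xy(4) by simp
  have sub: "P \<subseteq> perms 3" using xy perms_3 by auto
  show "admissible I P"
    unfolding admissible_def I
    by (intro conjI exI[of _ ?e1] exI[of _ ?e2] exI[of _ "one_line x"] exI[of _ "one_line y"])
      (rule is_basis2_basis_solution sub xy(3) ne nz)+
qed

text \<open>Cramer's rule for the vector of \<open>z\<close> in terms of those of \<open>x\<close>
  and \<open>y\<close>. The formula also covers \<open>z\<close> in the pair, where the quotients
  become 1 and 0 and agree with \<open>gr_single\<close>.\<close>

lemma red_coeff_eq:
  fixes I :: "((nat \<Rightarrow> nat) \<Rightarrow> 'k::field_char_0) set"
  assumes I: "gr_star ` I = solutions (of_int s)"
    and xyz: "x \<in> set S3" "y \<in> set S3" "z \<in> set S3" and d: "minor s x y \<noteq> 0"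
  shows "red_coeff I {one_line x, one_line y} (one_line z) =
    (\<lambda>q. if q = one_line x then of_int (minor s z y) / of_int (minor s x y)
         else if q = one_line y then of_int (minor s x z) / of_int (minor s x y) else 0)"
    (is "_ = ?\<kappa>")
proof -
  have eq: "one_line a = one_line b \<longleftrightarrow> a = b" if "a \<in> set S3" "b \<in> set S3" for a b
    using one_line_eq_iff[of a b] length_S3 that by simp
  have ne: "x \<noteq> y" using d by auto
  let ?P = "{one_line x, one_line y}"
  show ?thesis
  proof (cases "z = x \<or> z = y")
    case True
    then show ?thesis
      unfolding red_coeff_def gr_single_def
      using d ne by (intro ext) (elim disjE; simp add: eq xyz)
  next
    case False
    have P: "?P \<subseteq> perms 3" "one_line z \<in> perms 3" using xyz perms_3 by auto
    have sum: "(\<Sum>p\<in>perms 3. h p * (gr_single (one_line z) p - \<kappa> p))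
      = h (one_line z) - (\<kappa> (one_line x) * h (one_line x) + \<kappa> (one_line y) * h (one_line y))"
      if "\<And>q. q \<notin> ?P \<Longrightarrow> \<kappa> q = 0" for h \<kappa> :: "_ \<Rightarrow> 'k"
    proof -
      have "(\<Sum>p\<in>perms 3. h p * \<kappa> p) = (\<Sum>p\<in>?P. h p * \<kappa> p)"
        using that P(1) by (intro sum.mono_neutral_right) auto
      moreover have "(\<Sum>p\<in>perms 3. h p * gr_single (one_line z) p) = h (one_line z)"
        using P(2) by (simp add: gr_single_def mult_delta_right)
      ultimately show ?thesis
        using ne by (simp add: right_diff_distrib sum_subtractf eq xyz mult.commute)
    qed
    have ids: "(\<lambda>q. gr_single (one_line z) q - \<kappa> q) \<in> identities I \<longleftrightarrow> (\<forall>h\<in>solutions (of_int s).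
        h (one_line z) = \<kappa> (one_line x) * h (one_line x) + \<kappa> (one_line y) * h (one_line y))"
      if \<kappa>: "\<And>q. q \<notin> ?P \<Longrightarrow> \<kappa> q = 0" for \<kappa> :: "_ \<Rightarrow> 'k"
    proof -
      have s: "(\<Sum>p\<in>perms 3. h p * (gr_single (one_line z) p - \<kappa> p))
        = h (one_line z) - (\<kappa> (one_line x) * h (one_line x) + \<kappa> (one_line y) * h (one_line y))" for h
        by (rule sum) (rule \<kappa>)
      have "(\<lambda>q. gr_single (one_line z) q - \<kappa> q) \<in> group_ring 3"
      proof -
        have "\<kappa> q = 0" if "q \<notin> perms 3" for q
          using \<kappa>[of q] P(1) that by blast
        then show ?thesis using P(2) by (auto simp: group_ring_def gr_single_def)
      qed
      then show ?thesis
        unfolding identities_def mem_Collect_eq I by (simp add: s)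
    qed
    have d': "of_int (minor s x y) \<noteq> (0::'k)" using d by simp
    have vals: "?\<kappa> (one_line x) = of_int (minor s z y) / of_int (minor s x y)"
      "?\<kappa> (one_line y) = of_int (minor s x z) / of_int (minor s x y)"
      using ne by (simp_all add: eq xyz)
    have "red_coeff I ?P (one_line z) = (THE \<kappa>. (\<forall>q. q \<notin> ?P \<longrightarrow> \<kappa> q = 0) \<and>
        (\<lambda>q. gr_single (one_line z) q - \<kappa> q) \<in> identities I)"
      unfolding red_coeff_def using False by (simp add: eq xyz)
    also have "\<dots> = ?\<kappa>"
    proof (rule the_equality)
      have "h (one_line z) = ?\<kappa> (one_line x) * h (one_line x) + ?\<kappa> (one_line y) * h (one_line y)"
        if "h \<in> solutions (of_int s)" for h
      proof -
        \<comment> \<open>The relation det(x,y) z = det(z,y) x + det(x,z) y between any three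
          vectors of the plane.\<close>
        have "of_int (minor s x y) * h (one_line z) =
          of_int (minor s z y) * h (one_line x) + of_int (minor s x z) * h (one_line y)"
          unfolding minor_def of_int_diff of_int_mult xyz[THEN solutions_coord[OF that]] by algebra
        then show ?thesis unfolding vals using d' by (simp add: field_simps)
      qed
      then show "(\<forall>q. q \<notin> ?P \<longrightarrow> ?\<kappa> q = 0) \<and> (\<lambda>q. gr_single (one_line z) q - ?\<kappa> q) \<in> identities I"
        using ids[of ?\<kappa>] by simp
    next
      fix \<kappa> assume \<kappa>: "(\<forall>q. q \<notin> ?P \<longrightarrow> \<kappa> q = 0) \<and> (\<lambda>q. gr_single (one_line z) q - \<kappa> q) \<in> identities I"
      then have h: "h (one_line z) = \<kappa> (one_line x) * h (one_line x) + \<kappa> (one_line y) * h (one_line y)"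
        if "h \<in> solutions (of_int s)" for h using ids[of \<kappa>] that by blast
      \<comment> \<open>Uniqueness: testing the identity on the two dual basis solutions gives a
        linear system with determinant \<open>minor s x y\<close>.\<close>
      have c: "of_int (f (coord s z)) = \<kappa> (one_line x) * of_int (f (coord s x)) + \<kappa> (one_line y) * of_int (f (coord s y))"
        if "f = fst \<or> f = snd" for f
        using h[of "basis_solution s f"] basis_solution_mem that xyz[THEN basis_solution_apply] by metis
      have "\<kappa> (one_line x) * of_int (minor s x y) = of_int (minor s z y)"
        "\<kappa> (one_line y) * of_int (minor s x y) = of_int (minor s x z)"
        unfolding minor_def of_int_diff of_int_mult using c[of fst] c[of snd] by (simp_all add: algebra_simps)
      then have "\<kappa> (one_line x) = ?\<kappa> (one_line x)" "\<kappa> (one_line y) = ?\<kappa> (one_line y)"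
        unfolding vals using d' by (simp_all add: field_simps)
      then have "\<kappa> q = ?\<kappa> q" for q
        using \<kappa> by (cases "q \<in> ?P") auto
      then show "\<kappa> = ?\<kappa>" by (rule ext)
    qed
    finally show ?thesis .
  qed
qed

section \<open>Evaluation of reduced expressions\<close>

lemma length_arrange [simp]: "length (arrange p xs) = length xs"
  by (simp add: arrange_def del: upt_Suc)

lemma nth_arrange: "i < length xs \<Longrightarrow> arrange p xs ! i = xs ! (p (Suc i) - 1)"
  by (simp add: arrange_def One_nat_def del: upt_Suc)

lemma arrange_conv_word: "arrange p vs = map (\<lambda>k. vs ! (k - 1)) (map p [1..<Suc (length vs)])"
  by (simp add: arrange_def del: upt_Suc)

lemma arrange_map:
  assumes "p \<in> perms (length xs)"
  shows "arrange p (map f xs) = map f (arrange p xs)"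
proof (rule nth_equalityI)
  fix i assume "i < length (arrange p (map f xs))"
  then have i: "i < length xs" by simp
  then have "p (Suc i) - 1 < length xs"
    using perms_apply[OF assms, of "Suc i"] by (simp add: One_nat_def, arith)
  then show "arrange p (map f xs) ! i = map f (arrange p xs) ! i"
    using i by (simp add: nth_arrange)
qed simp

lemma arrange_upt:
  assumes "p \<in> perms n"
  shows "arrange p [1..<Suc n] = map p [1..<Suc n]"
proof (rule nth_equalityI)
  fix i assume "i < length (arrange p [1..<Suc n])"
  then have "i < n" by (simp del: upt_Suc)
  then show "arrange p [1..<Suc n] ! i = map p [1..<Suc n] ! i"
    using perms_apply[OF assms, of "Suc i"] by (simp add: nth_arrange One_nat_def del: upt_Suc)
qed simp

lemma arrange_inj:
  assumes "distinct xs" "p \<in> perms (length xs)" "q \<in> perms (length xs)" "arrange p xs = arrange q xs"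
  shows "p = q"
proof
  fix k show "p k = q k"
  proof (cases "1 \<le> k \<and> k \<le> length xs")
    case True
    then have k: "k - 1 < length xs" "Suc (k - 1) = k" by auto
    have r: "1 \<le> p k" "p k \<le> length xs" "1 \<le> q k" "q k \<le> length xs"
      using perms_apply[OF assms(2)] perms_apply[OF assms(3)] True by auto
    have "xs ! (p k - 1) = xs ! (q k - 1)"
      using arg_cong[OF assms(4), of "\<lambda>l. l ! (k - 1)"] nth_arrange[OF k(1)] k(2) by simp
    moreover have "p k - 1 < length xs" "q k - 1 < length xs" using r by auto
    ultimately have "p k - 1 = q k - 1" using nth_eq_iff_index_eq[OF assms(1)] by blast
    then show ?thesis using r by simp
  next
    case False
    then show ?thesis
      using assms(2,3) permutes_not_in[of p "{1..length xs}" k] permutes_not_in[of q "{1..length xs}" k]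
      by (auto simp: perms_def)
  qed
qed

section \<open>Standardization of index triples, and reduced polynomials in terms of words\<close>

lemma arrange_3: "arrange p [x, y, z] = [[x, y, z] ! (p 1 - 1), [x, y, z] ! (p 2 - 1), [x, y, z] ! (p 3 - 1)]"
proof -
  have "Suc (length [x, y, z]) = Suc 3" by simp
  then show ?thesis unfolding arrange_def by (simp only: upt_1_4 list.map)
qed

text \<open>The standardization of a list. For distinct triples it is an executable form of the
  permutation that \<open>pattern\<close> describes by \<open>THE\<close>.\<close>

definition ranks :: "nat list \<Rightarrow> nat list" where
  "ranks us = map (\<lambda>x. Suc (length (filter (\<lambda>y. y < x) us))) us"

lemma ranks:
  assumes "distinct us" "length us = 3"
  shows "ranks us \<in> set S3" "arrange (one_line (ranks us)) (sort us) = us"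
proof -
  obtain x y z where us: "us = [x, y, z]"
    using assms(2) by (auto simp: numeral_3_eq_3 length_Suc_conv)
  have n: "Suc 0 = 1" "Suc 1 = 2" "Suc 2 = 3" by simp_all
  have d: "x \<noteq> y" "x \<noteq> z" "y \<noteq> z" using assms(1) us by auto
  then consider "x < y" "y < z" | "x < z" "z < y" | "y < x" "x < z" | "y < z" "z < x"
    | "z < x" "x < y" | "z < y" "y < x" by linarith
  then have "ranks us \<in> set S3 \<and> arrange (one_line (ranks us)) (sort us) = us"
    unfolding us ranks_def by cases (simp_all add: n S3_def arrange_3)
  then show "ranks us \<in> set S3" "arrange (one_line (ranks us)) (sort us) = us" by auto
qed

lemma pattern_eq:
  assumes "distinct us" "length us = 3"
  shows "pattern us = one_line (ranks us)"
  unfolding pattern_def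
proof (rule the_equality)
  show "one_line (ranks us) \<in> perms 3 \<and> us = arrange (one_line (ranks us)) (sort us)"
    using ranks[OF assms] perms_3 by auto
  then show "p = one_line (ranks us)" if "p \<in> perms 3 \<and> us = arrange p (sort us)" for p
    using that arrange_inj[of "sort us" p "one_line (ranks us)"] assms by simp
qed

definition compl_list :: "nat \<Rightarrow> nat list \<Rightarrow> nat list" where
  "compl_list n bs = filter (\<lambda>k. k \<notin> set bs) [1..<Suc n]"

definition word :: "nat \<Rightarrow> (nat \<Rightarrow> nat) \<Rightarrow> nat list" where
  "word n p = map p [1..<Suc n]"

lemma word_props:
  assumes "p \<in> perms n"
  shows "distinct (word n p)" "set (word n p) = {1..n}" "length (word n p) = n"
proof -
  have "inj p" using perms_bij[OF assms] by (rule bij_is_inj)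
  then show "distinct (word n p)"
    unfolding word_def using distinct_map inj_on_subset by (metis distinct_upt subset_UNIV)
  show "set (word n p) = {1..n}"
    unfolding word_def using assms permutes_image[of p "{1..n}"]
    by (simp add: perms_def atLeastLessThanSuc_atLeastAtMost del: upt_Suc)
  show "length (word n p) = n" by (simp add: word_def)
qed

text \<open>Every index occurs exactly once, so the increasing indices of \<open>U\<close> are
  determined by those of the other factor. Hence a reduced monomial is fixed by a permutation in
  \<open>P\<close> and the sorted remaining indices.\<close>

lemma sort_take_word:
  assumes "p \<in> perms n"
  shows "sort (take 3 (word n p)) = compl_list n (sort (drop 3 (word n p)))"
proof (rule sorted_distinct_set_unique)
  note w = word_props[OF assms]
  have "set (word n p) = set (take 3 (word n p)) \<union> set (drop 3 (word n p))"
    by (metis append_take_drop_id set_append)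
  moreover have "set (take 3 (word n p)) \<inter> set (drop 3 (word n p)) = {}"
    using w(1) by (simp add: set_take_disj_set_drop_if_distinct)
  ultimately have "set (take 3 (word n p)) = {1..n} - set (drop 3 (word n p))"
    using w(2) by blast
  then show "set (sort (take 3 (word n p))) = set (compl_list n (sort (drop 3 (word n p))))"
    by (auto simp: compl_list_def simp del: upt_Suc)
  show "sorted (compl_list n (sort (drop 3 (word n p))))" "distinct (compl_list n (sort (drop 3 (word n p))))"
    unfolding compl_list_def by (simp_all add: sorted_wrt_filter del: upt_Suc)
qed (use word_props(1)[OF assms] in simp_all)

text \<open>Polymorphic because it is evaluated both in the field and over the integers.\<close>

definition swap_sign :: "'k \<Rightarrow> nat list \<Rightarrow> 'k::one" where
  "swap_sign \<epsilon> bs = (if sorted bs then 1 else \<epsilon>)"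

lemma reduced_eq:
  assumes "3 \<le> n"
  shows "reduced n \<epsilon> c I P m = (\<Sum>p\<in>perms n. c p * swap_sign \<epsilon> (drop 3 (word n p)) *
    (\<Sum>q\<in>P. red_coeff I P (one_line (ranks (take 3 (word n p)))) q *
      (if m = (arrange q (compl_list n (sort (drop 3 (word n p)))), sort (drop 3 (word n p))) then 1 else 0)))"
  unfolding reduced_def
proof (intro sum.cong refl)
  fix p assume p: "p \<in> perms n"
  have "pattern (take 3 (word n p)) = one_line (ranks (take 3 (word n p)))"
    using word_props[OF p] assms by (intro pattern_eq) auto
  then show "(let us = take 3 (arrange p [1..<Suc n]); bs = drop 3 (arrange p [1..<Suc n])
      in c p * (if sorted bs then 1 else \<epsilon>) * (\<Sum>q\<in>P. red_coeff I P (pattern us) q *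
        (if m = (arrange q (sort us), sort bs) then 1 else 0))) =
    c p * swap_sign \<epsilon> (drop 3 (word n p)) * (\<Sum>q\<in>P. red_coeff I P (one_line (ranks (take 3 (word n p)))) q *
      (if m = (arrange q (compl_list n (sort (drop 3 (word n p)))), sort (drop 3 (word n p))) then 1 else 0))"
    unfolding arrange_upt[OF p] word_def[symmetric] Let_def sort_take_word[OF p, symmetric]
    by (simp add: swap_sign_def)
qed

text \<open>Applied to the function sending \<open>q\<close> to the coordinate of \<open>U\<close>
  with indices rearranged by \<open>q\<close>, this is the replacement rule of the
  reduction.\<close>

lemma solutions_red_coeff:
  fixes I :: "((nat \<Rightarrow> nat) \<Rightarrow> 'k::field_char_0) set"
  assumes I: "gr_star ` I = solutions (of_int s)" and "admissible I P"
    and h: "h \<in> solutions (of_int s)" and z: "z \<in> set S3"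
  shows "h (one_line z) = (\<Sum>q\<in>P. red_coeff I P (one_line z) q * h q)"
proof -
  obtain x y where xy: "x \<in> set S3" "y \<in> set S3" and P: "P = {one_line x, one_line y}"
    and d: "minor s x y \<noteq> 0"
    using assms(2) unfolding admissible_iff[OF I] by blast
  have "x \<noteq> y" using d by auto
  then have ne: "one_line x \<noteq> one_line y"
    using one_line_eq_iff[of x y] length_S3 xy by simp
  have "of_int (minor s x y) * h (one_line z) =
      of_int (minor s z y) * h (one_line x) + of_int (minor s x z) * h (one_line y)"
    unfolding minor_def of_int_diff of_int_mult xy[THEN solutions_coord[OF h]] solutions_coord[OF h z]
    by algebra
  moreover have "of_int (minor s x y) \<noteq> (0::'k)" using d by simp
  ultimately show ?thesis
    unfolding P using ne by (simp add: red_coeff_eq[OF I xy z d] field_simps)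
qed

text \<open>Soundness of the reduction: every replacement is an identity valid for \<open>U\<close>,
  so the formal polynomial keeps its value. The vectors in \<open>vs\<close> may repeat, hence the
  hypothesis on \<open>U\<close> speaks of arbitrary triples from \<open>vs\<close>.\<close>

lemma act_eq_eval_reduced:
  fixes I :: "((nat \<Rightarrow> nat) \<Rightarrow> 'k::field_char_0) set"
  assumes I: "gr_star ` I = solutions (of_int s)" and adm: "admissible I P" and n: "3 \<le> n"
    and vs: "length vs = n"
    and U: "\<And>us. length us = 3 \<Longrightarrow> set us \<subseteq> set vs \<Longrightarrow>
      (\<lambda>q. if q \<in> perms 3 then U (arrange q us) else 0) \<in> solutions (of_int s)"
    and B: "\<And>bs. length bs = n - 3 \<Longrightarrow> set bs \<subseteq> {1..n} \<Longrightarrow>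
      B (map (\<lambda>k. vs ! (k - 1)) bs) = swap_sign \<epsilon> bs * B (map (\<lambda>k. vs ! (k - 1)) (sort bs))"
  shows "act n c (tensor_prod 3 U B) vs = eval_expr (reduced n \<epsilon> c I P) U B vs"
proof -
  define ev where "ev = map (\<lambda>k. vs ! (k - 1))"
  define us where "us p = take 3 (word n p)" for p
  define bs where "bs p = drop 3 (word n p)" for p
  define mono where "mono q p = (arrange q (compl_list n (sort (bs p))), sort (bs p))" for q p
  define \<kappa> where "\<kappa> p q = red_coeff I P (one_line (ranks (us p))) q" for p q
  define val where "val m = U (ev (fst m)) * B (ev (snd m))" for m
  have finP: "finite P" and Psub: "P \<subseteq> perms 3"
    using adm finite_subset[OF _ finite_perms] unfolding admissible_def by auto
  have red: "reduced n \<epsilon> c I P m = (\<Sum>p\<in>perms n. c p * swap_sign \<epsilon> (bs p) *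
      (\<Sum>q\<in>P. \<kappa> p q * (if m = mono q p then 1 else 0)))" for m
    unfolding reduced_eq[OF n] us_def bs_def mono_def \<kappa>_def ..
  \<comment> \<open>The finitely many monomials that can occur. Writing each value as an indicator
    sum over \<open>M\<close> permits exchanging the sums over permutations and monomials.\<close>
  define M where "M = (\<lambda>(q, p). mono q p) ` (P \<times> perms n)"
  have finM: "finite M" unfolding M_def using finP by simp
  have prod_term: "tensor_prod 3 U B (arrange p vs) = swap_sign \<epsilon> (bs p) * (\<Sum>q\<in>P. \<kappa> p q * val (mono q p))"
    if p: "p \<in> perms n" for p
  proof -
    note w = word_props[OF p]
    have us3: "length (us p) = 3" "distinct (us p)" "set (us p) \<subseteq> {1..n}"
      using w n set_take_subset[of 3 "word n p"] unfolding us_def by auto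
    have bsn: "length (bs p) = n - 3" "set (bs p) \<subseteq> {1..n}"
      using w set_drop_subset[of 3 "word n p"] unfolding bs_def by auto
    have a: "arrange p vs = ev (us p) @ ev (bs p)"
      unfolding arrange_conv_word vs ev_def us_def bs_def word_def[symmetric]
      by (simp flip: map_append)
    have l: "length (ev (us p)) = 3" using us3 by (simp add: ev_def)
    have "set (ev (sort (us p))) \<subseteq> set vs"
      using us3(3) vs by (fastforce simp: ev_def)
    moreover have "length (ev (sort (us p))) = 3" using us3 by (simp add: ev_def)
    ultimately have h: "(\<lambda>q. if q \<in> perms 3 then U (arrange q (ev (sort (us p)))) else 0) \<in> solutions (of_int s)"
      using U by blast
    have arr: "arrange q (ev (sort (us p))) = ev (arrange q (sort (us p)))" if "q \<in> perms 3" for q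
      unfolding ev_def using that us3 by (intro arrange_map) simp
    have r: "one_line (ranks (us p)) \<in> perms 3" "ranks (us p) \<in> set S3"
      using ranks(1)[OF us3(2,1)] perms_3 by auto
    \<comment> \<open>The vectors are ordered by their index names, as in the formal reduction; the
      rank word restores the actual order.\<close>
    have "U (ev (us p)) = U (arrange (one_line (ranks (us p))) (ev (sort (us p))))"
      unfolding arr[OF r(1)] ranks(2)[OF us3(2,1)] ..
    also have "\<dots> = (\<Sum>q\<in>P. \<kappa> p q * U (arrange q (ev (sort (us p)))))"
      using solutions_red_coeff[OF I adm h r(2)] r(1) Psub unfolding \<kappa>_def
      by (simp add: subset_iff)
    also have "\<dots> = (\<Sum>q\<in>P. \<kappa> p q * U (ev (fst (mono q p))))"
      using arr Psub sort_take_word[OF p] unfolding mono_def us_def bs_def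
      by (intro sum.cong) auto
    finally have u: "U (ev (us p)) = \<dots>" .
    have b: "B (ev (bs p)) = swap_sign \<epsilon> (bs p) * B (ev (sort (bs p)))"
      unfolding ev_def by (rule B[OF bsn])
    show ?thesis
      unfolding tensor_prod_def a using l u b
      by (simp add: val_def mono_def sum_distrib_left sum_distrib_right algebra_simps)
  qed
  have "act n c (tensor_prod 3 U B) vs = (\<Sum>p\<in>perms n. c p * swap_sign \<epsilon> (bs p) *
      (\<Sum>q\<in>P. \<kappa> p q * val (mono q p)))"
    unfolding act_def using vs prod_term by (simp add: mult.assoc)
  also have "\<dots> = (\<Sum>p\<in>perms n. c p * swap_sign \<epsilon> (bs p) *
      (\<Sum>q\<in>P. \<kappa> p q * (\<Sum>m\<in>M. (if m = mono q p then 1 else 0) * val m)))"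
  proof (intro sum.cong refl arg_cong2[where f = "(*)"])
    fix p q assume "p \<in> perms n" "q \<in> P"
    then have "mono q p \<in> M" unfolding M_def by blast
    then show "val (mono q p) = (\<Sum>m\<in>M. (if m = mono q p then 1 else 0) * val m)"
      using finM by (simp add: mult_delta_left)
  qed
  also have "\<dots> = (\<Sum>p\<in>perms n. \<Sum>q\<in>P. \<Sum>m\<in>M. c p * swap_sign \<epsilon> (bs p) * \<kappa> p q *
      (if m = mono q p then 1 else 0) * val m)"
    by (simp only: sum_distrib_left mult.assoc)
  also have "\<dots> = (\<Sum>p\<in>perms n. \<Sum>m\<in>M. \<Sum>q\<in>P. c p * swap_sign \<epsilon> (bs p) * \<kappa> p q *
      (if m = mono q p then 1 else 0) * val m)"
    by (intro sum.cong refl sum.swap)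
  also have "\<dots> = (\<Sum>m\<in>M. \<Sum>p\<in>perms n. \<Sum>q\<in>P. c p * swap_sign \<epsilon> (bs p) * \<kappa> p q *
      (if m = mono q p then 1 else 0) * val m)"
    by (rule sum.swap)
  also have "\<dots> = (\<Sum>m\<in>M. reduced n \<epsilon> c I P m * val m)"
    unfolding red by (simp only: sum_distrib_left sum_distrib_right mult.assoc)
  also have "\<dots> = (\<Sum>m | reduced n \<epsilon> c I P m \<noteq> 0. reduced n \<epsilon> c I P m * val m)"
  proof (rule sum.mono_neutral_right[OF finM])
    show "{m. reduced n \<epsilon> c I P m \<noteq> 0} \<subseteq> M"
    proof
      fix m assume m: "m \<in> {m. reduced n \<epsilon> c I P m \<noteq> 0}"
      show "m \<in> M"
      proof (rule ccontr)
        assume "m \<notin> M"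
        then have "m \<noteq> mono q p" if "q \<in> P" "p \<in> perms n" for p q
          using that unfolding M_def by blast
        then have "reduced n \<epsilon> c I P m = 0" unfolding red by simp
        then show False using m by simp
      qed
    qed
  qed auto
  also have "\<dots> = eval_expr (reduced n \<epsilon> c I P) U B vs"
    unfolding eval_expr_def val_def ev_def by (intro sum.cong) (auto simp: mult.assoc)
  finally show ?thesis .
qed

section \<open>Lengths of reduced expressions\<close>

text \<open>The components of the vector \<open>v\<^sub>b\<close> are \<open>weight n \<epsilon> c s fst b\<close> and \<open>weight n \<epsilon> c s snd b\<close>.\<close>

definition weight :: "nat \<Rightarrow> 'k \<Rightarrow> ((nat \<Rightarrow> nat) \<Rightarrow> 'k) \<Rightarrow> int \<Rightarrow> (int \<times> int \<Rightarrow> int) \<Rightarrow> nat list \<Rightarrow> 'k::field" where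
  "weight n \<epsilon> c s f b = (\<Sum>p\<in>perms n. c p * (if sort (drop 3 (word n p)) = b
     then swap_sign \<epsilon> (drop 3 (word n p)) * of_int (f (coord s (ranks (take 3 (word n p))))) else 0))"

definition weight_minor :: "nat \<Rightarrow> 'k \<Rightarrow> ((nat \<Rightarrow> nat) \<Rightarrow> 'k) \<Rightarrow> int \<Rightarrow> nat list \<Rightarrow> nat list \<Rightarrow> 'k::field" where
  "weight_minor n \<epsilon> c s z b =
     weight n \<epsilon> c s fst b * of_int (snd (coord s z)) - weight n \<epsilon> c s snd b * of_int (fst (coord s z))"

text \<open>Up to sign, a coefficient is \<open>weight_minor\<close> of the other word divided by
  \<open>minor s x y\<close>, and distinct pairs of a word and a list b give distinct monomials. So
  the count splits into two summands, each depending on one word alone.\<close>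

lemma expr_length_reduced:
  fixes I :: "((nat \<Rightarrow> nat) \<Rightarrow> 'k::field_char_0) set"
  assumes I: "gr_star ` I = solutions (of_int s)" and n: "3 \<le> n"
    and xy: "x \<in> set S3" "y \<in> set S3" and d: "minor s x y \<noteq> 0"
  shows "expr_length (reduced n \<epsilon> c I {one_line x, one_line y}) =
    card {b. weight_minor n \<epsilon> c s x b \<noteq> 0} + card {b. weight_minor n \<epsilon> c s y b \<noteq> 0}"
proof -
  let ?P = "{one_line x, one_line y}"
  let ?e = "reduced n \<epsilon> c I ?P"
  have "x \<noteq> y" using d by auto
  then have ne: "one_line x \<noteq> one_line y"
    using one_line_eq_iff[of x y] length_S3 xy by simp
  have d': "of_int (minor s x y) \<noteq> (0::'k)" using d by simp
  define key where "key p = sort (drop 3 (word n p))" for p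
  define rk where "rk p = ranks (take 3 (word n p))" for p
  define a where "a p = c p * swap_sign \<epsilon> (drop 3 (word n p))" for p
  define K where "K = key ` perms n"
  define mono where "mono q b = (arrange q (compl_list n b), b)" for q b
  have finK: "finite K" unfolding K_def by simp
  have rk: "rk p \<in> set S3" if "p \<in> perms n" for p
    unfolding rk_def using word_props[OF that] n by (intro ranks(1)) auto
  have compl: "distinct (compl_list n b) \<and> length (compl_list n b) = 3" if "b \<in> K" for b
  proof -
    obtain p where p: "p \<in> perms n" "b = key p" using \<open>b \<in> K\<close> unfolding K_def by blast
    show ?thesis
      using word_props[OF p(1)] n unfolding p(2) key_def sort_take_word[OF p(1), symmetric] by simp
  qed
  have P: "?P \<subseteq> perms 3" using xy perms_3 by auto
  \<comment> \<open>An arrangement of \<open>compl_list n b\<close> determines \<open>q\<close>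
    because this list has three distinct entries, which is known for \<open>b\<close> in
    \<open>K\<close>.\<close>
  have mono_eq: "mono q b = mono q' b' \<longleftrightarrow> b = b' \<and> q = q'" if "b \<in> K" "q \<in> ?P" "q' \<in> ?P" for b b' q q'
  proof -
    have "q \<in> perms 3" "q' \<in> perms 3" using that P by blast+
    then show ?thesis using arrange_inj[of "compl_list n b" q q'] compl[OF that(1)]
      unfolding mono_def by auto
  qed
  have e: "?e m = (\<Sum>p\<in>perms n. a p * (\<Sum>q\<in>?P. red_coeff I ?P (one_line (rk p)) q *
      (if m = mono q (key p) then 1 else 0)))" for m
    unfolding reduced_eq[OF n] a_def rk_def mono_def key_def ..
  have at: "?e (mono q b) = (\<Sum>p\<in>perms n. a p * (if key p = b then red_coeff I ?P (one_line (rk p)) q else 0))"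
    if "b \<in> K" "q \<in> ?P" for q b
  proof -
    have "(\<Sum>q'\<in>?P. red_coeff I ?P (one_line (rk p)) q' * (if mono q b = mono q' (key p) then 1 else 0))
      = (if key p = b then red_coeff I ?P (one_line (rk p)) q else 0)" for p
    proof -
      have "(\<Sum>q'\<in>?P. red_coeff I ?P (one_line (rk p)) q' * (if mono q b = mono q' (key p) then 1 else 0))
        = (\<Sum>q'\<in>?P. if q' = q then (if key p = b then red_coeff I ?P (one_line (rk p)) q else 0) else 0)"
        using mono_eq[OF that] by (intro sum.cong) auto
      also have "\<dots> = (if key p = b then red_coeff I ?P (one_line (rk p)) q else 0)"
        using that(2) by (simp only: sum.delta finite.intros if_True)
      finally show ?thesis .
    qed
    then show ?thesis unfolding e by (simp only:)
  qed
  have w: "weight n \<epsilon> c s f b = (\<Sum>p\<in>perms n. a p * (if key p = b then of_int (f (coord s (rk p))) else 0))" for f b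
    unfolding weight_def a_def key_def rk_def by (intro sum.cong) (auto simp: mult.assoc)
  have at_x: "of_int (minor s x y) * ?e (mono (one_line x) b) = weight_minor n \<epsilon> c s y b" if "b \<in> K" for b
  proof -
    have "of_int (minor s x y) * ?e (mono (one_line x) b)
      = (\<Sum>p\<in>perms n. a p * (if key p = b then of_int (minor s (rk p) y) else 0))"
      unfolding at[OF that insertI1] sum_distrib_left
      using d' by (intro sum.cong) (simp_all add: red_coeff_eq[OF I xy rk d])
    also have "\<dots> = weight_minor n \<epsilon> c s y b"
      unfolding weight_minor_def w minor_def sum_distrib_right sum_subtractf[symmetric]
      by (intro sum.cong) (auto simp: algebra_simps)
    finally show ?thesis .
  qed
  have at_y: "of_int (minor s x y) * ?e (mono (one_line y) b) = - weight_minor n \<epsilon> c s x b" if "b \<in> K" for b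
  proof -
    have "of_int (minor s x y) * ?e (mono (one_line y) b)
      = (\<Sum>p\<in>perms n. a p * (if key p = b then of_int (minor s x (rk p)) else 0))"
      unfolding at[OF that insertI2[OF singletonI]] sum_distrib_left
      using d' ne by (intro sum.cong) (simp_all add: red_coeff_eq[OF I xy rk d])
    also have "\<dots> = - weight_minor n \<epsilon> c s x b"
      unfolding weight_minor_def w minor_def sum_distrib_right sum_subtractf[symmetric] sum_negf[symmetric]
      by (intro sum.cong) (auto simp: algebra_simps)
    finally show ?thesis .
  qed
  \<comment> \<open>A list that no permutation produces has weight zero; this also makes both
    counted sets finite.\<close>
  have nzK: "b \<in> K" if "weight_minor n \<epsilon> c s z b \<noteq> 0" for b z
  proof (rule ccontr)
    assume "b \<notin> K"
    then have "key p \<noteq> b" if "p \<in> perms n" for p using that unfolding K_def by blast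
    then have "weight n \<epsilon> c s f b = 0" for f unfolding w by simp
    then show False using that unfolding weight_minor_def by simp
  qed
  let ?X = "{b. weight_minor n \<epsilon> c s x b \<noteq> 0}" and ?Y = "{b. weight_minor n \<epsilon> c s y b \<noteq> 0}"
  have XK: "?X \<subseteq> K" "?Y \<subseteq> K" using nzK by auto
  have "{m. ?e m \<noteq> 0} = mono (one_line x) ` ?Y \<union> mono (one_line y) ` ?X"
  proof (intro equalityI subsetI)
    fix m assume m: "m \<in> {m. ?e m \<noteq> 0}"
    have "\<exists>p\<in>perms n. \<exists>q\<in>?P. m = mono q (key p)"
    proof (rule ccontr)
      assume no: "\<not> ?thesis"
      have "(\<Sum>q\<in>?P. red_coeff I ?P (one_line (rk p)) q * (if m = mono q (key p) then 1 else 0)) = 0"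
        if "p \<in> perms n" for p
        by (rule sum.neutral) (use no that in auto)
      then have "?e m = 0" unfolding e by simp
      then show False using m by simp
    qed
    then obtain p q where pq: "p \<in> perms n" "q \<in> ?P" "m = mono q (key p)" by blast
    have k: "key p \<in> K" using pq(1) unfolding K_def by blast
    show "m \<in> mono (one_line x) ` ?Y \<union> mono (one_line y) ` ?X"
    proof (cases "q = one_line x")
      case True
      then have "key p \<in> ?Y" using at_x[OF k] m pq(3) d' by auto
      then show ?thesis using True pq(3) by blast
    next
      case False
      then have q: "q = one_line y" using pq(2) by blast
      then have "key p \<in> ?X" using at_y[OF k] m pq(3) d' by auto
      then show ?thesis using q pq(3) by blast
    qed
  next
    fix m assume "m \<in> mono (one_line x) ` ?Y \<union> mono (one_line y) ` ?X"
    then show "m \<in> {m. ?e m \<noteq> 0}"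
    proof
      assume "m \<in> mono (one_line x) ` ?Y"
      then obtain b where "b \<in> ?Y" "m = mono (one_line x) b" by blast
      then show ?thesis using at_x[of b] XK by auto
    next
      assume "m \<in> mono (one_line y) ` ?X"
      then obtain b where "b \<in> ?X" "m = mono (one_line y) b" by blast
      then show ?thesis using at_y[of b] XK by auto
    qed
  qed
  moreover have "mono (one_line x) ` ?Y \<inter> mono (one_line y) ` ?X = {}"
    using mono_eq XK ne by blast
  moreover have "card (mono q ` Z) = card Z" if "Z \<subseteq> K" for q Z
    by (rule card_image) (auto simp: inj_on_def mono_def)
  moreover have "finite ?X" "finite ?Y" using XK finK finite_subset by blast+
  ultimately show ?thesis
    unfolding expr_length_def using XK by (simp add: card_Un_disjoint)
qed

text \<open>The star reverses the products \<open>p \<circ> q\<close> of a row and a column permutation; since both groups are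
  closed under inversion, the terms of the starred symmetrizer are the \<open>q \<circ> p\<close> with the sign of \<open>q\<close>.\<close>

definition young_terms :: "nat list list \<Rightarrow> (nat list \<times> int) list \<Rightarrow> (nat list \<times> int) list" where
  "young_terms R C = concat (map (\<lambda>r. map (\<lambda>(c, a). (map (one_line c) r, a)) C) R)"

text \<open>Replaces a sum over all permutations by one over an explicit list, of 16 terms for the
  first tableau and 48 for the second. The function \<open>F\<close> is arbitrary so that it can
  stand for either component of any weight.\<close>

lemma sum_star_young_symmetrizer:
  fixes F :: "(nat \<Rightarrow> nat) \<Rightarrow> 'k::field"
  assumes n: "sum_list (map length t) = n"
    and R: "row_group t = one_line ` set R" "distinct R" "\<And>r. r \<in> set R \<Longrightarrow> length r = n"
    and C: "column_group t = one_line ` fst ` set C" "distinct (map fst C)"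
      "\<And>c a. (c, a) \<in> set C \<Longrightarrow> length c = n \<and> sign (one_line c) = a"
  shows "(\<Sum>p\<in>perms n. gr_star (young_symmetrizer t) p * F p)
    = (\<Sum>(w, a)\<leftarrow>young_terms R C. of_int a * F (one_line w))"
proof -
  let ?y = "young_symmetrizer t :: _ \<Rightarrow> 'k"
  have sub: "row_group t \<subseteq> perms n" "column_group t \<subseteq> perms n"
    using n by (auto simp: row_group_def column_group_def)
  have image_inv: "inv p ` A = A" if "p ` A = A" "bij p" for p :: "nat \<Rightarrow> nat" and A
    using that by (metis bij_is_inj image_inv_f_f)
  have inv_row: "inv p \<in> row_group t" if "p \<in> row_group t" for p
    using that perms_inv image_inv[OF _ perms_bij] unfolding row_group_def by blast
  have inv_col: "inv p \<in> column_group t" if "p \<in> column_group t" for p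
    using that perms_inv image_inv[OF _ perms_bij] unfolding column_group_def by blast
  have bij: "bij_betw inv A A" if "A \<subseteq> perms n" "\<And>p. p \<in> A \<Longrightarrow> inv p \<in> A" for A
    using that perms_inv_inv by (intro bij_betwI[where g = inv]) blast+
  have "(\<Sum>p\<in>perms n. gr_star ?y p * F p) = (\<Sum>p\<in>perms n. ?y (inv p) * F p)"
    by (intro sum.cong) (simp_all add: gr_star_def perms_bij)
  also have "\<dots> = (\<Sum>p\<in>perms n. ?y p * F (inv p))"
    using sum.reindex_bij_betw[OF bij_betw_inv_perms, of "\<lambda>p. ?y p * F (inv p)" n]
    by (simp add: perms_inv_inv)
  also have "\<dots> = (\<Sum>s\<in>perms n. \<Sum>p\<in>row_group t. \<Sum>q\<in>column_group t.
      of_int (sign q) * (if s = p \<circ> q then F (inv (p \<circ> q)) else 0))"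
    unfolding young_symmetrizer_def sum_distrib_right
    by (intro sum.cong refl) (auto simp: gr_single_def)
  also have "\<dots> = (\<Sum>p\<in>row_group t. \<Sum>s\<in>perms n. \<Sum>q\<in>column_group t.
      of_int (sign q) * (if s = p \<circ> q then F (inv (p \<circ> q)) else 0))"
    by (rule sum.swap)
  also have "\<dots> = (\<Sum>p\<in>row_group t. \<Sum>q\<in>column_group t. \<Sum>s\<in>perms n.
      of_int (sign q) * (if s = p \<circ> q then F (inv (p \<circ> q)) else 0))"
    by (intro sum.cong refl sum.swap)
  also have "\<dots> = (\<Sum>p\<in>row_group t. \<Sum>q\<in>column_group t. of_int (sign (inv q)) * F (inv q \<circ> inv p))"
  proof (intro sum.cong refl)
    fix p q assume "p \<in> row_group t" "q \<in> column_group t"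
    then have pq: "p \<in> perms n" "q \<in> perms n" using sub by auto
    have "permutation q" using pq(2) permutation_permutes unfolding perms_def by blast
    then show "(\<Sum>s\<in>perms n. of_int (sign q) * (if s = p \<circ> q then F (inv (p \<circ> q)) else 0))
      = of_int (sign (inv q)) * F (inv q \<circ> inv p)"
      using perms_compose[OF pq] pq[THEN perms_bij]
      by (simp add: o_inv_distrib mult_delta_right sign_inverse)
  qed
  also have "\<dots> = (\<Sum>p\<in>row_group t. \<Sum>q\<in>column_group t. of_int (sign q) * F (q \<circ> inv p))"
    by (intro sum.cong refl sum.reindex_bij_betw[OF bij[OF sub(2) inv_col],
          of "\<lambda>q. of_int (sign q) * F (q \<circ> inv _)"])
  also have "\<dots> = (\<Sum>p\<in>row_group t. \<Sum>q\<in>column_group t. of_int (sign q) * F (q \<circ> p))"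
    by (rule sum.reindex_bij_betw[OF bij[OF sub(1) inv_row],
          of "\<lambda>p. \<Sum>q\<in>column_group t. of_int (sign q) * F (q \<circ> p)"])
  also have "\<dots> = (\<Sum>r\<in>set R. \<Sum>c\<in>fst ` set C. of_int (sign (one_line c)) * F (one_line c \<circ> one_line r))"
  proof -
    have "inj_on one_line (set R)" "inj_on one_line (fst ` set C)"
      using R(3) C(3) by (auto intro!: inj_on_one_line[of _ n])
    then show ?thesis unfolding R(1) C(1) by (simp only: sum.reindex o_def)
  qed
  also have "\<dots> = (\<Sum>r\<in>set R. \<Sum>(c, a)\<in>set C. of_int a * F (one_line (map (one_line c) r)))"
  proof (intro sum.cong refl)
    fix r assume r: "r \<in> set R"
    have "(\<Sum>c\<in>fst ` set C. of_int (sign (one_line c)) * F (one_line c \<circ> one_line r))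
      = (\<Sum>ca\<in>set C. of_int (sign (one_line (fst ca))) * F (one_line (fst ca) \<circ> one_line r))"
      using C(2) by (subst sum.reindex) (auto simp: distinct_map)
    also have "\<dots> = (\<Sum>(c, a)\<in>set C. of_int a * F (one_line (map (one_line c) r)))"
      using C(3) R(3)[OF r] by (intro sum.cong) (auto simp: one_line_compose)
    finally show "(\<Sum>c\<in>fst ` set C. of_int (sign (one_line c)) * F (one_line c \<circ> one_line r)) = \<dots>" .
  qed
  also have "\<dots> = (\<Sum>r\<leftarrow>R. \<Sum>(c, a)\<leftarrow>C. of_int a * F (one_line (map (one_line c) r)))"
    using R(2) C(2) by (simp add: sum.distinct_set_conv_list distinct_map)
  also have "\<dots> = (\<Sum>(w, a)\<leftarrow>young_terms R C. of_int a * F (one_line w))"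
    unfolding young_terms_def
    by (induction R) (simp_all add: o_def case_prod_unfold)
  finally show ?thesis .
qed

section \<open>Integer evaluation of the lengths\<close>

definition young_data :: "int \<Rightarrow> int \<Rightarrow> (nat list \<times> int) list \<Rightarrow> (nat list \<times> int \<times> int \<times> int) list" where
  "young_data e s T =
     map (\<lambda>(w, a). (sort (drop 3 w), a * swap_sign e (drop 3 w), coord s (ranks (take 3 w)))) T"

definition total :: "(int \<times> int \<Rightarrow> int) \<Rightarrow> (nat list \<times> int \<times> int \<times> int) list \<Rightarrow> nat list \<Rightarrow> int" where
  "total f D b = (\<Sum>(k, a, v)\<leftarrow>D. if k = b then a * f v else 0)"

text \<open>Several terms of the symmetrizer share their index list; \<open>remdups\<close> makes
  each list contribute one vector.\<close>

definition totals :: "(nat list \<times> int \<times> int \<times> int) list \<Rightarrow> (int \<times> int) list" where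
  "totals D = map (\<lambda>b. (total fst D b, total snd D b)) (remdups (map fst D))"

definition minor_count :: "int \<Rightarrow> (int \<times> int) list \<Rightarrow> nat list \<Rightarrow> nat" where
  "minor_count s W z = length (filter (\<lambda>(u, v). u * snd (coord s z) \<noteq> v * fst (coord s z)) W)"

lemma word_one_line:
  assumes "length w = n"
  shows "word n (one_line w) = w"
  using assms by (intro nth_equalityI) (auto simp: word_def one_line_def simp del: upt_Suc)

lemma of_int_sum_list_map: "of_int (\<Sum>x\<leftarrow>xs. g x) = (\<Sum>x\<leftarrow>xs. of_int (g x))"
  by (induction xs) simp_all

text \<open>Signs, swap factors and coordinate vectors are all images of integers, and
  \<open>of_int\<close> is injective in characteristic 0. Non-vanishing in the field is therefore
  decided by integer totals.\<close>

lemma card_weight_minor: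
  fixes t :: "nat list list" and e s :: int
  assumes n: "sum_list (map length t) = n"
    and R: "row_group t = one_line ` set R" "distinct R" "\<And>r. r \<in> set R \<Longrightarrow> length r = n"
    and C: "column_group t = one_line ` fst ` set C" "distinct (map fst C)"
      "\<And>c a. (c, a) \<in> set C \<Longrightarrow> length c = n \<and> sign (one_line c) = a"
  shows "card {b. weight_minor n (of_int e) (gr_star (young_symmetrizer t)) s z b \<noteq> (0::'k::field_char_0)}
    = minor_count s (totals (young_data e s (young_terms R C))) z"
proof -
  let ?T = "young_terms R C"
  let ?D = "young_data e s ?T"
  let ?K = "remdups (map fst ?D)"
  have len: "length w = n" if "(w, a) \<in> set ?T" for w a
    using that R(3) unfolding young_terms_def by auto
  have w: "weight n (of_int e) (gr_star (young_symmetrizer t)) s f b = (of_int (total f ?D b) :: 'k)" for f b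
  proof -
    let ?F = "\<lambda>p. if sort (drop 3 (word n p)) = b then swap_sign (of_int e) (drop 3 (word n p)) *
        of_int (f (coord s (ranks (take 3 (word n p))))) else (0::'k)"
    have "weight n (of_int e) (gr_star (young_symmetrizer t)) s f b
      = (\<Sum>(w, a)\<leftarrow>?T. of_int a * ?F (one_line w))"
      unfolding weight_def by (rule sum_star_young_symmetrizer[OF n R C])
    also have "\<dots> = (\<Sum>x\<leftarrow>?T. of_int (if sort (drop 3 (fst x)) = b
     then snd x * swap_sign e (drop 3 (fst x)) * f (coord s (ranks (take 3 (fst x)))) else 0))"
      by (intro arg_cong[where f = sum_list] map_cong refl)
        (auto simp: word_one_line[OF len] swap_sign_def)
    also have "\<dots> = of_int (total f ?D b)"
      unfolding total_def young_data_def of_int_sum_list_map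
      by (intro arg_cong[where f = sum_list]) (simp add: case_prod_unfold)
    finally show ?thesis .
  qed
  have "weight_minor n (of_int e) (gr_star (young_symmetrizer t)) s z b \<noteq> (0::'k) \<longleftrightarrow>
      total fst ?D b * snd (coord s z) \<noteq> total snd ?D b * fst (coord s z)" for b
    unfolding weight_minor_def w of_int_mult[symmetric] right_minus_eq of_int_eq_iff ..
  \<comment> \<open>Index lists carried by no term have zero totals, so only the listed keys can be
    counted.\<close>
  moreover have "total f ?D b = 0" if "b \<notin> set ?K" for f b
  proof -
    have "map (\<lambda>(k, a, v). if k = b then a * f v else 0) ?D = map (\<lambda>_. 0) ?D"
      using that by (intro map_cong) force+
    then show ?thesis unfolding total_def by (simp only: sum_list_0)
  qed
  then have "b \<in> set ?K" if "total fst ?D b * snd (coord s z) \<noteq> total snd ?D b * fst (coord s z)" for b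
    using that by (metis mult_zero_left)
  ultimately have "{b. weight_minor n (of_int e) (gr_star (young_symmetrizer t)) s z b \<noteq> (0::'k)}
    = set (filter (\<lambda>b. total fst ?D b * snd (coord s z) \<noteq> total snd ?D b * fst (coord s z)) ?K)"
    unfolding set_filter by blast
  then have "card {b. weight_minor n (of_int e) (gr_star (young_symmetrizer t)) s z b \<noteq> (0::'k)}
    = length (filter (\<lambda>b. total fst ?D b * snd (coord s z) \<noteq> total snd ?D b * fst (coord s z)) ?K)"
    by (simp only: distinct_card distinct_filter distinct_remdups)
  then show ?thesis
    unfolding minor_count_def totals_def filter_map by (simp add: o_def)
qed

text \<open>Turns the minimum over all admissible sets into a finite search over pairs of words,
  since each length is a sum of two values of \<open>g\<close>.\<close>

lemma Least_expr_length:
  fixes I :: "((nat \<Rightarrow> nat) \<Rightarrow> 'k::field_char_0) set"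
  assumes I: "gr_star ` I = solutions (of_int s)" and n3: "3 \<le> n"
    and card: "\<And>z. card {b. weight_minor n \<epsilon> c s z b \<noteq> (0::'k)} = g z"
    and ex: "\<exists>x\<in>set S3. \<exists>y\<in>set S3. minor s x y \<noteq> 0 \<and> g x + g y = m"
    and min: "\<forall>x\<in>set S3. \<forall>y\<in>set S3. minor s x y \<noteq> 0 \<longrightarrow> m \<le> g x + g y"
  shows "(LEAST l. \<exists>P. admissible I P \<and> l = expr_length (reduced n \<epsilon> c I P)) = m"
proof (rule Least_equality)
  note len = expr_length_reduced[OF I n3, of _ _ "\<epsilon>" c, unfolded card]
  show "\<exists>P. admissible I P \<and> m = expr_length (reduced n \<epsilon> c I P)"
    proof -
    obtain x y where xy: "x \<in> set S3" "y \<in> set S3" "minor s x y \<noteq> 0" "g x + g y = m"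
      using ex by blast
    then show ?thesis
      unfolding admissible_iff[OF I] using len[OF xy(1-3)] by (intro exI[of _ "{one_line x, one_line y}"]) auto
  qed
  show "m \<le> l" if l: "\<exists>P. admissible I P \<and> l = expr_length (reduced n \<epsilon> c I P)" for l
    proof -
    obtain P where "admissible I P" and le: "l = expr_length (reduced n \<epsilon> c I P)" using l by blast
    then obtain x y where xy: "x \<in> set S3" "y \<in> set S3" "minor s x y \<noteq> 0" and "P = {one_line x, one_line y}"
      unfolding admissible_iff[OF I] by blast
    then show ?thesis using le len[OF xy] min by simp
  qed
qed

section \<open>The two tableaux\<close>

definition rows4 :: "nat list list" where
  "rows4 = [[1,2,3,4], [3,2,1,4], [1,4,3,2], [3,4,1,2]]"

definition cols4 :: "(nat list \<times> int) list" where
  "cols4 = [([1,2,3,4], 1), ([2,1,3,4], -1), ([1,2,4,3], -1), ([2,1,4,3], 1)]"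

definition rows5 :: "nat list list" where
  "rows5 = [[1,2,3,4,5], [1,2,5,4,3], [3,2,1,4,5], [3,2,5,4,1], [5,2,1,4,3], [5,2,3,4,1],
            [1,4,3,2,5], [1,4,5,2,3], [3,4,1,2,5], [3,4,5,2,1], [5,4,1,2,3], [5,4,3,2,1]]"

definition cols5 :: "(nat list \<times> int) list" where
  "cols5 = [([1,2,3,4,5], 1), ([2,1,3,4,5], -1), ([1,2,4,3,5], -1), ([2,1,4,3,5], 1)]"

lemma upt_1_5: "[1..<Suc 4] = [1, 2, 3, 4]"
  by code_simp

lemma upt_1_6: "[1..<Suc 5] = [1, 2, 3, 4, 5]"
  by code_simp

lemma one_line_4 [simp]:
  "one_line [a,b,c,d] 1 = a" "one_line [a,b,c,d] 2 = b" "one_line [a,b,c,d] 3 = c"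
  "one_line [a,b,c,d] 4 = d"
  by (simp_all add: one_line_def)

lemma one_line_5 [simp]:
  "one_line [a,b,c,d,e] 1 = a" "one_line [a,b,c,d,e] 2 = b" "one_line [a,b,c,d,e] 3 = c"
  "one_line [a,b,c,d,e] 4 = d" "one_line [a,b,c,d,e] 5 = e"
  by (simp_all add: one_line_def)

lemma perms_4_word: "p \<in> perms 4 \<Longrightarrow> p = one_line [p 1, p 2, p 3, p 4]"
  using one_line_word[of p 4] unfolding upt_1_5 by simp

lemma perms_5_word: "p \<in> perms 5 \<Longrightarrow> p = one_line [p 1, p 2, p 3, p 4, p 5]"
  using one_line_word[of p 5] unfolding upt_1_6 by simp

lemma perms_neq: "p \<in> perms n \<Longrightarrow> a \<noteq> b \<Longrightarrow> p a \<noteq> p b"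
  using perms_bij[of p n] by (auto dest: bij_is_inj injD)

lemma one_line_perms:
  assumes "distinct xs" "set xs = {1..n}" "length xs = n"
  shows "one_line xs \<in> perms n"
  using one_line_mem[of xs] assms by simp

lemma interval_lists: "{1..4::nat} = set [1,2,3,4]" "{1..5::nat} = set [1,2,3,4,5]"
  by (auto simp: One_nat_def)

lemma mem_rows4:
  fixes a b c d :: nat
  assumes "a \<in> {1,3}" "c \<in> {1,3}" "a \<noteq> c" "b \<in> {2,4}" "d \<in> {2,4}" "b \<noteq> d"
  shows "[a, b, c, d] \<in> set rows4"
  using assms unfolding rows4_def by (elim insertE emptyE; simp)

lemma mem_cols4:
  fixes a b c d :: nat
  assumes "a \<in> {1,2}" "b \<in> {1,2}" "a \<noteq> b" "c \<in> {3,4}" "d \<in> {3,4}" "c \<noteq> d"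
  shows "[a, b, c, d] \<in> set (map fst cols4)"
  using assms unfolding cols4_def by (elim insertE emptyE; simp)

lemma mem_rows5:
  fixes a b c d e :: nat
  assumes "a \<in> {1,3,5}" "c \<in> {1,3,5}" "e \<in> {1,3,5}" "a \<noteq> c" "a \<noteq> e" "c \<noteq> e"
    "b \<in> {2,4}" "d \<in> {2,4}" "b \<noteq> d"
  shows "[a, b, c, d, e] \<in> set rows5"
  using assms unfolding rows5_def by (elim insertE emptyE; simp)

lemma mem_cols5:
  fixes a b c d :: nat
  assumes "a \<in> {1,2}" "b \<in> {1,2}" "a \<noteq> b" "c \<in> {3,4}" "d \<in> {3,4}" "c \<noteq> d"
  shows "[a, b, c, d, 5] \<in> set (map fst cols5)"
  using assms unfolding cols5_def by (elim insertE emptyE; simp)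

lemma row_group_4: "row_group [[1,3],[2,4]] = one_line ` set rows4"
proof
  have n: "sum_list (map length [[1,3],[2,4::nat]]) = 4" by simp
  show "row_group [[1,3],[2,4]] \<subseteq> one_line ` set rows4"
  proof
    fix p assume "p \<in> row_group [[1,3],[2,4]]"
    then have p: "p \<in> perms 4" "p ` {1,3} = {1,3}" "p ` {2,4} = {2,4}"
      unfolding row_group_def n by auto
    have "[p 1, p 2, p 3, p 4] \<in> set rows4"
      using p(2,3) by (intro mem_rows4 perms_neq[OF p(1)]) auto
    then show "p \<in> one_line ` set rows4" using perms_4_word[OF p(1)] by blast
  qed
  show "one_line ` set rows4 \<subseteq> row_group [[1,3],[2,4]]"
  proof
    fix p assume "p \<in> one_line ` set rows4"
    then obtain xs where xs: "xs \<in> set rows4" "p = one_line xs" by blast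
    have "p \<in> perms 4"
      unfolding xs(2) interval_lists by (rule one_line_perms; use xs(1) in \<open>auto simp: rows4_def interval_lists\<close>)
    then show "p \<in> row_group [[1,3],[2,4]]"
      unfolding row_group_def n using xs by (auto simp: rows4_def)
  qed
qed

lemma row_group_5: "row_group [[1,3,5],[2,4]] = one_line ` set rows5"
proof
  have n: "sum_list (map length [[1,3,5],[2,4::nat]]) = 5" by simp
  show "row_group [[1,3,5],[2,4]] \<subseteq> one_line ` set rows5"
  proof
    fix p assume "p \<in> row_group [[1,3,5],[2,4]]"
    then have p: "p \<in> perms 5" "p ` {1,3,5} = {1,3,5}" "p ` {2,4} = {2,4}"
      unfolding row_group_def n by auto
    have "p 1 \<in> {1,3,5}" "p 3 \<in> {1,3,5}" "p 5 \<in> {1,3,5}" "p 2 \<in> {2,4}" "p 4 \<in> {2,4}"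
      using p(2,3) by blast+
    then have "[p 1, p 2, p 3, p 4, p 5] \<in> set rows5"
      by (intro mem_rows5 perms_neq[OF p(1)]) simp_all
    then show "p \<in> one_line ` set rows5" using perms_5_word[OF p(1)] by blast
  qed
  show "one_line ` set rows5 \<subseteq> row_group [[1,3,5],[2,4]]"
  proof
    fix p assume "p \<in> one_line ` set rows5"
    then obtain xs where xs: "xs \<in> set rows5" "p = one_line xs" by blast
    have "p \<in> perms 5"
      unfolding xs(2) by (rule one_line_perms; use xs(1) in \<open>auto simp: rows5_def interval_lists\<close>)
    then show "p \<in> row_group [[1,3,5],[2,4]]"
      unfolding row_group_def n using xs by (auto simp: rows5_def)
  qed
qed

lemma tableau_column_two_rows:
  "tableau_column [r, r'] j =
    (if j < length r then {r ! j} else {}) \<union> (if j < length r' then {r' ! j} else {})"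
  by (auto simp: tableau_column_def)

lemma tableau_column_4:
  "tableau_column [[1,3],[2,4]] j = (if j = 0 then {1,2} else if j = 1 then {3,4} else {})"
proof -
  consider "j = 0" | "j = 1" | "2 \<le> j" by linarith
  then show ?thesis
    unfolding tableau_column_two_rows by cases auto
qed

lemma tableau_column_5:
  "tableau_column [[1,3,5],[2,4]] j =
    (if j = 0 then {1,2} else if j = 1 then {3,4} else if j = 2 then {5} else {})"
proof -
  consider "j = 0" | "j = 1" | "j = 2" | "3 \<le> j" by linarith
  then show ?thesis
    unfolding tableau_column_two_rows by cases auto
qed

lemma column_group_4: "column_group [[1,3],[2,4]] = one_line ` fst ` set cols4"
proof
  have n: "sum_list (map length [[1,3],[2,4::nat]]) = 4" by simp
  show "column_group [[1,3],[2,4]] \<subseteq> one_line ` fst ` set cols4"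
  proof
    fix p assume p': "p \<in> column_group [[1,3],[2,4]]"
    then have p: "p \<in> perms 4" and c: "\<And>j. p ` tableau_column [[1,3],[2,4]] j = tableau_column [[1,3],[2,4]] j"
      unfolding column_group_def n by auto
    have "p ` {1,2} = {1,2}" "p ` {3,4} = {3,4}"
      using c[of 0] c[of 1] unfolding tableau_column_4 by simp_all
    then have "[p 1, p 2, p 3, p 4] \<in> set (map fst cols4)"
      by (intro mem_cols4 perms_neq[OF p]) auto
    then show "p \<in> one_line ` fst ` set cols4" using perms_4_word[OF p] by auto
  qed
  show "one_line ` fst ` set cols4 \<subseteq> column_group [[1,3],[2,4]]"
  proof
    fix p assume "p \<in> one_line ` fst ` set cols4"
    then obtain xs where xs: "xs \<in> fst ` set cols4" "p = one_line xs" by blast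
    have "p \<in> perms 4"
      unfolding xs(2) by (rule one_line_perms; use xs(1) in \<open>auto simp: cols4_def interval_lists\<close>)
    then show "p \<in> column_group [[1,3],[2,4]]"
      unfolding column_group_def n tableau_column_4 using xs by (auto simp: cols4_def)
  qed
qed

lemma column_group_5: "column_group [[1,3,5],[2,4]] = one_line ` fst ` set cols5"
proof
  have n: "sum_list (map length [[1,3,5],[2,4::nat]]) = 5" by simp
  show "column_group [[1,3,5],[2,4]] \<subseteq> one_line ` fst ` set cols5"
  proof
    fix p assume p': "p \<in> column_group [[1,3,5],[2,4]]"
    then have p: "p \<in> perms 5" and c: "\<And>j. p ` tableau_column [[1,3,5],[2,4]] j = tableau_column [[1,3,5],[2,4]] j"
      unfolding column_group_def n by auto
    have "p ` {1,2} = {1,2}" "p ` {3,4} = {3,4}" "p 5 = 5"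
      using c[of 0] c[of 1] c[of 2] unfolding tableau_column_5 by simp_all
    then have "[p 1, p 2, p 3, p 4, p 5] \<in> set (map fst cols5)"
      unfolding \<open>p 5 = 5\<close> by (intro mem_cols5 perms_neq[OF p]) auto
    then show "p \<in> one_line ` fst ` set cols5" using perms_5_word[OF p] by auto
  qed
  show "one_line ` fst ` set cols5 \<subseteq> column_group [[1,3,5],[2,4]]"
  proof
    fix p assume "p \<in> one_line ` fst ` set cols5"
    then obtain xs where xs: "xs \<in> fst ` set cols5" "p = one_line xs" by blast
    have "p \<in> perms 5"
      unfolding xs(2) by (rule one_line_perms; use xs(1) in \<open>auto simp: cols5_def interval_lists\<close>)
    then show "p \<in> column_group [[1,3,5],[2,4]]"
      unfolding column_group_def n tableau_column_5 using xs by (auto simp: cols5_def)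
  qed
qed

lemma one_line_eqI: "p \<in> perms n \<Longrightarrow> map p [1..<Suc n] = w \<Longrightarrow> one_line w = p"
  using one_line_word by blast

lemma transpose_perms: "a \<in> {1..n} \<Longrightarrow> b \<in> {1..n} \<Longrightarrow> Transposition.transpose a b \<in> perms n"
  by (simp add: perms_def permutes_swap_id)

lemma id_perms: "id \<in> perms n"
  by (simp add: perms_def permutes_id)

lemma sign_transpose: "a \<noteq> b \<Longrightarrow> sign (Transposition.transpose a b) = - 1"
  by (simp add: sign_swap_id)

lemma sign_transpose2: "a \<noteq> b \<Longrightarrow> c \<noteq> d \<Longrightarrow> sign (Transposition.transpose a b \<circ> Transposition.transpose c d) = 1"
  by (simp add: sign_compose permutation_swap_id sign_swap_id)

text \<open>Factorizations into transpositions, from which signs of words are computed.\<close>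

lemma one_line_transpositions_3:
  "one_line [1,3,2] = Transposition.transpose 2 3" "one_line [2,1,3] = Transposition.transpose 1 2"
  "one_line [3,2,1] = Transposition.transpose 1 3"
  "one_line [2,3,1] = Transposition.transpose 1 2 \<circ> Transposition.transpose 2 3" "one_line [3,1,2] = Transposition.transpose 2 3 \<circ> Transposition.transpose 1 2"
  by (rule one_line_eqI[of _ 3], (intro perms_compose transpose_perms id_perms; simp)[1],
      unfold upt_1_4, simp add: Transposition.transpose_def)+

lemma one_line_transpositions_4:
  "one_line [1,2,3,4] = id" "one_line [2,1,3,4] = Transposition.transpose 1 2" "one_line [1,2,4,3] = Transposition.transpose 3 4"
  "one_line [2,1,4,3] = Transposition.transpose 1 2 \<circ> Transposition.transpose 3 4"
  by (rule one_line_eqI[of _ 4], (intro perms_compose transpose_perms id_perms; simp)[1],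
      unfold upt_1_5, simp add: Transposition.transpose_def)+

lemma one_line_transpositions_5:
  "one_line [1,2,3,4,5] = id" "one_line [2,1,3,4,5] = Transposition.transpose 1 2" "one_line [1,2,4,3,5] = Transposition.transpose 3 4"
  "one_line [2,1,4,3,5] = Transposition.transpose 1 2 \<circ> Transposition.transpose 3 4"
  by (rule one_line_eqI[of _ 5], (intro perms_compose transpose_perms id_perms; simp)[1],
      unfold upt_1_6, simp add: Transposition.transpose_def)+

lemma rows4_cols4:
  "sum_list (map length [[1,3],[2,4::nat]]) = 4" "distinct rows4" "\<And>r. r \<in> set rows4 \<Longrightarrow> length r = 4"
  "distinct (map fst cols4)" "\<And>c a. (c, a) \<in> set cols4 \<Longrightarrow> length c = 4 \<and> sign (one_line c) = a"
proof -
  show "length c = 4 \<and> sign (one_line c) = a" if "(c, a) \<in> set cols4" for c a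
    using that by (auto simp: cols4_def one_line_transpositions_4 sign_transpose sign_transpose2)
qed (auto simp: rows4_def cols4_def)

lemma rows5_cols5:
  "sum_list (map length [[1,3,5],[2,4::nat]]) = 5" "distinct rows5" "\<And>r. r \<in> set rows5 \<Longrightarrow> length r = 5"
  "distinct (map fst cols5)" "\<And>c a. (c, a) \<in> set cols5 \<Longrightarrow> length c = 5 \<and> sign (one_line c) = a"
proof -
  show "length c = 5 \<and> sign (one_line c) = a" if "(c, a) \<in> set cols5" for c a
    using that by (auto simp: cols5_def one_line_transpositions_5 sign_transpose sign_transpose2)
qed (auto simp: rows5_def cols5_def)

definition totals_w :: "int \<Rightarrow> (int \<times> int) list" where
  "totals_w s = totals (young_data 1 s (young_terms rows4 cols4))"

definition totals_B :: "int \<Rightarrow> int \<Rightarrow> (int \<times> int) list" where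
  "totals_B e s = totals (young_data e s (young_terms rows5 cols5))"

text \<open>One vector v_b for each of the four possible indices of \<open>w\<close>; likewise the
  lists of ten below run over the index pairs of the second factor.\<close>

lemma totals_w:
  "totals_w 1 = [(-1, -2), (1, 2), (-1, 1), (1, -1)]"
  "totals_w (-1) = [(3, 0), (-3, 0), (-3, 3), (3, -3)]"
  by code_simp+

lemma totals_B:
  "totals_B 1 1 = [(-1, -2), (1, 2), (0, 0), (-1, 1), (1, -1), (1, 0), (-1, 0), (-1, 0), (1, 0), (0, 0)]"
  "totals_B (-1) 1 = [(-1, -2), (1, 2), (2, 4), (-1, 1), (1, -1), (-1, -2), (1, 2), (1, 2), (-1, -2), (2, 4)]"
  "totals_B 1 (-1) = [(3, 0), (-3, 0), (0, 0), (-3, 3), (3, -3), (1, -2), (-1, 2), (-1, 2), (1, -2), (0, 0)]"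
  "totals_B (-1) (-1) = [(3, 0), (-3, 0), (-6, 0), (-3, 3), (3, -3), (3, 0), (-3, 0), (-3, 0), (3, 0), (-6, 0)]"
  by code_simp+

definition minimal_count :: "int \<Rightarrow> (int \<times> int) list \<Rightarrow> nat \<Rightarrow> bool" where
  "minimal_count s W m \<longleftrightarrow>
     (\<exists>x\<in>set S3. \<exists>y\<in>set S3. minor s x y \<noteq> 0 \<and> minor_count s W x + minor_count s W y = m) \<and>
     (\<forall>x\<in>set S3. \<forall>y\<in>set S3. minor s x y \<noteq> 0 \<longrightarrow> m \<le> minor_count s W x + minor_count s W y)"

text \<open>For s = 1 the three lines are spanned by (1,0), (0,1), (1,1), with counts 4, 4, 4 for
  \<open>w\<close>, 4, 8, 8 for \<open>S\<close> and 10, 10, 10 for \<open>A\<close>. For s = -1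
  they are spanned by (1,0), (0,1), (1,-1), with counts 2, 4, 2 for \<open>w\<close>, 6, 8, 6 for
  \<open>S\<close> and 2, 10, 8 for \<open>A\<close>. The minimum is the sum of the two smallest
  counts.\<close>

lemma minimal_counts:
  "minimal_count 1 (totals_w 1) 8" "minimal_count (-1) (totals_w (-1)) 4"
  "minimal_count 1 (totals_B 1 1) 12" "minimal_count (-1) (totals_B 1 (-1)) 12"
  "minimal_count 1 (totals_B (-1) 1) 20" "minimal_count (-1) (totals_B (-1) (-1)) 10"
  unfolding totals_w totals_B by code_simp+

lemma length_eqs:
  fixes I :: "((nat \<Rightarrow> nat) \<Rightarrow> 'k::field_char_0) set"
  assumes I: "gr_star ` I = solutions (of_int s)"
  shows "minimal_count s (totals_w s) m \<Longrightarrow> length_w I = m"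
    and "minimal_count s (totals_B 1 s) m \<Longrightarrow> length_S I = m"
    and "minimal_count s (totals_B (-1) s) m \<Longrightarrow> length_A I = m"
proof -
  note c4 = card_weight_minor[OF rows4_cols4(1) row_group_4 rows4_cols4(2,3) column_group_4 rows4_cols4(4,5)]
  note c5 = card_weight_minor[OF rows5_cols5(1) row_group_5 rows5_cols5(2,3) column_group_5 rows5_cols5(4,5)]
  show "length_w I = m" if "minimal_count s (totals_w s) m"
    unfolding length_w_def reduced_w_def y_t_def
    using that c4[of 1] unfolding minimal_count_def totals_w_def
    by (intro Least_expr_length[OF I, where g = "minor_count s (totals_w s)"]) (simp_all add: totals_w_def)
  show "length_S I = m" if "minimal_count s (totals_B 1 s) m"
    unfolding length_S_def reduced_S_def y_t'_def
    using that c5[of 1] unfolding minimal_count_def totals_B_def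
    by (intro Least_expr_length[OF I, where g = "minor_count s (totals_B 1 s)"]) (simp_all add: totals_B_def)
  show "length_A I = m" if "minimal_count s (totals_B (-1) s) m"
    unfolding length_A_def reduced_A_def y_t'_def
    using that c5[of "-1"] unfolding minimal_count_def totals_B_def
    by (intro Least_expr_length[OF I, where g = "minor_count s (totals_B (-1) s)"]) (simp_all add: totals_B_def)
qed

section \<open>Tensors of order three with a symmetry in the first two arguments\<close>

lemma arrange_words:
  "arrange (one_line [1,2,3]) [x, y, z] = [x, y, z]" "arrange (one_line [1,3,2]) [x, y, z] = [x, z, y]"
  "arrange (one_line [2,1,3]) [x, y, z] = [y, x, z]" "arrange (one_line [2,3,1]) [x, y, z] = [y, z, x]"
  "arrange (one_line [3,1,2]) [x, y, z] = [z, x, y]" "arrange (one_line [3,2,1]) [x, y, z] = [z, y, x]"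
  unfolding arrange_3 one_line_3 by simp_all

lemma act_3:
  "act 3 a T [x, y, z] = a (one_line [1,2,3]) * T [x, y, z] + a (one_line [1,3,2]) * T [x, z, y]
    + a (one_line [2,1,3]) * T [y, x, z] + a (one_line [2,3,1]) * T [y, z, x]
    + a (one_line [3,1,2]) * T [z, x, y] + a (one_line [3,2,1]) * T [z, y, x]"
  unfolding act_def sum_perms_3 arrange_words by simp

text \<open>The six terms pair up under the exchange of the first two arguments, which leaves the
  mean over cyclic shifts.\<close>

lemma symmetrize_3:
  assumes "\<And>x y z. T [y, x, z] = T [x, y, z]"
  shows "symmetrize 3 T [x, y, z] = (T [x, y, z] + T [y, z, x] + T [z, x, y]) / 3"
  unfolding symmetrize_def act_3 using assms[of x z y] assms[of y x z] assms[of z y x]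
  by (simp add: fact_numeral field_simps)

text \<open>The sign of an odd permutation cancels the sign of the exchange, so the same cyclic mean
  remains as in the symmetric case. This is what permits a uniform treatment with \<sigma>.\<close>

lemma alternate_3:
  assumes "\<And>x y z. T [y, x, z] = - T [x, y, z]"
  shows "alternate 3 T [x, y, z] = (T [x, y, z] + T [y, z, x] + T [z, x, y]) / 3"
proof -
  have "one_line [1,2,3] = id" by (rule one_line_id)
  then show ?thesis
    unfolding alternate_def act_3 using assms[of z x y] assms[of x y z] assms[of y z x]
    by (simp add: one_line_transpositions_3 sign_transpose sign_transpose2 fact_numeral field_simps)
qed

context
  fixes T U :: "'v list \<Rightarrow> 'k::field_char_0" and \<sigma> :: 'k
  assumes sign: "\<sigma> * \<sigma> = 1"
    and swap: "\<And>x y z. T [y, x, z] = \<sigma> * T [x, y, z]"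
    and U: "\<And>x y z. U [x, y, z] = T [x, y, z] - (T [x, y, z] + T [y, z, x] + T [z, x, y]) / 3"
begin

text \<open>Subtracting the cyclic mean preserves the swap rule and makes the cyclic sums
  vanish.\<close>

lemma coordinates_solutions:
  assumes "length us = 3"
  shows "(\<lambda>q. if q \<in> perms 3 then U (arrange q us) else 0) \<in> solutions \<sigma>"
proof -
  obtain x y z where us: "us = [x, y, z]"
    using assms by (auto simp: numeral_3_eq_3 length_Suc_conv)
  have m: "one_line xs \<in> perms 3" if "xs \<in> set S3" for xs using that perms_3 by blast
  have S: "[1,2,3] \<in> set S3" "[1,3,2] \<in> set S3" "[2,1,3] \<in> set S3"
    "[2,3,1] \<in> set S3" "[3,1,2] \<in> set S3" "[3,2,1] \<in> set S3"
    by (simp_all add: S3_def)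
  have g: "(\<lambda>q. if q \<in> perms 3 then U (arrange q [x, y, z]) else 0) \<in> group_ring 3"
    by (simp add: group_ring_def)
  define t where "t = (1 / 3 :: 'k)"
  have t: "3 * t = 1" by (simp add: t_def)
  have U': "U [x, y, z] = T [x, y, z] - t * (T [x, y, z] + T [y, z, x] + T [z, x, y])" for x y z
    unfolding U t_def by simp
  show ?thesis
    unfolding solutions_def us mem_Collect_eq arrange_words m[OF S(1), THEN if_P] m[OF S(2), THEN if_P]
      m[OF S(3), THEN if_P] m[OF S(4), THEN if_P] m[OF S(5), THEN if_P] m[OF S(6), THEN if_P]
      U' swap[of z x y] swap[of x y z] swap[of y z x]
    using g sign t by (-, intro conjI) (assumption | algebra)+
qed

text \<open>Once the swap rule is applied, the coefficients of \<open>T [x, y, z]\<close>,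
  \<open>T [y, z, x]\<close> and \<open>T [z, x, y]\<close> become 2/3, -1/3 and -1/3, so this
  element of the group ring subtracts the cyclic mean.\<close>

lemma act_xi_eq: "act 3 (xi (1 - \<sigma>)) T [x, y, z] = U [x, y, z]"
proof -
  define t where "t = (1 / 3 :: 'k)"
  have t: "3 * t = 1" by (simp add: t_def)
  have x: "xi (1 - \<sigma>) (one_line [1,2,3]) = t" "xi (1 - \<sigma>) (one_line [1,3,2]) = (1 - \<sigma>) * t"
    "xi (1 - \<sigma>) (one_line [2,1,3]) = \<sigma> * t" "xi (1 - \<sigma>) (one_line [2,3,1]) = - (1 - \<sigma>) * t"
    "xi (1 - \<sigma>) (one_line [3,1,2]) = - \<sigma> * t" "xi (1 - \<sigma>) (one_line [3,2,1]) = - t"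
    by (simp_all add: xi_def gr_single_def one_line_eq_iff t_def)
  have U': "U [x, y, z] = T [x, y, z] - t * (T [x, y, z] + T [y, z, x] + T [z, x, y])"
    unfolding U t_def by simp
  show ?thesis
    unfolding act_3 x U' swap[of z x y] swap[of x y z] swap[of y z x]
    using sign t by algebra
qed

end

lemma xi_mem: "xi \<nu> \<in> right_ideal_gen 3 (xi \<nu>)"
proof -
  have "gr_mult 3 (xi \<nu>) (gr_single id) = xi \<nu>"
  proof
    fix s
    have off: "xi \<nu> s = 0" if "s \<notin> perms 3"
      using that unfolding xi_def gr_single_def perms_3 by (auto simp: S3_def)
    have "(\<Sum>p\<in>perms 3. xi \<nu> p * gr_single id (inv p \<circ> s)) = (\<Sum>p\<in>perms 3. if p = s then xi \<nu> s else 0)"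
    proof (intro sum.cong refl)
      fix p assume p: "p \<in> perms 3"
      have "inv p \<circ> s = id \<longleftrightarrow> p = s"
        using perms_inv_o[OF p] by (metis comp_assoc comp_id id_comp)
      then show "xi \<nu> p * gr_single id (inv p \<circ> s) = (if p = s then xi \<nu> s else 0)"
        by (simp add: gr_single_def)
    qed
    then show "gr_mult 3 (xi \<nu>) (gr_single id) s = xi \<nu> s"
      unfolding gr_mult_eq using off by simp
  qed
  moreover have "gr_single id \<in> group_ring 3"
    using id_perms[of 3] by (auto simp: group_ring_def gr_single_def)
  ultimately show ?thesis unfolding right_ideal_gen_def by force
qed

declare One_nat_def [simp]

section \<open>Iterated differentiability\<close>

text \<open>On an open set, functions that agree have equal derivatives at every point, so equality
  propagates through all orders.\<close>

lemma Ck_on_cong: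
  assumes "open S" "\<And>x. x \<in> S \<Longrightarrow> f x = g x" "Ck_on k S f"
  shows "Ck_on k S g"
  using assms(2,3)
proof (induction k arbitrary: f g)
  case 0
  then show ?case using continuous_on_cong[of S S f g] by simp
next
  case (Suc k)
  have d: "(g has_derivative frechet_derivative f (at x)) (at x)" if "x \<in> S" for x
  proof -
    have "(f has_derivative frechet_derivative f (at x)) (at x)"
      using Suc.prems(2) that by (simp add: frechet_derivative_works)
    then show ?thesis
      using has_derivative_transform_within_open[OF _ \<open>open S\<close> that] Suc.prems(1) by blast
  qed
  then have e: "frechet_derivative f (at x) = frechet_derivative g (at x)" if "x \<in> S" for x
    using frechet_derivative_at that by blast
  have "Ck_on k S (\<lambda>x. frechet_derivative g (at x) v)" for v
    using Suc.IH[of "\<lambda>x. frechet_derivative f (at x) v" "\<lambda>x. frechet_derivative g (at x) v"]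
      e Suc.prems(2) by simp
  then show ?case using d by (auto simp: differentiable_def)
qed

lemma Ck_on_SucD:
  assumes "Ck_on (Suc k) S f" "x \<in> S"
  shows "(f has_derivative frechet_derivative f (at x)) (at x)"
  using assms by (simp add: frechet_derivative_works)

text \<open>Allows the derivative to be given by a formula: by uniqueness it equals
  \<open>frechet_derivative\<close> on \<open>S\<close>, and \<open>Ck_on_cong\<close> transfers the
  regularity.\<close>

lemma Ck_on_SucI:
  assumes "open S" "\<And>x. x \<in> S \<Longrightarrow> (f has_derivative f' x) (at x)"
    "\<And>v. Ck_on k S (\<lambda>x. f' x v)"
  shows "Ck_on (Suc k) S f"
proof -
  have "f' x = frechet_derivative f (at x)" if "x \<in> S" for x
    using assms(2) frechet_derivative_at that by blast
  then have "Ck_on k S (\<lambda>x. frechet_derivative f (at x) v)" for v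
    using Ck_on_cong[OF assms(1), of "\<lambda>x. f' x v" "\<lambda>x. frechet_derivative f (at x) v" k] assms(3)
    by simp
  then show ?thesis using assms(2) by (auto simp: differentiable_def)
qed

lemma Ck_on_Suc_imp: "Ck_on (Suc k) S f \<Longrightarrow> Ck_on k S f"
proof (induction k arbitrary: f)
  case 0
  then have "f differentiable at x" if "x \<in> S" for x using that by simp
  then show ?case
    by (simp add: continuous_at_imp_continuous_on differentiable_imp_continuous_within)
next
  case (Suc k)
  then show ?case by (metis Ck_on.simps(2))
qed

lemma Ck_on_subset: "Ck_on k S f \<Longrightarrow> T \<subseteq> S \<Longrightarrow> Ck_on k T f"
  by (induction k arbitrary: f) (auto intro: continuous_on_subset)

lemma Ck_on_const: "open S \<Longrightarrow> Ck_on k S (\<lambda>x. a)"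
proof (induction k arbitrary: a)
  case (Suc k)
  then show ?case
    by (intro Ck_on_SucI[where f' = "\<lambda>x v. 0"]) auto
qed auto

lemma Ck_on_bounded_linear:
  assumes "bounded_linear L" "open S" "Ck_on k S f"
  shows "Ck_on k S (\<lambda>x. L (f x))"
  using assms(3)
proof (induction k arbitrary: f)
  case 0
  then show ?case
    using bounded_linear.continuous_on[OF assms(1)] by simp
next
  case (Suc k)
  show ?case
  proof (rule Ck_on_SucI[OF \<open>open S\<close>])
    show "((\<lambda>x. L (f x)) has_derivative (\<lambda>v. L (frechet_derivative f (at x) v))) (at x)"
      if "x \<in> S" for x
      using bounded_linear.has_derivative[OF assms(1) Ck_on_SucD[OF Suc.prems that]] .
    show "Ck_on k S (\<lambda>x. L (frechet_derivative f (at x) v))" for v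
      using Suc.IH Suc.prems by simp
  qed
qed

lemma Ck_on_add:
  assumes "open S" "Ck_on k S f" "Ck_on k S g"
  shows "Ck_on k S (\<lambda>x. f x + g x)"
  using assms(2,3)
proof (induction k arbitrary: f g)
  case 0
  then show ?case by (simp add: continuous_on_add)
next
  case (Suc k)
  show ?case
  proof (rule Ck_on_SucI[OF \<open>open S\<close>])
    show "((\<lambda>x. f x + g x) has_derivative
        (\<lambda>v. frechet_derivative f (at x) v + frechet_derivative g (at x) v)) (at x)"
      if "x \<in> S" for x
      using has_derivative_add[OF Ck_on_SucD[OF Suc.prems(1) that] Ck_on_SucD[OF Suc.prems(2) that]] .
    show "Ck_on k S (\<lambda>x. frechet_derivative f (at x) v + frechet_derivative g (at x) v)" for v
      using Suc.IH Suc.prems by simp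
  qed
qed

lemma Ck_on_sum:
  assumes "open S" "\<And>i. i \<in> I \<Longrightarrow> Ck_on k S (f i)"
  shows "Ck_on k S (\<lambda>x. \<Sum>i\<in>I. f i x)"
  using assms(2)
  by (induction I rule: infinite_finite_induct) (auto intro: Ck_on_const Ck_on_add \<open>open S\<close>)

lemma Ck_on_scaleR:
  assumes "open S" "Ck_on k S f" "Ck_on k S g"
  shows "Ck_on k S (\<lambda>x. f x *\<^sub>R g x)"
  using assms(2,3)
proof (induction k arbitrary: f g)
  case 0
  then show ?case by (simp add: continuous_on_scaleR)
next
  case (Suc k)
  show ?case
  proof (rule Ck_on_SucI[OF \<open>open S\<close>])
    show "((\<lambda>x. f x *\<^sub>R g x) has_derivative
        (\<lambda>v. f x *\<^sub>R frechet_derivative g (at x) v + frechet_derivative f (at x) v *\<^sub>R g x)) (at x)"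
      if "x \<in> S" for x
      using has_derivative_scaleR[OF Ck_on_SucD[OF Suc.prems(1) that] Ck_on_SucD[OF Suc.prems(2) that]] .
    show "Ck_on k S (\<lambda>x. f x *\<^sub>R frechet_derivative g (at x) v + frechet_derivative f (at x) v *\<^sub>R g x)" for v
      using Suc.prems by (intro Ck_on_add Suc.IH \<open>open S\<close>) (auto intro: Ck_on_Suc_imp simp del: Ck_on.simps, auto)
  qed
qed

text \<open>In the chain rule the direction fed to the derivative of \<open>f\<close> varies with
  \<open>x\<close>, whereas \<open>Ck_on\<close> speaks of fixed directions. Expanding it in
  \<open>Basis\<close> gives sums of products, to which the induction hypothesis applies with
  \<open>f\<close> replaced by its directional derivatives.\<close>

lemma Ck_on_compose:
  fixes f :: "'e::euclidean_space \<Rightarrow> 'b::real_normed_vector" and \<tau> :: "'d::euclidean_space \<Rightarrow> 'e"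
  assumes "open S" "open T" "Ck_on k T f" "Ck_on k S \<tau>" "\<tau> ` S \<subseteq> T"
  shows "Ck_on k S (\<lambda>x. f (\<tau> x))"
  using assms(3,4)
proof (induction k arbitrary: f)
  case 0
  then show ?case using continuous_on_compose2 assms(5) by (metis Ck_on.simps(1))
next
  case (Suc k)
  let ?f' = "\<lambda>x. frechet_derivative f (at x)" and ?\<tau>' = "\<lambda>x. frechet_derivative \<tau> (at x)"
  have df: "(f has_derivative ?f' (\<tau> x)) (at (\<tau> x))" if "x \<in> S" for x
    using Ck_on_SucD[OF Suc.prems(1)] that assms(5) by blast
  show ?case
  proof (rule Ck_on_SucI[OF \<open>open S\<close>])
    fix x assume "x \<in> S"
    have "((\<lambda>x. f (\<tau> x)) has_derivative (\<lambda>v. ?f' (\<tau> x) (?\<tau>' x v))) (at x)"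
      using diff_chain_at[OF Ck_on_SucD[OF Suc.prems(2) \<open>x \<in> S\<close>] df[OF \<open>x \<in> S\<close>]]
      by (simp add: o_def)
    moreover have "?f' (\<tau> x) (?\<tau>' x v) = (\<Sum>b\<in>Basis. (?\<tau>' x v \<bullet> b) *\<^sub>R ?f' (\<tau> x) b)" for v
    proof -
      have lin: "linear (?f' (\<tau> x))"
        using has_derivative_bounded_linear[OF df[OF \<open>x \<in> S\<close>]] bounded_linear.linear by blast
      have "?f' (\<tau> x) (?\<tau>' x v) = ?f' (\<tau> x) (\<Sum>b\<in>Basis. (?\<tau>' x v \<bullet> b) *\<^sub>R b)"
        by (simp only: euclidean_representation)
      also have "\<dots> = (\<Sum>b\<in>Basis. (?\<tau>' x v \<bullet> b) *\<^sub>R ?f' (\<tau> x) b)"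
        by (simp only: linear_sum[OF lin] linear_scale[OF lin])
      finally show ?thesis .
    qed
    ultimately show "((\<lambda>x. f (\<tau> x)) has_derivative
        (\<lambda>v. \<Sum>b\<in>Basis. (?\<tau>' x v \<bullet> b) *\<^sub>R ?f' (\<tau> x) b)) (at x)"
      by (simp only: fun_eq_iff)
  next
    fix v
    have "Ck_on k S (\<lambda>x. ?\<tau>' x v)"
      using Suc.prems(2) by simp
    then have "Ck_on k S (\<lambda>x. ?\<tau>' x v \<bullet> b)" for b
      by (rule Ck_on_bounded_linear[OF bounded_linear_inner_left \<open>open S\<close>])
    moreover have "Ck_on k S (\<lambda>x. ?f' (\<tau> x) b)" for b
      using Suc.prems(1) Ck_on_Suc_imp[OF Suc.prems(2)] by (intro Suc.IH) auto
    ultimately show "Ck_on k S (\<lambda>x. \<Sum>b\<in>Basis. (?\<tau>' x v \<bullet> b) *\<^sub>R ?f' (\<tau> x) b)"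
      by (intro Ck_on_sum Ck_on_scaleR \<open>open S\<close>)
  qed
qed

section \<open>Charts and vector fields\<close>

text \<open>Charts are pairs, and quantifiers over charts should not be split.\<close>

declare split_paired_All [simp del] split_paired_Ex [simp del]

lemma tangent_space_lincomb:
  assumes "u \<in> tangent_space \<A> q" "v \<in> tangent_space \<A> q"
    and "\<And>c c'. c \<in> charts_at \<A> q \<Longrightarrow> c' \<in> charts_at \<A> q \<Longrightarrow>
      linear (frechet_derivative (snd c' \<circ> chart_inv c) (at (snd c q)))"
  shows "(\<lambda>c. a *\<^sub>R u c + b *\<^sub>R v c) \<in> tangent_space \<A> q"
proof -
  have "a *\<^sub>R u c' + b *\<^sub>R v c'
      = frechet_derivative (snd c' \<circ> chart_inv c) (at (snd c q)) (a *\<^sub>R u c + b *\<^sub>R v c)"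
    if c: "c \<in> charts_at \<A> q" "c' \<in> charts_at \<A> q" for c c'
  proof -
    have "u c' = frechet_derivative (snd c' \<circ> chart_inv c) (at (snd c q)) (u c)"
      "v c' = frechet_derivative (snd c' \<circ> chart_inv c) (at (snd c q)) (v c)"
      using assms(1,2) c unfolding tangent_space_def by blast+
    then show ?thesis
      by (simp only: linear_add[OF assms(3)[OF c]] linear_scale[OF assms(3)[OF c]])
  qed
  moreover have "a *\<^sub>R u c + b *\<^sub>R v c = 0" if "c \<notin> charts_at \<A> q" for c
    using assms(1,2) that unfolding tangent_space_def by simp
  ultimately show ?thesis unfolding tangent_space_def by blast
qed

locale smooth_manifold =
  fixes \<A> :: "('m::{t2_space, second_countable_topology}, 'e::euclidean_space) chart set"
  assumes atlas: "smooth_atlas \<A>"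
begin

lemma charts_at_iff: "c \<in> charts_at \<A> q \<longleftrightarrow> c \<in> \<A> \<and> q \<in> fst c"
  by (simp add: charts_at_def)

lemma chart_homeomorphism: "c \<in> \<A> \<Longrightarrow> homeomorphism (fst c) (snd c ` fst c) (snd c) (chart_inv c)"
  using atlas unfolding smooth_atlas_def by blast

lemma chart_inv_left: "c \<in> charts_at \<A> q \<Longrightarrow> chart_inv c (snd c q) = q"
  using homeomorphism_apply1[OF chart_homeomorphism] unfolding charts_at_iff by blast

lemma chart_inv_apply: "c \<in> \<A> \<Longrightarrow> q \<in> fst c \<Longrightarrow> chart_inv c (snd c q) = q"
  using homeomorphism_apply1[OF chart_homeomorphism] .

lemma open_chart_domain: "c \<in> \<A> \<Longrightarrow> open (fst c)"
  using atlas unfolding smooth_atlas_def by blast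

lemma open_chart_image:
  assumes "c \<in> \<A>" "open N" "N \<subseteq> fst c"
  shows "open (snd c ` N)"
proof -
  have "openin (top_of_set (fst c)) N"
    using assms by (simp add: open_subset)
  then have "openin (top_of_set (snd c ` fst c)) (snd c ` N)"
    using homeomorphism_imp_open_map[OF chart_homeomorphism[OF assms(1)]] by blast
  moreover have "open (snd c ` fst c)"
    using atlas assms(1) unfolding smooth_atlas_def by blast
  ultimately show ?thesis using openin_open_trans by blast
qed

lemma charts_at_nonempty: "\<exists>c. c \<in> charts_at \<A> q"
proof -
  have "q \<in> \<Union> (fst ` \<A>)" using atlas unfolding smooth_atlas_def by blast
  then show ?thesis unfolding charts_at_iff by blast
qed

section \<open>Jacobians of chart changes and coordinate fields\<close>

definition jac :: "('m, 'e) chart \<Rightarrow> ('m, 'e) chart \<Rightarrow> 'm \<Rightarrow> 'e \<Rightarrow> 'e" where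
  "jac c c' q = frechet_derivative (snd c' \<circ> chart_inv c) (at (snd c q))"

lemma smooth_transition:
  assumes "c \<in> \<A>" "c' \<in> \<A>"
  shows "smooth_on (snd c ` (fst c \<inter> fst c')) (snd c' \<circ> chart_inv c)"
  using atlas assms unfolding smooth_atlas_def by blast

lemma transition_has_derivative:
  assumes "c \<in> charts_at \<A> q" "c' \<in> charts_at \<A> q"
  shows "((snd c' \<circ> chart_inv c) has_derivative jac c c' q) (at (snd c q))"
proof -
  have "Ck_on (Suc 0) (snd c ` (fst c \<inter> fst c')) (snd c' \<circ> chart_inv c)"
    using smooth_transition[of c c'] assms unfolding charts_at_iff smooth_on_def by blast
  moreover have "snd c q \<in> snd c ` (fst c \<inter> fst c')"
    using assms unfolding charts_at_iff by blast
  ultimately show ?thesis unfolding jac_def by (rule Ck_on_SucD)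
qed

lemma jac_linear:
  assumes "c \<in> charts_at \<A> q" "c' \<in> charts_at \<A> q"
  shows "linear (jac c c' q)"
  using has_derivative_bounded_linear[OF transition_has_derivative[OF assms]] bounded_linear.linear
  by blast

lemma chart_change_has_derivative:
  assumes c: "c \<in> charts_at \<A> q" "c' \<in> charts_at \<A> q"
    and f: "((f \<circ> chart_inv c') has_derivative F) (at (snd c' q))"
  shows "((f \<circ> chart_inv c) has_derivative (\<lambda>v. F (jac c c' q v))) (at (snd c q))"
proof -
  have cA: "c \<in> \<A>" "c' \<in> \<A>" "q \<in> fst c" "q \<in> fst c'"
    using c unfolding charts_at_iff by auto
  let ?S = "snd c ` (fst c \<inter> fst c')"
  have "((f \<circ> chart_inv c') has_derivative F) (at ((snd c' \<circ> chart_inv c) (snd c q)))"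
    using f chart_inv_left[OF c(1)] by simp
  then have d: "((f \<circ> chart_inv c' \<circ> (snd c' \<circ> chart_inv c)) has_derivative (F \<circ> jac c c' q)) (at (snd c q))"
    using diff_chain_at[OF transition_has_derivative[OF c]] by blast
  have o: "open ?S"
    using cA by (intro open_chart_image open_Int open_chart_domain) auto
  have i: "snd c q \<in> ?S" using cA by blast
  have e: "(f \<circ> chart_inv c' \<circ> (snd c' \<circ> chart_inv c)) x = (f \<circ> chart_inv c) x" if x: "x \<in> ?S" for x
  proof -
    obtain r where r: "x = snd c r" "r \<in> fst c" "r \<in> fst c'" using x by blast
    then have "chart_inv c x = r" "chart_inv c' (snd c' r) = r"
      using chart_inv_left cA charts_at_iff by auto
    then show ?thesis by simp
  qed
  have "((f \<circ> chart_inv c) has_derivative (F \<circ> jac c c' q)) (at (snd c q))"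
    by (rule has_derivative_transform_within_open[OF d o i e])
  then show ?thesis by (simp add: o_def)
qed

text \<open>The cocycle rule: the chain rule for the coordinate map of \<open>c''\<close>, combined
  with uniqueness of derivatives.\<close>

lemma jac_comp:
  assumes "c \<in> charts_at \<A> q" "c' \<in> charts_at \<A> q" "c'' \<in> charts_at \<A> q"
  shows "jac c' c'' q (jac c c' q v) = jac c c'' q v"
  using frechet_derivative_at[OF chart_change_has_derivative[OF assms(1,2)
        transition_has_derivative[OF assms(2,3)]]]
  by (metis jac_def)

lemma jac_self:
  assumes "c \<in> charts_at \<A> q"
  shows "jac c c q v = v"
proof -
  have cA: "c \<in> \<A>" "q \<in> fst c" using assms unfolding charts_at_iff by auto
  have "((snd c \<circ> chart_inv c) has_derivative (\<lambda>v. v)) (at (snd c q))"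
  proof (rule has_derivative_transform_within_open[OF has_derivative_ident])
    show "open (snd c ` fst c)" using open_chart_image cA open_chart_domain by blast
    show "snd c q \<in> snd c ` fst c" using cA by blast
    show "x = (snd c \<circ> chart_inv c) x" if "x \<in> snd c ` fst c" for x
      using that chart_inv_apply[OF cA(1)] by (metis comp_apply imageE)
  qed
  then show ?thesis unfolding jac_def using frechet_derivative_at by metis
qed

lemma tangent_iff: "v \<in> tangent_space \<A> q \<longleftrightarrow> (\<forall>c. c \<notin> charts_at \<A> q \<longrightarrow> v c = 0) \<and>
     (\<forall>c\<in>charts_at \<A> q. \<forall>c'\<in>charts_at \<A> q. v c' = jac c c' q (v c))"
  unfolding tangent_space_def jac_def mem_Collect_eq by (rule refl)

lemma tangent_lincomb:
  assumes "u \<in> tangent_space \<A> q" "v \<in> tangent_space \<A> q"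
  shows "(\<lambda>c. a *\<^sub>R u c + b *\<^sub>R v c) \<in> tangent_space \<A> q"
  by (rule tangent_space_lincomb[OF assms jac_linear[unfolded jac_def]])

text \<open>The field with constant components \<open>v\<close> in the chart \<open>c\<close>, set
  to zero outside its domain. Basis vectors \<open>v\<close> give the coordinate frame.\<close>

definition coord_field :: "('m, 'e) chart \<Rightarrow> 'e \<Rightarrow> 'm \<Rightarrow> ('m, 'e) tvec" where
  "coord_field c v q = (\<lambda>c'. if c \<in> charts_at \<A> q \<and> c' \<in> charts_at \<A> q then jac c c' q v else 0)"

lemma coord_field_mem: "c \<in> charts_at \<A> q \<Longrightarrow> coord_field c v q \<in> tangent_space \<A> q"
  unfolding tangent_iff by (auto simp: coord_field_def jac_comp)

lemma coord_field_apply: "c \<in> charts_at \<A> q \<Longrightarrow> coord_field c v q c = v"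
  by (simp add: coord_field_def jac_self)

lemma tangent_eq_coord_field:
  assumes "u \<in> tangent_space \<A> q" "c \<in> charts_at \<A> q"
  shows "coord_field c (u c) q = u"
proof
  fix c'
  show "coord_field c (u c) q c' = u c'"
  proof (cases "c' \<in> charts_at \<A> q")
    case True
    then have "u c' = jac c c' q (u c)"
      using assms unfolding tangent_iff by blast
    then show ?thesis
      using True assms(2) unfolding coord_field_def by presburger
  next
    case False
    then show ?thesis using assms(1) unfolding tangent_iff coord_field_def by simp
  qed
qed

lemma coord_field_lincomb:
  "coord_field c (a *\<^sub>R u + b *\<^sub>R v) q = (\<lambda>c'. a *\<^sub>R coord_field c u q c' + b *\<^sub>R coord_field c v q c')"
  by (auto simp: coord_field_def linear_add[OF jac_linear] linear_scale[OF jac_linear])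

lemma vector_field_nearI:
  assumes "c \<in> \<A>" "open N" "p \<in> N" "N \<subseteq> fst c" "\<And>q. q \<in> N \<Longrightarrow> X q \<in> tangent_space \<A> q"
    and "smooth_on (snd c ` N) (\<lambda>x. X (chart_inv c x) c)"
  shows "vector_field_near \<A> p X"
  unfolding vector_field_near_def vector_field_on_def
proof (intro exI[of _ N] conjI ballI bexI[of _ c])
  show "c \<in> charts_at \<A> q" if "q \<in> N" for q
    using that assms(1,4) unfolding charts_at_iff by blast
qed (simp_all add: assms)

lemma smooth_fun_nearI:
  assumes "c \<in> \<A>" "open N" "p \<in> N" "N \<subseteq> fst c" "smooth_on (snd c ` N) (f \<circ> chart_inv c)"
  shows "smooth_fun_near \<A> p f"
  unfolding smooth_fun_near_def smooth_fun_on_def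
proof (intro exI[of _ N] conjI ballI bexI[of _ c])
  show "c \<in> charts_at \<A> q" if "q \<in> N" for q
    using that assms(1,4) unfolding charts_at_iff by blast
qed (simp_all add: assms)

lemma chart_inv_image: "c \<in> \<A> \<Longrightarrow> N \<subseteq> fst c \<Longrightarrow> x \<in> snd c ` N \<Longrightarrow> chart_inv c x \<in> N"
  by (auto simp: chart_inv_apply subset_iff)

text \<open>The definition grants smoothness in some chart only. In a prescribed chart the
  components arise by applying the Jacobian, which varies with the point and is therefore expanded
  in \<open>Basis\<close>.\<close>

lemma vector_field_near_chart:
  assumes X: "vector_field_near \<A> p X" and c: "c \<in> charts_at \<A> p"
  obtains N where "open N" "p \<in> N" "N \<subseteq> fst c" "\<And>q. q \<in> N \<Longrightarrow> X q \<in> tangent_space \<A> q"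
    "smooth_on (snd c ` N) (\<lambda>x. X (chart_inv c x) c)"
proof -
  obtain W where W: "p \<in> W" "open W" "\<And>q. q \<in> W \<Longrightarrow> X q \<in> tangent_space \<A> q"
    "\<exists>c\<in>charts_at \<A> p. \<exists>N. open N \<and> p \<in> N \<and> N \<subseteq> W \<inter> fst c \<and> smooth_on (snd c ` N) (\<lambda>x. X (chart_inv c x) c)"
    using X unfolding vector_field_near_def vector_field_on_def by blast
  then obtain c' N' where c': "c' \<in> charts_at \<A> p"
    and N': "open N'" "p \<in> N'" "N' \<subseteq> W \<inter> fst c'"
      "smooth_on (snd c' ` N') (\<lambda>x. X (chart_inv c' x) c')"
    by blast
  have cA: "c \<in> \<A>" "c' \<in> \<A>" "p \<in> fst c" "p \<in> fst c'" using c c' unfolding charts_at_iff by auto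
  define N where "N = N' \<inter> fst c"
  let ?\<tau> = "snd c' \<circ> chart_inv c" and ?S = "snd c ` N" and ?T = "snd c' ` N"
  have N: "open N" "p \<in> N" "N \<subseteq> fst c" "N \<subseteq> fst c'" "N \<subseteq> N'" "N \<subseteq> W"
    using N' cA open_chart_domain[OF cA(1)] unfolding N_def by auto
  have oS: "open ?S" and oT: "open ?T" using open_chart_image cA N by auto
  have inv: "chart_inv c (snd c q) = q" "chart_inv c' (snd c' q) = q" if "q \<in> N" for q
    using that N(3,4) cA(1,2) chart_inv_apply by blast+
  have "Ck_on k ?S (\<lambda>x. X (chart_inv c x) c)" for k
  proof -
    have tau: "Ck_on k ?S ?\<tau>"
      using smooth_transition[OF cA(1,2)] Ck_on_subset N unfolding smooth_on_def by blast
    \<comment> \<open>One more order is taken from the transition map because its derivative enters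
      the components.\<close>
    have "Ck_on (Suc k) (snd c' ` (fst c' \<inter> fst c)) (snd c \<circ> chart_inv c')"
      using smooth_transition[OF cA(2,1)] unfolding smooth_on_def by blast
    then have "Ck_on (Suc k) ?T (snd c \<circ> chart_inv c')"
      using N by (elim Ck_on_subset) blast
    then have "Ck_on k ?T (\<lambda>x. frechet_derivative (snd c \<circ> chart_inv c') (at x) b)" for b
      by simp
    moreover have "?\<tau> ` ?S \<subseteq> ?T" using inv by auto
    ultimately have 1: "Ck_on k ?S (\<lambda>x. frechet_derivative (snd c \<circ> chart_inv c') (at (?\<tau> x)) b)" for b
      using Ck_on_compose[OF oS oT _ tau] by blast
    have "Ck_on k ?T (\<lambda>x. X (chart_inv c' x) c')"
      using N'(4) Ck_on_subset[OF _ image_mono[OF N(5)]] unfolding smooth_on_def by blast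
    then have "Ck_on k ?S (\<lambda>x. X (chart_inv c' (?\<tau> x)) c')"
      using Ck_on_compose[OF oS oT _ tau] \<open>?\<tau> ` ?S \<subseteq> ?T\<close> by blast
    then have 2: "Ck_on k ?S (\<lambda>x. X (chart_inv c' (?\<tau> x)) c' \<bullet> b)" for b
      by (rule Ck_on_bounded_linear[OF bounded_linear_inner_left oS])
    have 3: "Ck_on k ?S (\<lambda>x. \<Sum>b\<in>Basis. (X (chart_inv c' (?\<tau> x)) c' \<bullet> b) *\<^sub>R
        frechet_derivative (snd c \<circ> chart_inv c') (at (?\<tau> x)) b)"
      by (intro Ck_on_sum Ck_on_scaleR oS 1 2)
    have 4: "(\<Sum>b\<in>Basis. (X (chart_inv c' (?\<tau> x)) c' \<bullet> b) *\<^sub>R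
        frechet_derivative (snd c \<circ> chart_inv c') (at (?\<tau> x)) b) = X (chart_inv c x) c"
      if x: "x \<in> ?S" for x
    proof -
      obtain q where q: "x = snd c q" "q \<in> N" using x by blast
      have cq: "c \<in> charts_at \<A> q" "c' \<in> charts_at \<A> q" using q N cA charts_at_iff by auto
      have "X q c = jac c' c q (X q c')"
        using W(3)[of q] q N(6) cq unfolding tangent_iff by blast
      also have "\<dots> = jac c' c q (\<Sum>b\<in>Basis. (X q c' \<bullet> b) *\<^sub>R b)"
        by (simp only: euclidean_representation)
      also have "\<dots> = (\<Sum>b\<in>Basis. (X q c' \<bullet> b) *\<^sub>R jac c' c q b)"
        by (simp only: linear_sum[OF jac_linear[OF cq(2,1)]] linear_scale[OF jac_linear[OF cq(2,1)]])
      finally show ?thesis using q inv by (simp add: jac_def)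
    qed
    show ?thesis by (rule Ck_on_cong[OF oS 4 3])
  qed
  then have "smooth_on ?S (\<lambda>x. X (chart_inv c x) c)"
    using oS unfolding smooth_on_def by blast
  moreover have "X q \<in> tangent_space \<A> q" if "q \<in> N" for q using that W(3) N(6) by blast
  ultimately show ?thesis using that N by blast
qed

end

section \<open>Derivatives along tangent vectors and local extensions\<close>

lemma smooth_on_cong:
  assumes "\<And>x. x \<in> S \<Longrightarrow> f x = g x" "smooth_on S f"
  shows "smooth_on S g"
  unfolding smooth_on_def
proof (intro conjI allI)
  show "open S" using assms(2) by (simp add: smooth_on_def)
  then show "Ck_on k S g" for k
    by (rule Ck_on_cong[OF _ assms(1)]) (use assms(2) in \<open>simp_all add: smooth_on_def\<close>)
qed

lemma smooth_on_const: "open S \<Longrightarrow> smooth_on S (\<lambda>x. a)"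
  by (simp add: smooth_on_def Ck_on_const)

lemma smooth_on_bounded_linear:
  "bounded_linear L \<Longrightarrow> smooth_on S f \<Longrightarrow> smooth_on S (\<lambda>x. L (f x))"
  by (simp add: smooth_on_def Ck_on_bounded_linear)

lemma tensors2_left:
  assumes "T \<in> tensors 2 V" "u \<in> V" "v \<in> V" "y \<in> V"
  shows "T [\<lambda>c. a *\<^sub>R u c + b *\<^sub>R v c, y] = a *\<^sub>R T [u, y] + b *\<^sub>R T [v, y]"
proof -
  have "\<forall>vs i u v a b. length vs = 2 \<and> set vs \<subseteq> V \<and> i < 2 \<and> u \<in> V \<and> v \<in> V \<longrightarrow>
        T (vs[i := (\<lambda>c. a *\<^sub>R u c + b *\<^sub>R v c)]) = a *\<^sub>R T (vs[i := u]) + b *\<^sub>R T (vs[i := v])"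
    using assms(1) unfolding tensors_def by blast
  from this[rule_format, of "[u, y]" 0 u v a b] show ?thesis using assms by simp
qed

context smooth_manifold begin

lemma charts_atI: "c \<in> \<A> \<Longrightarrow> q \<in> fst c \<Longrightarrow> c \<in> charts_at \<A> q"
  by (simp add: charts_at_iff)

lemma diff_at_chart:
  assumes "c \<in> charts_at \<A> p" "diff_at \<A> p f"
  obtains F where "((f \<circ> chart_inv c) has_derivative F) (at (snd c p))"
proof -
  obtain c' where c': "c' \<in> charts_at \<A> p" "(f \<circ> chart_inv c') differentiable (at (snd c' p))"
    using assms(2) unfolding diff_at_def by blast
  then obtain F' where "((f \<circ> chart_inv c') has_derivative F') (at (snd c' p))"
    unfolding differentiable_def by blast
  from chart_change_has_derivative[OF assms(1) c'(1) this] show ?thesis by (rule that)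
qed

text \<open>Frees \<open>dir_deriv\<close> from the chart chosen by \<open>SOME\<close>: the
  Jacobian relating the components of \<open>v\<close> is the one produced by the chain
  rule.\<close>

lemma dir_deriv_eq:
  assumes c: "c \<in> charts_at \<A> p" and v: "v \<in> tangent_space \<A> p"
    and f: "((f \<circ> chart_inv c) has_derivative F) (at (snd c p))"
  shows "dir_deriv \<A> p v f = F (v c)"
proof -
  define c0 where "c0 = (SOME c. c \<in> charts_at \<A> p)"
  have c0: "c0 \<in> charts_at \<A> p"
    unfolding c0_def using charts_at_nonempty by (rule someI_ex)
  have "v c = jac c0 c p (v c0)"
    using v c c0 unfolding tangent_iff by blast
  moreover have "frechet_derivative (f \<circ> chart_inv c0) (at (snd c0 p)) = (\<lambda>v. F (jac c0 c p v))"
    using frechet_derivative_at[OF chart_change_has_derivative[OF c0 c f]] by simp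
  ultimately show ?thesis
    unfolding dir_deriv_def Let_def c0_def[symmetric] by metis
qed

lemma has_derivative_chart_cong:
  assumes c: "c \<in> charts_at \<A> p" and N: "open N" "p \<in> N" "\<And>q. q \<in> N \<Longrightarrow> f q = g q"
    and f: "((f \<circ> chart_inv c) has_derivative F) (at (snd c p))"
  shows "((g \<circ> chart_inv c) has_derivative F) (at (snd c p))"
proof -
  have cA: "c \<in> \<A>" "p \<in> fst c" using c unfolding charts_at_iff by auto
  show ?thesis
  proof (rule has_derivative_transform_within_open[OF f])
    show "open (snd c ` (N \<inter> fst c))"
      using cA N by (intro open_chart_image open_Int open_chart_domain) auto
    show "snd c p \<in> snd c ` (N \<inter> fst c)" using cA N by blast
    show "(f \<circ> chart_inv c) x = (g \<circ> chart_inv c) x" if x: "x \<in> snd c ` (N \<inter> fst c)" for x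
      using chart_inv_image[OF cA(1) _ x] N(3) by simp
  qed
qed

lemma vector_field_nearD:
  assumes "vector_field_near \<A> p X"
  obtains N where "open N" "p \<in> N" "\<And>q. q \<in> N \<Longrightarrow> X q \<in> tangent_space \<A> q"
  using assms unfolding vector_field_near_def vector_field_on_def by blast

lemma vector_field_near_mem: "vector_field_near \<A> p X \<Longrightarrow> X p \<in> tangent_space \<A> p"
  unfolding vector_field_near_def vector_field_on_def by blast

lemma smooth_fun_near_diff:
  assumes "smooth_fun_near \<A> p f" "c \<in> charts_at \<A> p"
  obtains F where "((f \<circ> chart_inv c) has_derivative F) (at (snd c p))"
proof -
  obtain c' N where c': "c' \<in> charts_at \<A> p" and N: "p \<in> N"
    and s: "smooth_on (snd c' ` N) (f \<circ> chart_inv c')"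
    using assms(1) unfolding smooth_fun_near_def smooth_fun_on_def by blast
  have "Ck_on (Suc 0) (snd c' ` N) (f \<circ> chart_inv c')" using s unfolding smooth_on_def by blast
  moreover have "snd c' p \<in> snd c' ` N" using N by blast
  ultimately have "(f \<circ> chart_inv c') differentiable (at (snd c' p))"
    using Ck_on_SucD differentiable_def by blast
  then have "diff_at \<A> p f" using c' unfolding diff_at_def by blast
  from diff_at_chart[OF assms(2) this] show ?thesis using that .
qed

lemma coord_field_near:
  assumes "c \<in> charts_at \<A> p"
  shows "vector_field_near \<A> p (coord_field c v)"
proof -
  have cA: "c \<in> \<A>" "p \<in> fst c" using assms unfolding charts_at_iff by auto
  have o: "open (snd c ` fst c)" using cA open_chart_image open_chart_domain by blast
  show ?thesis
  proof (rule vector_field_nearI[of c "fst c"])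
    show "coord_field c v q \<in> tangent_space \<A> q" if "q \<in> fst c" for q
      by (rule coord_field_mem[OF charts_atI[OF cA(1) that]])
    show "smooth_on (snd c ` fst c) (\<lambda>x. coord_field c v (chart_inv c x) c)"
    proof (rule smooth_on_cong[OF _ smooth_on_const[OF o]])
      show "v = coord_field c v (chart_inv c x) c" if x: "x \<in> snd c ` fst c" for x
        using coord_field_apply[OF charts_atI[OF cA(1) chart_inv_image[OF cA(1) subset_refl x]]] by simp
    qed
    show "open (fst c)" by (rule open_chart_domain[OF cA(1)])
  qed (use cA in simp_all)
qed

text \<open>A coordinate field with the components of \<open>u\<close> is an extension, so the
  \<open>SOME\<close> in the definition picks a genuine one.\<close>

lemma extend_vector:
  assumes "u \<in> tangent_space \<A> p"
  shows "vector_field_near \<A> p (extend_vector \<A> p u)" "extend_vector \<A> p u p = u"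
proof -
  obtain c where "c \<in> charts_at \<A> p" using charts_at_nonempty by blast
  then have "\<exists>X. vector_field_near \<A> p X \<and> X p = u"
    using coord_field_near tangent_eq_coord_field[OF assms] by blast
  then have "vector_field_near \<A> p (extend_vector \<A> p u) \<and> extend_vector \<A> p u p = u"
    unfolding extend_vector_def by (rule someI_ex)
  then show "vector_field_near \<A> p (extend_vector \<A> p u)" "extend_vector \<A> p u p = u" by auto
qed

end

section \<open>The covariant derivative of a tensor field\<close>

locale manifold_connection = smooth_manifold \<A>
  for \<A> :: "('m::{t2_space, second_countable_topology}, 'e::euclidean_space) chart set" +
  fixes D :: "('m, 'e) connection"
  assumes covariant: "covariant_derivative \<A> D"
begin

lemma D_mem: "u \<in> tangent_space \<A> p \<Longrightarrow> vector_field_near \<A> p Y \<Longrightarrow> D p u Y \<in> tangent_space \<A> p"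
  using covariant unfolding covariant_derivative_def by blast

lemma D_direction:
  "u \<in> tangent_space \<A> p \<Longrightarrow> v \<in> tangent_space \<A> p \<Longrightarrow> vector_field_near \<A> p Y \<Longrightarrow>
    D p (\<lambda>c. a *\<^sub>R u c + b *\<^sub>R v c) Y = (\<lambda>c. a *\<^sub>R D p u Y c + b *\<^sub>R D p v Y c)"
  using covariant unfolding covariant_derivative_def by blast

lemma D_add:
  "u \<in> tangent_space \<A> p \<Longrightarrow> vector_field_near \<A> p Y \<Longrightarrow> vector_field_near \<A> p Z \<Longrightarrow>
    D p u (\<lambda>q c. Y q c + Z q c) = (\<lambda>c. D p u Y c + D p u Z c)"
  using covariant unfolding covariant_derivative_def by blast

lemma D_scale:
  "u \<in> tangent_space \<A> p \<Longrightarrow> smooth_fun_near \<A> p f \<Longrightarrow> vector_field_near \<A> p Y \<Longrightarrow>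
    D p u (\<lambda>q c. f q *\<^sub>R Y q c) = (\<lambda>c. dir_deriv \<A> p u f *\<^sub>R Y p c + f p *\<^sub>R D p u Y c)"
  using covariant unfolding covariant_derivative_def by blast

text \<open>The product rule for the indicator function of a neighbourhood.\<close>

lemma D_local:
  assumes u: "u \<in> tangent_space \<A> p" and X: "vector_field_near \<A> p X" "vector_field_near \<A> p X'"
    and N: "open N" "p \<in> N" "\<And>q. q \<in> N \<Longrightarrow> X q = X' q"
  shows "D p u X = D p u X'"
proof -
  obtain c where c: "c \<in> charts_at \<A> p" using charts_at_nonempty by blast
  then have cA: "c \<in> \<A>" "p \<in> fst c" unfolding charts_at_iff by auto
  \<comment> \<open>In general \<open>f\<close> is discontinuous on the manifold, but
    \<open>smooth_fun_near\<close> only asks for smoothness on some neighbourhood of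
    \<open>p\<close>, and on \<open>N\<close> it is constant.\<close>
  define f :: "'m \<Rightarrow> real" where "f = (\<lambda>q. if q \<in> N then 1 else 0)"
  have N': "open (N \<inter> fst c)" "p \<in> N \<inter> fst c" "N \<inter> fst c \<subseteq> fst c"
    using N cA open_chart_domain[OF cA(1)] by auto
  have "smooth_on (snd c ` (N \<inter> fst c)) (f \<circ> chart_inv c)"
  proof (rule smooth_on_cong[OF _ smooth_on_const])
    show "open (snd c ` (N \<inter> fst c))" by (rule open_chart_image[OF cA(1) N'(1,3)])
    show "1 = (f \<circ> chart_inv c) x" if x: "x \<in> snd c ` (N \<inter> fst c)" for x
      using chart_inv_image[OF cA(1) _ x] by (simp add: f_def)
  qed
  then have f: "smooth_fun_near \<A> p f"
    using smooth_fun_nearI[OF cA(1) N'] by blast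
  have "((\<lambda>q. 1) \<circ> chart_inv c has_derivative (\<lambda>v. 0)) (at (snd c p))" for c :: "('m, 'e) chart"
    by (simp add: o_def)
  then have "((f \<circ> chart_inv c) has_derivative (\<lambda>v. 0)) (at (snd c p))"
    by (rule has_derivative_chart_cong[OF c N(1,2), rotated]) (simp add: f_def)
  then have df: "dir_deriv \<A> p u f = 0" using dir_deriv_eq[OF c u] by blast
  have fp: "f p = 1" using N by (simp add: f_def)
  have "D p u X = D p u (\<lambda>q c. f q *\<^sub>R X q c)"
    using D_scale[OF u f X(1)] df fp by simp
  \<comment> \<open>Off \<open>N\<close> both products are zero, so they agree as total functions
    even where \<open>X\<close> and \<open>X'\<close> differ.\<close>
  also have "(\<lambda>q c. f q *\<^sub>R X q c) = (\<lambda>q c. f q *\<^sub>R X' q c)"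
    using N(3) by (auto simp: f_def fun_eq_iff)
  also have "D p u \<dots> = D p u X'"
    using D_scale[OF u f X(2)] df fp by simp
  finally show ?thesis .
qed

text \<open>The formula of \<open>nabla_tensor2\<close> with arbitrary fields in place of the chosen
  extensions, so that the extensions can be varied.\<close>

definition nabla_fields ::
  "('m \<Rightarrow> ('m, 'e) tvec list \<Rightarrow> 'k::real_normed_field) \<Rightarrow> 'm \<Rightarrow> ('m, 'e) tvec \<Rightarrow>
    ('m \<Rightarrow> ('m, 'e) tvec) \<Rightarrow> ('m \<Rightarrow> ('m, 'e) tvec) \<Rightarrow> 'k" where
  "nabla_fields \<psi> p w X Y =
    dir_deriv \<A> p w (\<lambda>q. \<psi> q [X q, Y q]) - \<psi> p [D p w X, Y p] - \<psi> p [X p, D p w Y]"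

end

text \<open>Covers symmetric and skew-symmetric fields at once. The swap rule is asked for arbitrary
  arguments, which is available since members of \<open>tensors\<close> vanish off the tangent
  space.\<close>

locale signed_form_field = manifold_connection \<A> D
  for \<A> :: "('m::{t2_space, second_countable_topology}, 'e::euclidean_space) chart set" and D +
  fixes \<psi> :: "'m \<Rightarrow> ('m, 'e) tvec list \<Rightarrow> 'k::real_normed_field" and \<sigma> :: 'k
  assumes diff: "diff_tensor_field2 \<A> \<psi>"
    and swap: "\<psi> q [v, u] = \<sigma> * \<psi> q [u, v]"
    and sign: "\<sigma> * \<sigma> = 1"
begin

lemma mem_tensors: "\<psi> q \<in> tensors 2 (tangent_space \<A> q)"
  using diff unfolding diff_tensor_field2_def by blast

lemma diff_at_fields:
  "vector_field_near \<A> p X \<Longrightarrow> vector_field_near \<A> p Y \<Longrightarrow> diff_at \<A> p (\<lambda>q. \<psi> q [X q, Y q])"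
  using diff unfolding diff_tensor_field2_def by blast

text \<open>Transfers statements about the first field to the second.\<close>

lemma nabla_fields_swap:
  assumes w: "w \<in> tangent_space \<A> p"
    and X: "vector_field_near \<A> p X" and Y: "vector_field_near \<A> p Y"
  shows "nabla_fields \<psi> p w Y X = \<sigma> * nabla_fields \<psi> p w X Y"
proof -
  obtain c where c: "c \<in> charts_at \<A> p" using charts_at_nonempty by blast
  obtain F where F: "(((\<lambda>q. \<psi> q [X q, Y q]) \<circ> chart_inv c) has_derivative F) (at (snd c p))"
    using diff_at_chart[OF c diff_at_fields[OF X Y]] .
  have F': "(((\<lambda>q. \<psi> q [Y q, X q]) \<circ> chart_inv c) has_derivative (\<lambda>v. \<sigma> * F v)) (at (snd c p))"
    using has_derivative_mult_right[OF F, of \<sigma>]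
    by (simp add: o_def swap[of _ "Y _" "X _"])
  have "dir_deriv \<A> p w (\<lambda>q. \<psi> q [Y q, X q]) = \<sigma> * dir_deriv \<A> p w (\<lambda>q. \<psi> q [X q, Y q])"
    by (simp only: dir_deriv_eq[OF c w F'] dir_deriv_eq[OF c w F])
  moreover have "\<psi> p [D p w Y, X p] = \<sigma> * \<psi> p [X p, D p w Y]" "\<psi> p [Y p, D p w X] = \<sigma> * \<psi> p [D p w X, Y p]"
    by (rule swap)+
  ultimately show ?thesis unfolding nabla_fields_def by (simp add: right_diff_distrib)
qed

lemma nabla_fields_local:
  assumes w: "w \<in> tangent_space \<A> p"
    and X: "vector_field_near \<A> p X" "vector_field_near \<A> p X'" and Y: "vector_field_near \<A> p Y"
    and N: "open N" "p \<in> N" "\<And>q. q \<in> N \<Longrightarrow> X q = X' q"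
  shows "nabla_fields \<psi> p w X Y = nabla_fields \<psi> p w X' Y"
proof -
  obtain c where c: "c \<in> charts_at \<A> p" using charts_at_nonempty by blast
  obtain F where F: "(((\<lambda>q. \<psi> q [X q, Y q]) \<circ> chart_inv c) has_derivative F) (at (snd c p))"
    using diff_at_chart[OF c diff_at_fields[OF X(1) Y]] .
  have F': "(((\<lambda>q. \<psi> q [X' q, Y q]) \<circ> chart_inv c) has_derivative F) (at (snd c p))"
    by (rule has_derivative_chart_cong[OF c N(1,2) _ F]) (simp add: N(3))
  have "dir_deriv \<A> p w (\<lambda>q. \<psi> q [X q, Y q]) = dir_deriv \<A> p w (\<lambda>q. \<psi> q [X' q, Y q])"
    by (simp only: dir_deriv_eq[OF c w F'] dir_deriv_eq[OF c w F])
  then show ?thesis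
    unfolding nabla_fields_def using D_local[OF w X N] N(3)[OF N(2)] by simp
qed

text \<open>Shaped as one step of a frame expansion, with \<open>Z\<close> the remaining partial
  sum. The derivative of \<open>f\<close> arises once from differentiating the value of \<psi> and
  once, with opposite sign, from the product rule for \<open>D\<close>, and cancels.\<close>

lemma nabla_fields_scale_add:
  assumes w: "w \<in> tangent_space \<A> p" and f: "smooth_fun_near \<A> p f"
    and X: "vector_field_near \<A> p X" and fX: "vector_field_near \<A> p (\<lambda>q c. f q *\<^sub>R X q c)"
    and Z: "vector_field_near \<A> p Z" and Y: "vector_field_near \<A> p Y"
  shows "nabla_fields \<psi> p w (\<lambda>q c. f q *\<^sub>R X q c + Z q c) Y
    = f p *\<^sub>R nabla_fields \<psi> p w X Y + nabla_fields \<psi> p w Z Y"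
proof -
  obtain c where c: "c \<in> charts_at \<A> p" using charts_at_nonempty by blast
  have inv: "chart_inv c (snd c p) = p" using chart_inv_left[OF c] .
  obtain F where F: "(((\<lambda>q. \<psi> q [X q, Y q]) \<circ> chart_inv c) has_derivative F) (at (snd c p))"
    using diff_at_chart[OF c diff_at_fields[OF X Y]] .
  obtain G where G: "(((\<lambda>q. \<psi> q [Z q, Y q]) \<circ> chart_inv c) has_derivative G) (at (snd c p))"
    using diff_at_chart[OF c diff_at_fields[OF Z Y]] .
  obtain H where H: "((f \<circ> chart_inv c) has_derivative H) (at (snd c p))"
    using smooth_fun_near_diff[OF f c] .
  obtain N1 N2 N3 where
    N1: "open N1" "p \<in> N1" "\<And>q. q \<in> N1 \<Longrightarrow> X q \<in> tangent_space \<A> q" and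
    N2: "open N2" "p \<in> N2" "\<And>q. q \<in> N2 \<Longrightarrow> Y q \<in> tangent_space \<A> q" and
    N3: "open N3" "p \<in> N3" "\<And>q. q \<in> N3 \<Longrightarrow> Z q \<in> tangent_space \<A> q"
    using vector_field_nearD[OF X] vector_field_nearD[OF Y] vector_field_nearD[OF Z] by metis
  let ?XZ = "\<lambda>q c. f q *\<^sub>R X q c + Z q c"
  have split: "\<psi> q [?XZ q, Y q] = f q *\<^sub>R \<psi> q [X q, Y q] + \<psi> q [Z q, Y q]"
    if "q \<in> N1 \<inter> N2 \<inter> N3" for q
    using tensors2_left[OF mem_tensors N1(3) N3(3) N2(3), of q "f q" 1] that by simp
  have "(((\<lambda>q. f q *\<^sub>R \<psi> q [X q, Y q] + \<psi> q [Z q, Y q]) \<circ> chart_inv c) has_derivative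
      (\<lambda>v. f p *\<^sub>R F v + H v *\<^sub>R \<psi> p [X p, Y p] + G v)) (at (snd c p))"
    using has_derivative_add[OF has_derivative_scaleR[OF H F] G] by (simp add: o_def inv)
  then have F': "(((\<lambda>q. \<psi> q [?XZ q, Y q]) \<circ> chart_inv c) has_derivative
      (\<lambda>v. f p *\<^sub>R F v + H v *\<^sub>R \<psi> p [X p, Y p] + G v)) (at (snd c p))"
    by (rule has_derivative_chart_cong[OF c _ _ _, of "N1 \<inter> N2 \<inter> N3", rotated 3])
      (use N1 N2 N3 split in auto)
  have 1: "dir_deriv \<A> p w (\<lambda>q. \<psi> q [?XZ q, Y q])
    = f p *\<^sub>R dir_deriv \<A> p w (\<lambda>q. \<psi> q [X q, Y q]) + dir_deriv \<A> p w f *\<^sub>R \<psi> p [X p, Y p]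
      + dir_deriv \<A> p w (\<lambda>q. \<psi> q [Z q, Y q])"
    by (simp only: dir_deriv_eq[OF c w F] dir_deriv_eq[OF c w G] dir_deriv_eq[OF c w H]
        dir_deriv_eq[OF c w F'])
  have mem: "X p \<in> tangent_space \<A> p" "Y p \<in> tangent_space \<A> p" "Z p \<in> tangent_space \<A> p"
    using X Y Z vector_field_near_mem by auto
  have Dm: "D p w X \<in> tangent_space \<A> p" "D p w Y \<in> tangent_space \<A> p" "D p w Z \<in> tangent_space \<A> p"
    using D_mem[OF w] X Y Z by auto
  let ?D = "\<lambda>c. dir_deriv \<A> p w f *\<^sub>R X p c + f p *\<^sub>R D p w X c"
  \<comment> \<open>The factors 1 bring the sum into the linear combination form of
    \<open>tensors2_left\<close>.\<close>
  have "D p w ?XZ = (\<lambda>c. 1 *\<^sub>R ?D c + 1 *\<^sub>R D p w Z c)"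
    using D_add[OF w fX Z] D_scale[OF w f X] by simp
  then have 2: "\<psi> p [D p w ?XZ, Y p]
    = dir_deriv \<A> p w f *\<^sub>R \<psi> p [X p, Y p] + f p *\<^sub>R \<psi> p [D p w X, Y p] + \<psi> p [D p w Z, Y p]"
    using tensors2_left[OF mem_tensors tangent_lincomb[OF mem(1) Dm(1)] Dm(3) mem(2), of 1 _ _ 1]
      tensors2_left[OF mem_tensors mem(1) Dm(1) mem(2)] by simp
  have 3: "\<psi> p [?XZ p, D p w Y] = f p *\<^sub>R \<psi> p [X p, D p w Y] + \<psi> p [Z p, D p w Y]"
    using tensors2_left[OF mem_tensors mem(1) mem(3) Dm(2), of "f p" 1] by simp
  show ?thesis
    unfolding nabla_fields_def 1 2 3 by (simp add: scaleR_diff_right)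
qed

lemma nabla_fields_direction:
  assumes w: "w \<in> tangent_space \<A> p" "w' \<in> tangent_space \<A> p"
    and X: "vector_field_near \<A> p X" and Y: "vector_field_near \<A> p Y"
  shows "nabla_fields \<psi> p (\<lambda>c. a *\<^sub>R w c + b *\<^sub>R w' c) X Y
    = a *\<^sub>R nabla_fields \<psi> p w X Y + b *\<^sub>R nabla_fields \<psi> p w' X Y"
proof -
  obtain c where c: "c \<in> charts_at \<A> p" using charts_at_nonempty by blast
  obtain F where F: "(((\<lambda>q. \<psi> q [X q, Y q]) \<circ> chart_inv c) has_derivative F) (at (snd c p))"
    using diff_at_chart[OF c diff_at_fields[OF X Y]] .
  have "linear F" by (rule bounded_linear.linear[OF has_derivative_bounded_linear[OF F]])
  then have 1: "dir_deriv \<A> p (\<lambda>c. a *\<^sub>R w c + b *\<^sub>R w' c) (\<lambda>q. \<psi> q [X q, Y q])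
    = a *\<^sub>R dir_deriv \<A> p w (\<lambda>q. \<psi> q [X q, Y q]) + b *\<^sub>R dir_deriv \<A> p w' (\<lambda>q. \<psi> q [X q, Y q])"
    using dir_deriv_eq[OF c _ F] w tangent_lincomb[OF w]
    by (simp add: linear_add linear_scale)
  have mem: "X p \<in> tangent_space \<A> p" "Y p \<in> tangent_space \<A> p"
    using X Y vector_field_near_mem by auto
  have l: "\<psi> p [\<lambda>c. a *\<^sub>R D p w Z c + b *\<^sub>R D p w' Z c, y] = a *\<^sub>R \<psi> p [D p w Z, y] + b *\<^sub>R \<psi> p [D p w' Z, y]"
    if "vector_field_near \<A> p Z" "y \<in> tangent_space \<A> p" for Z y
    using tensors2_left[OF mem_tensors D_mem[OF w(1)] D_mem[OF w(2)]] that by blast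
  have 2: "\<psi> p [D p (\<lambda>c. a *\<^sub>R w c + b *\<^sub>R w' c) X, Y p]
    = a *\<^sub>R \<psi> p [D p w X, Y p] + b *\<^sub>R \<psi> p [D p w' X, Y p]"
    unfolding D_direction[OF w X] using l[OF X mem(2)] .
  have 3: "\<psi> p [X p, D p (\<lambda>c. a *\<^sub>R w c + b *\<^sub>R w' c) Y]
    = a *\<^sub>R \<psi> p [X p, D p w Y] + b *\<^sub>R \<psi> p [X p, D p w' Y]"
    \<comment> \<open>Linearity in the second slot is reduced to the first by the swap rule.\<close>
    unfolding D_direction[OF w Y] swap[of p "X p"] l[OF Y mem(1)] by (simp add: ring_distribs)
  show ?thesis
    unfolding nabla_fields_def 1 2 3 by (simp add: scaleR_diff_right)
qed

text \<open>The partial sums of the expansion of \<open>X\<close> in the frame of the chart are smooth fields, so the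
  expansion is obtained by induction.\<close>

lemma nabla_fields_expand_left:
  assumes w: "w \<in> tangent_space \<A> p" and c: "c \<in> charts_at \<A> p"
    and X: "vector_field_near \<A> p X" and Y: "vector_field_near \<A> p Y"
  shows "nabla_fields \<psi> p w X Y = (\<Sum>b\<in>Basis. (X p c \<bullet> b) *\<^sub>R nabla_fields \<psi> p w (coord_field c b) Y)"
proof -
  have cA: "c \<in> \<A>" "p \<in> fst c" using c unfolding charts_at_iff by auto
  obtain N where N: "open N" "p \<in> N" "N \<subseteq> fst c" "\<And>q. q \<in> N \<Longrightarrow> X q \<in> tangent_space \<A> q"
    "smooth_on (snd c ` N) (\<lambda>x. X (chart_inv c x) c)"
    using vector_field_near_chart[OF X c] by blast
  have o: "open (snd c ` N)" using open_chart_image[OF cA(1) N(1,3)] .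
  have ch: "c \<in> charts_at \<A> q" if "q \<in> N" for q using charts_atI[OF cA(1)] that N(3) by blast
  \<comment> \<open>Truncating the components by a linear map keeps every partial sum
    \<open>XB B\<close> smooth on \<open>N\<close>.\<close>
  define P where "P B v = (\<Sum>b\<in>B. (v \<bullet> b) *\<^sub>R b)" for B and v :: 'e
  define XB where "XB B q = coord_field c (P B (X q c)) q" for B q
  have near: "vector_field_near \<A> p (XB B)" if "finite B" for B
  proof (rule vector_field_nearI[OF cA(1) N(1-3)])
    show "XB B q \<in> tangent_space \<A> q" if "q \<in> N" for q
      unfolding XB_def using coord_field_mem[OF ch[OF that]] .
    have "bounded_linear (P B)"
      unfolding P_def by (intro bounded_linear_sum bounded_linear_scaleR_const bounded_linear_inner_left)
    show "smooth_on (snd c ` N) (\<lambda>x. XB B (chart_inv c x) c)"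
    proof (rule smooth_on_cong[OF _ smooth_on_bounded_linear[OF \<open>bounded_linear (P B)\<close> N(5)]])
      show "P B (X (chart_inv c x) c) = XB B (chart_inv c x) c" if "x \<in> snd c ` N" for x
        unfolding XB_def using coord_field_apply[OF ch[OF chart_inv_image[OF cA(1) N(3) that]]] by simp
    qed
  qed
  have fsmooth: "smooth_fun_near \<A> p (\<lambda>q. X q c \<bullet> b)" for b
    using smooth_fun_nearI[OF cA(1) N(1-3), of "\<lambda>q. X q c \<bullet> b"] smooth_on_bounded_linear[OF bounded_linear_inner_left[of b] N(5)]
    by (simp add: o_def)
  have one: "smooth_fun_near \<A> p (\<lambda>q. 1)"
    by (rule smooth_fun_nearI[OF cA(1) N(1-3)]) (simp add: o_def smooth_on_const[OF o])
  have "nabla_fields \<psi> p w (XB B) Y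
      = (\<Sum>b\<in>B. (X p c \<bullet> b) *\<^sub>R nabla_fields \<psi> p w (coord_field c b) Y)" if "finite B" for B
    using that
  proof (induction B rule: finite_induct)
    case empty
    \<comment> \<open>\<open>XB {}\<close> is the zero field. Written as 1 times itself plus itself,
      its value n satisfies n = n + n, hence n = 0.\<close>
    have "(\<lambda>q c'. 1 *\<^sub>R XB {} q c' + XB {} q c') = XB {}"
      using coord_field_lincomb[of c 1 0 1 0] unfolding XB_def P_def by (simp add: fun_eq_iff)
    then show ?case
      using nabla_fields_scale_add[OF w one near[of "{}"] _ near[of "{}"] Y] near[of "{}"] by simp
  next
    case (insert b B)
    have "XB (insert b B) = (\<lambda>q c'. (X q c \<bullet> b) *\<^sub>R coord_field c b q c' + XB B q c')"
    proof
      fix q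
      show "XB (insert b B) q = (\<lambda>c'. (X q c \<bullet> b) *\<^sub>R coord_field c b q c' + XB B q c')"
        using coord_field_lincomb[of c "X q c \<bullet> b" b 1 "P B (X q c)" q] insert.hyps
        unfolding XB_def P_def by simp
    qed
    \<comment> \<open>Recognizing the scaled frame field as a partial sum supplies its
      smoothness.\<close>
    moreover have "XB {b} = (\<lambda>q c'. (X q c \<bullet> b) *\<^sub>R coord_field c b q c')"
    proof
      fix q
      show "XB {b} q = (\<lambda>c'. (X q c \<bullet> b) *\<^sub>R coord_field c b q c')"
        using coord_field_lincomb[of c "X q c \<bullet> b" b 0 0 q]
        unfolding XB_def P_def by simp
    qed
    ultimately show ?case
      using nabla_fields_scale_add[OF w fsmooth[of b] coord_field_near[OF c, of b] _ near[OF insert.hyps(1)] Y]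
        near[of "{b}"] insert by simp
  qed
  \<comment> \<open>The full sum reproduces \<open>X\<close> on \<open>N\<close> only, so locality
    has to finish the argument.\<close>
  moreover have "XB Basis q = X q" if "q \<in> N" for q
    using tangent_eq_coord_field[OF N(4)[OF that] ch[OF that]]
    unfolding XB_def P_def by (simp add: euclidean_representation)
  then have "nabla_fields \<psi> p w (XB Basis) Y = nabla_fields \<psi> p w X Y"
    using nabla_fields_local[OF w near[OF finite_Basis] X Y N(1,2)] by blast
  ultimately show ?thesis by simp
qed

text \<open>The second field is expanded by swapping, expanding on the left and swapping back. The
  right-hand side sees \<open>X\<close> and \<open>Y\<close> only through their values at
  \<open>p\<close>: this is the independence of the extensions.\<close>

lemma nabla_fields_expand:
  assumes w: "w \<in> tangent_space \<A> p" and c: "c \<in> charts_at \<A> p"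
    and X: "vector_field_near \<A> p X" and Y: "vector_field_near \<A> p Y"
  shows "nabla_fields \<psi> p w X Y = (\<Sum>b\<in>Basis. \<Sum>b'\<in>Basis. ((X p c \<bullet> b) * (Y p c \<bullet> b')) *\<^sub>R
    nabla_fields \<psi> p w (coord_field c b) (coord_field c b'))"
proof -
  have "nabla_fields \<psi> p w (coord_field c b) Y
    = (\<Sum>b'\<in>Basis. (Y p c \<bullet> b') *\<^sub>R nabla_fields \<psi> p w (coord_field c b) (coord_field c b'))" for b
  proof -
    note E = coord_field_near[OF c]
    have "nabla_fields \<psi> p w (coord_field c b) Y = \<sigma> * nabla_fields \<psi> p w Y (coord_field c b)"
      using nabla_fields_swap[OF w Y E] .
    also have "\<dots> = (\<Sum>b'\<in>Basis. (Y p c \<bullet> b') *\<^sub>R (\<sigma> * nabla_fields \<psi> p w (coord_field c b') (coord_field c b)))"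
      unfolding nabla_fields_expand_left[OF w c Y E] by (simp add: sum_distrib_left)
    finally show ?thesis unfolding nabla_fields_swap[OF w E E, symmetric] .
  qed
  then show ?thesis
    unfolding nabla_fields_expand_left[OF w c X Y] by (simp add: scaleR_sum_right)
qed

lemma nabla_tensor2_apply:
  assumes "u \<in> tangent_space \<A> p" "v \<in> tangent_space \<A> p" "w \<in> tangent_space \<A> p"
  shows "nabla_tensor2 \<A> D \<psi> p [u, v, w] = nabla_fields \<psi> p w (extend_vector \<A> p u) (extend_vector \<A> p v)"
  using assms extend_vector(2) unfolding nabla_tensor2_def nabla_fields_def Let_def by simp

lemma nabla_tensor2_swap:
  assumes "u \<in> tangent_space \<A> p" "v \<in> tangent_space \<A> p" "w \<in> tangent_space \<A> p"
  shows "nabla_tensor2 \<A> D \<psi> p [v, u, w] = \<sigma> * nabla_tensor2 \<A> D \<psi> p [u, v, w]"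
  unfolding nabla_tensor2_apply[OF assms] nabla_tensor2_apply[OF assms(2,1,3)]
  by (rule nabla_fields_swap[OF assms(3) extend_vector(1)[OF assms(1)] extend_vector(1)[OF assms(2)]])

text \<open>After the frame expansion the chosen extensions have disappeared: the coefficients are
  bilinear in the first two vectors, and \<open>G\<close> is linear in the direction of
  differentiation.\<close>

lemma nabla_tensor2_mem: "nabla_tensor2 \<A> D \<psi> p \<in> tensors 3 (tangent_space \<A> p)"
proof -
  let ?V = "tangent_space \<A> p" and ?T = "nabla_tensor2 \<A> D \<psi> p"
  obtain c where c: "c \<in> charts_at \<A> p" using charts_at_nonempty by blast
  define G where "G b b' w = nabla_fields \<psi> p w (coord_field c b) (coord_field c b')" for b b' w
  have T: "?T [u, v, w] = (\<Sum>b\<in>Basis. \<Sum>b'\<in>Basis. ((u c \<bullet> b) * (v c \<bullet> b')) *\<^sub>R G b b' w)"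
    if "u \<in> ?V" "v \<in> ?V" "w \<in> ?V" for u v w
    using nabla_tensor2_apply[OF that] nabla_fields_expand[OF that(3) c] extend_vector that
    by (simp add: G_def)
  have G: "G b b' (\<lambda>c. s *\<^sub>R w c + t *\<^sub>R w' c) = s *\<^sub>R G b b' w + t *\<^sub>R G b b' w'"
    if "w \<in> ?V" "w' \<in> ?V" for b b' w w' s t
    unfolding G_def using nabla_fields_direction[OF that] coord_field_near[OF c] by blast
  have "?T (vs[i := (\<lambda>c. s *\<^sub>R x c + t *\<^sub>R y c)]) = s *\<^sub>R ?T (vs[i := x]) + t *\<^sub>R ?T (vs[i := y])"
    if len: "length vs = 3" and m: "set vs \<subseteq> ?V" "i < 3" "x \<in> ?V" "y \<in> ?V" for vs i x y s t
  proof -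
    obtain u v w where vs: "vs = [u, v, w]"
      using len by (auto simp: length_Suc_conv numeral_3_eq_3)
    then have V: "u \<in> ?V" "v \<in> ?V" "w \<in> ?V" using m(1) by auto
    note mm = tangent_lincomb[OF m(3,4), of s t]
    consider "i = 0" | "i = 1" | "i = 2" using m(2) by linarith
    then show ?thesis
    proof cases
      case 1
      then show ?thesis
        using T[OF mm V(2,3)] T[OF m(3) V(2,3)] T[OF m(4) V(2,3)] vs
        by (simp add: algebra_simps inner_add_left scaleR_sum_right sum.distrib)
    next
      case 2
      then show ?thesis
        using T[OF V(1) mm V(3)] T[OF V(1) m(3) V(3)] T[OF V(1) m(4) V(3)] vs
        by (simp add: algebra_simps inner_add_left scaleR_sum_right sum.distrib)
    next
      case 3
      then show ?thesis
        using T[OF V(1,2) mm] T[OF V(1,2) m(3)] T[OF V(1,2) m(4)] vs G[OF m(3,4)]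
        by (simp add: algebra_simps scaleR_sum_right sum.distrib)
    qed
  qed
  moreover have "?T vs = 0" if "\<not> (length vs = 3 \<and> set vs \<subseteq> ?V)" for vs
    using that unfolding nabla_tensor2_def by auto
  ultimately show ?thesis unfolding tensors_def by blast
qed

end

section \<open>The shortest lengths\<close>

text \<open>Tensors are zero on lists that leave \<open>V\<close>, so the swap rule extends from
  \<open>V\<close> to all arguments, as the locale and the reduction require.\<close>

lemma sym_forms_swap:
  assumes "T \<in> sym_forms V"
  shows "T [v, u] = T [u, v]"
proof (cases "u \<in> V \<and> v \<in> V")
  case True
  then show ?thesis using assms unfolding sym_forms_def by blast
next
  case False
  have "T vs = 0" if "\<not> set vs \<subseteq> V" for vs
    using assms that unfolding sym_forms_def tensors_def by blast
  from this[of "[u, v]"] this[of "[v, u]"] False show ?thesis by auto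
qed

lemma alt_forms_swap:
  assumes "T \<in> alt_forms V"
  shows "T [v, u] = - T [u, v]"
proof (cases "u \<in> V \<and> v \<in> V")
  case True
  then show ?thesis using assms unfolding alt_forms_def by blast
next
  case False
  have "T vs = 0" if "\<not> set vs \<subseteq> V" for vs
    using assms that unfolding alt_forms_def tensors_def by blast
  from this[of "[u, v]"] this[of "[v, u]"] False show ?thesis by auto
qed

lemma swap_sign_two:
  fixes B :: "'v list \<Rightarrow> 'k::comm_ring_1"
  assumes B: "\<And>u v. B [v, u] = \<epsilon> * B [u, v]" and "length bs = 2"
  shows "B (map f bs) = swap_sign \<epsilon> bs * B (map f (sort bs))"
proof -
  obtain a b where bs: "bs = [a, b]"
    using assms(2) by (auto simp: numeral_2_eq_2 length_Suc_conv)
  show ?thesis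
    unfolding bs using B[of "f a" "f b"] by (simp add: swap_sign_def)
qed

lemma Young_products_eval:
  fixes I :: "((nat \<Rightarrow> nat) \<Rightarrow> 'k::field_char_0) set"
  assumes I: "gr_star ` I = solutions (of_int s)" and P: "admissible I P"
    and U: "\<And>us. length us = 3 \<Longrightarrow> (\<lambda>q. if q \<in> perms 3 then U (arrange q us) else 0) \<in> solutions (of_int s)"
    and S: "\<And>u v. S [v, u] = S [u, v]" and A: "\<And>u v. A [v, u] = - A [u, v]"
  shows "length vs = 4 \<Longrightarrow> act 4 (gr_star y_t) (tensor_prod 3 U w) vs = eval_expr (reduced_w I P) U w vs"
    and "length vs = 5 \<Longrightarrow> act 5 (gr_star y_t') (tensor_prod 3 U S) vs = eval_expr (reduced_S I P) U S vs"
    and "length vs = 5 \<Longrightarrow> act 5 (gr_star y_t') (tensor_prod 3 U A) vs = eval_expr (reduced_A I P) U A vs"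
proof -
  have one: "w (map f bs) = swap_sign 1 bs * w (map f (sort bs))" if "length bs = 1" for f and bs :: "nat list"
    using that by (auto simp: length_Suc_conv swap_sign_def)
  have S': "S [v, u] = 1 * S [u, v]" and A': "A [v, u] = - 1 * A [u, v]" for u v
    using S[of v u] A[of v u] by simp_all
  show "act 4 (gr_star y_t) (tensor_prod 3 U w) vs = eval_expr (reduced_w I P) U w vs" if "length vs = 4"
    unfolding reduced_w_def
  proof (rule act_eq_eval_reduced[OF I P])
    show "(\<lambda>q. if q \<in> perms 3 then U (arrange q us) else 0) \<in> solutions (of_int s)" if "length us = 3" for us
      using U[OF that] .
    show "w (map (\<lambda>k. vs ! (k - 1)) bs) = swap_sign 1 bs * w (map (\<lambda>k. vs ! (k - 1)) (sort bs))"
      if "length bs = 4 - 3" for bs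
      by (rule one) (use that in simp_all)
  qed (use that in simp_all)
  show "act 5 (gr_star y_t') (tensor_prod 3 U S) vs = eval_expr (reduced_S I P) U S vs" if "length vs = 5"
    unfolding reduced_S_def
  proof (rule act_eq_eval_reduced[OF I P])
    show "(\<lambda>q. if q \<in> perms 3 then U (arrange q us) else 0) \<in> solutions (of_int s)" if "length us = 3" for us
      using U[OF that] .
    show "S (map (\<lambda>k. vs ! (k - 1)) bs) = swap_sign 1 bs * S (map (\<lambda>k. vs ! (k - 1)) (sort bs))"
      if "length bs = 5 - 3" for bs
      using that by (intro swap_sign_two[where B = S, OF S']) simp
  qed (use that in simp_all)
  show "act 5 (gr_star y_t') (tensor_prod 3 U A) vs = eval_expr (reduced_A I P) U A vs" if "length vs = 5"
    unfolding reduced_A_def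
  proof (rule act_eq_eval_reduced[OF I P])
    show "(\<lambda>q. if q \<in> perms 3 then U (arrange q us) else 0) \<in> solutions (of_int s)" if "length us = 3" for us
      using U[OF that] .
    show "A (map (\<lambda>k. vs ! (k - 1)) bs) = swap_sign (- 1) bs * A (map (\<lambda>k. vs ! (k - 1)) (sort bs))"
      if "length bs = 5 - 3" for bs
      using that by (intro swap_sign_two[where B = A, OF A']) simp
  qed (use that in simp_all)
qed

text \<open>The witnesses are \<open>xi (1 - \<sigma>)\<close> and \<open>T\<close> itself; lists of
  other lengths are compared separately because \<open>act\<close> is zero on them.\<close>

lemma symmetry_classI:
  fixes T :: "('c \<Rightarrow> 'e::real_vector) list \<Rightarrow> 'k::real_normed_field"
  assumes sign: "\<sigma> * \<sigma> = 1" and swap: "\<And>x y z. T [y, x, z] = \<sigma> * T [x, y, z]"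
    and T: "T \<in> tensors 3 V"
    and U: "\<And>x y z. U [x, y, z] = T [x, y, z] - (T [x, y, z] + T [y, z, x] + T [z, x, y]) / 3"
    and U0: "\<And>vs. length vs \<noteq> 3 \<Longrightarrow> U vs = 0"
  shows "U \<in> symmetry_class 3 (right_ideal_gen 3 (xi (1 - \<sigma>))) V"
proof -
  have "U = act 3 (xi (1 - \<sigma>)) T"
  proof
    fix vs show "U vs = act 3 (xi (1 - \<sigma>)) T vs"
    proof (cases "length vs = 3")
      case True
      then obtain x y z where "vs = [x, y, z]"
        by (auto simp: numeral_3_eq_3 length_Suc_conv)
      then show ?thesis using act_xi_eq[where T = T and U = U, OF sign swap U] by simp
    next
      case False
      then show ?thesis using U0 by (simp add: act_def)
    qed
  qed
  then show ?thesis unfolding symmetry_class_def using T xi_mem by blast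
qed

lemma (in signed_form_field) nabla_tensor2_swap_all:
  "nabla_tensor2 \<A> D \<psi> p [y, x, z] = \<sigma> * nabla_tensor2 \<A> D \<psi> p [x, y, z]"
proof (cases "set [x, y, z] \<subseteq> tangent_space \<A> p")
  case True
  then show ?thesis by (intro nabla_tensor2_swap) simp_all
next
  case False
  then have False': "\<not> set [y, x, z] \<subseteq> tangent_space \<A> p" by auto
  have zero: "nabla_tensor2 \<A> D \<psi> p vs = 0" if "\<not> set vs \<subseteq> tangent_space \<A> p" for vs
    using that unfolding nabla_tensor2_def by presburger
  show ?thesis unfolding zero[OF False] zero[OF False'] by simp
qed

theorem theorem1p11:
  fixes \<A> :: "('m::{t2_space, second_countable_topology}, 'e::euclidean_space) chart set"
    and D :: "('m, 'e) connection"
    and p :: 'm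
    and V :: "('m, 'e) tvec set"
    and \<psi> \<omega> :: "'m \<Rightarrow> ('m, 'e) tvec list \<Rightarrow> 'k::real_normed_field"
    and S A w U\<^sub>s U\<^sub>a :: "('m, 'e) tvec list \<Rightarrow> 'k"
    and \<rr>\<^sub>s \<rr>\<^sub>a :: "((nat \<Rightarrow> nat) \<Rightarrow> 'k) set"
  assumes "smooth_atlas \<A>" and "DIM('e) \<ge> 3"
    and "covariant_derivative \<A> D" and "torsion_free \<A> D"
    and "V = tangent_space \<A> p"
    and "S \<in> sym_forms V" and "A \<in> alt_forms V" and "w \<in> tensors 1 V"
    and "diff_tensor_field2 \<A> \<psi>" and "\<And>q. \<psi> q \<in> sym_forms (tangent_space \<A> q)"
    and "diff_tensor_field2 \<A> \<omega>" and "\<And>q. \<omega> q \<in> alt_forms (tangent_space \<A> q)"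
    and "U\<^sub>s = (\<lambda>vs. nabla_tensor2 \<A> D \<psi> p vs - symmetrize 3 (nabla_tensor2 \<A> D \<psi> p) vs)"
    and "U\<^sub>a = (\<lambda>vs. nabla_tensor2 \<A> D \<omega> p vs - alternate 3 (nabla_tensor2 \<A> D \<omega> p) vs)"
    and "\<rr>\<^sub>s = ideal_s" and "\<rr>\<^sub>a = ideal_a"
  shows
    \<comment> \<open>the tensors lie in the stated symmetry classes\<close>
    "U\<^sub>s \<in> symmetry_class 3 \<rr>\<^sub>s V \<and> U\<^sub>a \<in> symmetry_class 3 \<rr>\<^sub>a V \<and>
     \<comment> \<open>the reduced expressions represent the coordinates of the Young symmetrized products\<close>
     (\<forall>(\<rr>, U) \<in> {(\<rr>\<^sub>s, U\<^sub>s), (\<rr>\<^sub>a, U\<^sub>a)}. \<forall>P. admissible \<rr> P \<longrightarrow>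
        (\<forall>vs. length vs = 4 \<and> set vs \<subseteq> V \<longrightarrow>
           act 4 (gr_star y_t) (tensor_prod 3 U w) vs = eval_expr (reduced_w \<rr> P) U w vs) \<and>
        (\<forall>vs. length vs = 5 \<and> set vs \<subseteq> V \<longrightarrow>
           act 5 (gr_star y_t') (tensor_prod 3 U S) vs = eval_expr (reduced_S \<rr> P) U S vs \<and>
           act 5 (gr_star y_t') (tensor_prod 3 U A) vs = eval_expr (reduced_A \<rr> P) U A vs)) \<and>
     \<comment> \<open>4, 12 and 10 are the shortest lengths, attained exactly in the listed cases\<close>
     (\<forall>\<rr> \<in> {\<rr>\<^sub>s, \<rr>\<^sub>a}. 4 \<le> length_w \<rr> \<and> 12 \<le> length_S \<rr> \<and> 10 \<le> length_A \<rr>) \<and>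
     length_w \<rr>\<^sub>s \<noteq> 4 \<and> length_S \<rr>\<^sub>s = 12 \<and> length_A \<rr>\<^sub>s \<noteq> 10 \<and>
     length_w \<rr>\<^sub>a = 4 \<and> length_S \<rr>\<^sub>a = 12 \<and> length_A \<rr>\<^sub>a = 10"
proof -
  note V = \<open>V = tangent_space \<A> p\<close>
  interpret s: signed_form_field \<A> D \<psi> 1
  proof unfold_locales
    show "\<psi> q [v, u] = 1 * \<psi> q [u, v]" for q u v
      using sym_forms_swap[OF assms(10), of q v u] by simp
  qed (use assms(1,3,9) in simp_all)
  interpret a: signed_form_field \<A> D \<omega> "- 1"
  proof unfold_locales
    show "\<omega> q [v, u] = - 1 * \<omega> q [u, v]" for q u v
      using alt_forms_swap[OF assms(12), of q v u] by simp
  qed (use assms(11) in simp_all)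
  let ?Ts = "nabla_tensor2 \<A> D \<psi> p" and ?Ta = "nabla_tensor2 \<A> D \<omega> p"
  have "?Ts [y, x, z] = ?Ts [x, y, z]" "?Ta [y, x, z] = - ?Ta [x, y, z]" for x y z
    using s.nabla_tensor2_swap_all[of p y x z] a.nabla_tensor2_swap_all[of p y x z] by simp_all
  note sym = symmetrize_3[of ?Ts, OF this(1)] and alt = alternate_3[of ?Ta, OF this(2)]
  have Us: "U\<^sub>s [x, y, z] = ?Ts [x, y, z] - (?Ts [x, y, z] + ?Ts [y, z, x] + ?Ts [z, x, y]) / 3" for x y z
    unfolding assms(13) sym ..
  have Ua: "U\<^sub>a [x, y, z] = ?Ta [x, y, z] - (?Ta [x, y, z] + ?Ta [y, z, x] + ?Ta [z, x, y]) / 3" for x y z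
    unfolding assms(14) alt ..
  have zero: "U\<^sub>s vs = 0" "U\<^sub>a vs = 0" if "length vs \<noteq> 3" for vs
    unfolding assms(13,14) using that
    by (simp_all add: nabla_tensor2_def symmetrize_def alternate_def act_def)
  have ideals: "\<rr>\<^sub>s = right_ideal_gen 3 (xi (1 - 1))" "\<rr>\<^sub>a = right_ideal_gen 3 (xi (1 - - 1))"
    unfolding assms(15,16) ideal_s_def ideal_a_def by simp_all
  have Is: "gr_star ` \<rr>\<^sub>s = solutions (of_int 1)" and Ia: "gr_star ` \<rr>\<^sub>a = solutions (of_int (- 1))"
    unfolding ideals using star_ideal_eq[of "1::'k"] star_ideal_eq[of "- 1::'k"] by simp_all
  have class_s: "U\<^sub>s \<in> symmetry_class 3 \<rr>\<^sub>s V"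
    unfolding ideals V
    by (rule symmetry_classI[where T = ?Ts and U = U\<^sub>s,
          OF s.sign s.nabla_tensor2_swap_all s.nabla_tensor2_mem Us zero(1)])
  have class_a: "U\<^sub>a \<in> symmetry_class 3 \<rr>\<^sub>a V"
    unfolding ideals V
    by (rule symmetry_classI[where T = ?Ta and U = U\<^sub>a,
          OF a.sign a.nabla_tensor2_swap_all a.nabla_tensor2_mem Ua zero(2)])
  have sol:
    "(\<lambda>q. if q \<in> perms 3 then U\<^sub>s (arrange q us) else 0) \<in> solutions (of_int 1)"
    "(\<lambda>q. if q \<in> perms 3 then U\<^sub>a (arrange q us) else 0) \<in> solutions (of_int (- 1))"
    if "length us = 3" for us
    using coordinates_solutions[where T = ?Ts and U = U\<^sub>s, OF s.sign s.nabla_tensor2_swap_all Us that]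
      coordinates_solutions[where T = ?Ta and U = U\<^sub>a, OF a.sign a.nabla_tensor2_swap_all Ua that]
    by simp_all
  note evals =
    Young_products_eval[where U = U\<^sub>s and S = S and A = A, OF Is _ sol(1) sym_forms_swap[OF assms(6)] alt_forms_swap[OF assms(7)]]
    Young_products_eval[where U = U\<^sub>a and S = S and A = A, OF Ia _ sol(2) sym_forms_swap[OF assms(6)] alt_forms_swap[OF assms(7)]]
  have eval: "\<forall>(\<rr>, U) \<in> {(\<rr>\<^sub>s, U\<^sub>s), (\<rr>\<^sub>a, U\<^sub>a)}. \<forall>P. admissible \<rr> P \<longrightarrow>
        (\<forall>vs. length vs = 4 \<and> set vs \<subseteq> V \<longrightarrow>
           act 4 (gr_star y_t) (tensor_prod 3 U w) vs = eval_expr (reduced_w \<rr> P) U w vs) \<and>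
        (\<forall>vs. length vs = 5 \<and> set vs \<subseteq> V \<longrightarrow>
           act 5 (gr_star y_t') (tensor_prod 3 U S) vs = eval_expr (reduced_S \<rr> P) U S vs \<and>
           act 5 (gr_star y_t') (tensor_prod 3 U A) vs = eval_expr (reduced_A \<rr> P) U A vs)"
    unfolding ball_simps prod.case using evals by blast
  \<comment> \<open>Exact values also for the symmetric case: 8 and 20 give the two strict
    inequalities behind the unequal lengths.\<close>
  have lengths: "length_w \<rr>\<^sub>s = 8" "length_S \<rr>\<^sub>s = 12" "length_A \<rr>\<^sub>s = 20"
    "length_w \<rr>\<^sub>a = 4" "length_S \<rr>\<^sub>a = 12" "length_A \<rr>\<^sub>a = 10"
    by (rule length_eqs(1)[OF Is minimal_counts(1)] length_eqs(2)[OF Is minimal_counts(3)]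
        length_eqs(3)[OF Is minimal_counts(5)] length_eqs(1)[OF Ia minimal_counts(2)]
        length_eqs(2)[OF Ia minimal_counts(4)] length_eqs(3)[OF Ia minimal_counts(6)])+
  show ?thesis by (intro conjI class_s class_a eval) (simp_all add: lengths)
qed

end
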